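(* Let $G$ be a finitely generated group and $H$ an infinite subgroup of $G$. Then the following are equivalent: (1) $H$ is stable in $G$. (2) $H$ is hyperbolic and strongly quasiconvex in $G$. (3) $H$ is hyperbolic and the lower relative divergence of $G$ with respect to $H$ is completely super linear.
   Context: A $(K,L)$-quasi-isometric embedding $\Phi$ satisfies $\frac1Kd(x,y)-L\le d(\Phi(x),\Phi(y))\le Kd(x,y)+L$; a $(K,L)$-quasi-geodesic is such an embedding of an interval of $\mathbb{R}$. A subgroup $H$ of a finitely generated group $G$ is strongly quasiconvex if, in the Cayley graph of $G$ for some (any) finite generating set, for every $K\ge1$, $C\ge0$ there is $M(K,C)$ such that every $(K,C)$-quasi-geodesic with endpoints on $H$ lies in the $M(K,C)$-neighborhood of $H$. $H$ is stable in $G$ if it is finitely generated, undistorted (inclusion is a quasi-isometric embedding), and for all $K\ge1,L\ge0$ there is $R(K,L)$ such that any two $(K,L)$-quasi-geodesics in the Cayley graph of $G$ with the same endpoints in $H$ are at Hausdorff distance less than $R(K,L)$. "Hyperbolic" means finitely generated and Gromov hyperbolic. Lower relative divergence: let $X$ be a geodesic space, $A\subset X$ of infinite diameter. Put $N_r(A)=\{x: d(x,A)<r\}$, $\partial N_r(A)=\{x: d(x,A)=r\}$, and let $d_r$ be the induced length metric on $X-N_r(A)$ (value $\infty$ if there is no connecting rectifiable path). For $\rho\in(0,1]$, integer $n\ge2$ and $r>0$ let $\sigma^n_\rho(r)=\inf d_{\rho r}(x_1,x_2)$ over all $x_1,x_2\in\partial N_r(A)$ with $d_r(x_1,x_2)<\infty$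 and $d(x_1,x_2)\ge nr$, and $\sigma^n_\rho(r)=\infty$ if no such pair exists. The family $\{\sigma^n_\rho\}$ is $div(X,A)$; the lower relative divergence of $G$ with respect to $H$ is $div$ of a Cayley graph of $G$ (finite generating set) with respect to $H$. A function $f:[0,\infty)\to[0,\infty]$ is completely super linear if for every $C>0$ the set $\{x: f(x)\le Cx\}$ is bounded; a family $\{\delta^n_\rho\}$ is completely super linear if there is $n_0\ge3$ such that $\delta^{n_0}_\rho$ is completely super linear for all $\rho\in(0,1]$. *)

theory Defs
  imports "HOL-Analysis.Analysis" "HOL-Algebra.Generated_Groups"
begin

section \<open>Coarse geometry of abstract metric spaces\<close>

definition quasi_isometric_embedding ::
    "real \<Rightarrow> real \<Rightarrow> 'p metric \<Rightarrow> 'q metric \<Rightarrow> ('p \<Rightarrow> 'q) \<Rightarrow> bool" where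
  "quasi_isometric_embedding K L m1 m2 f \<longleftrightarrow>
     f ` mspace m1 \<subseteq> mspace m2 \<and>
     (\<forall>x\<in>mspace m1. \<forall>y\<in>mspace m1.
        mdist m1 x y / K - L \<le> mdist m2 (f x) (f y) \<and>
        mdist m2 (f x) (f y) \<le> K * mdist m1 x y + L)"

text \<open>Quasi-geodesics need not be continuous. Only the values of \<open>c\<close> on \<open>{a..b}\<close> matter.\<close>

definition quasi_geodesic ::
    "real \<Rightarrow> real \<Rightarrow> 'p metric \<Rightarrow> real \<Rightarrow> real \<Rightarrow> (real \<Rightarrow> 'p) \<Rightarrow> bool" where
  "quasi_geodesic K L m a b c \<longleftrightarrow>
     a \<le> b \<and> quasi_isometric_embedding K L (submetric euclidean_metric {a..b}) m c"

definition geodesic_segment :: "'p metric \<Rightarrow> 'p \<Rightarrow> 'p \<Rightarrow> 'p set \<Rightarrow> bool" where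
  "geodesic_segment m x y \<gamma> \<longleftrightarrow>
     (\<exists>l\<ge>0. \<exists>c. c ` {0..l} \<subseteq> mspace m \<and> c 0 = x \<and> c l = y \<and> \<gamma> = c ` {0..l} \<and>
        (\<forall>s\<in>{0..l}. \<forall>t\<in>{0..l}. mdist m (c s) (c t) = \<bar>s - t\<bar>))"

definition geodesic_space :: "'p metric \<Rightarrow> bool" where
  "geodesic_space m \<longleftrightarrow> (\<forall>x\<in>mspace m. \<forall>y\<in>mspace m. \<exists>\<gamma>. geodesic_segment m x y \<gamma>)"

text \<open>A geodesic space is Gromov hyperbolic if its geodesic triangles are uniformly slim.
  Slimness is demanded of one side only; relabelling the vertices gives the other two sides.\<close>

definition Gromov_hyperbolic :: "'p metric \<Rightarrow> bool" where
  "Gromov_hyperbolic m \<longleftrightarrow>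
     geodesic_space m \<and>
     (\<exists>\<delta>\<ge>0. \<forall>x y z \<alpha> \<beta> \<gamma>.
        geodesic_segment m x y \<alpha> \<and> geodesic_segment m y z \<beta> \<and> geodesic_segment m z x \<gamma> \<longrightarrow>
        (\<forall>p\<in>\<alpha>. \<exists>q\<in>\<beta> \<union> \<gamma>. mdist m p q \<le> \<delta>))"

text \<open>The distance to a set is meaningful for nonempty \<open>A\<close> only.\<close>

definition dist_to_set :: "'p metric \<Rightarrow> 'p \<Rightarrow> 'p set \<Rightarrow> real" where
  "dist_to_set m x A = (INF a\<in>A. mdist m x a)"

definition nbhd :: "'p metric \<Rightarrow> real \<Rightarrow> 'p set \<Rightarrow> 'p set" where
  "nbhd m r A = {x \<in> mspace m. dist_to_set m x A < r}"

definition nbhd_boundary :: "'p metric \<Rightarrow> real \<Rightarrow> 'p set \<Rightarrow> 'p set" where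
  "nbhd_boundary m r A = {x \<in> mspace m. dist_to_set m x A = r}"

definition Hausdorff_distance :: "'p metric \<Rightarrow> 'p set \<Rightarrow> 'p set \<Rightarrow> ennreal" where
  "Hausdorff_distance m A B =
     max (SUP x\<in>A. INF y\<in>B. ennreal (mdist m x y)) (SUP y\<in>B. INF x\<in>A. ennreal (mdist m x y))"


section \<open>Lower relative divergence\<close>

definition path_length :: "'p metric \<Rightarrow> (real \<Rightarrow> 'p) \<Rightarrow> ennreal" where
  "path_length m g =
     (SUP ts\<in>{ts. sorted ts \<and> set ts \<subseteq> {0..1}}.
        \<Sum>i<length ts - 1. ennreal (mdist m (g (ts ! i)) (g (ts ! Suc i))))"

text \<open>Non-rectifiable paths have length \<open>\<infinity>\<close>, so the infimum is \<open>\<infinity>\<close> exactly when \<open>Y\<close> contains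
  no rectifiable path from \<open>x\<close> to \<open>y\<close>.\<close>

definition induced_length_dist :: "'p metric \<Rightarrow> 'p set \<Rightarrow> 'p \<Rightarrow> 'p \<Rightarrow> ennreal" where
  "induced_length_dist m Y x y =
     (INF g\<in>{g. pathin (mtopology_of (submetric m Y)) g \<and> g 0 = x \<and> g 1 = y}. path_length m g)"

text \<open>The family \<open>div(X,A)\<close>; \<open>lower_divergence m A n \<rho> r\<close> is \<open>\<sigma>\<^sup>n\<^sub>\<rho>(r)\<close>.
  The infimum over the empty set is \<open>\<infinity>\<close>.\<close>

definition lower_divergence :: "'p metric \<Rightarrow> 'p set \<Rightarrow> nat \<Rightarrow> real \<Rightarrow> real \<Rightarrow> ennreal" where
  "lower_divergence m A n \<rho> r =
     (INF (x, y)\<in>{(x, y). x \<in> nbhd_boundary m r A \<and> y \<in> nbhd_boundary m r A \<and>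
                          induced_length_dist m (mspace m - nbhd m r A) x y < \<infinity> \<and>
                          real n * r \<le> mdist m x y}.
        induced_length_dist m (mspace m - nbhd m (\<rho> * r) A) x y)"

definition completely_super_linear :: "(real \<Rightarrow> ennreal) \<Rightarrow> bool" where
  "completely_super_linear f \<longleftrightarrow> (\<forall>C>0. bounded {x. 0 \<le> x \<and> f x \<le> ennreal (C * x)})"

definition completely_super_linear_family :: "(nat \<Rightarrow> real \<Rightarrow> real \<Rightarrow> ennreal) \<Rightarrow> bool" where
  "completely_super_linear_family \<delta> \<longleftrightarrow>
     (\<exists>n0\<ge>3. \<forall>\<rho>. 0 < \<rho> \<and> \<rho> \<le> 1 \<longrightarrow> completely_super_linear (\<delta> n0 \<rho>))"


section \<open>Geometric realisation of a graph\<close>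

text \<open>Points of the realisation are given by barycentric coordinates. The metric is the path
  metric in which every edge is isometric to \<open>[0,1]\<close>: the infimum of the lengths of the piecewise
  linear paths between two points.\<close>

definition edge_point :: "'a \<Rightarrow> 'a \<Rightarrow> real \<Rightarrow> 'a \<Rightarrow> real" where
  "edge_point u v t = (\<lambda>w. (1 - t) * indicator {u} w + t * indicator {v} w)"

abbreviation vertex :: "'a \<Rightarrow> 'a \<Rightarrow> real" where
  "vertex v \<equiv> indicator {v}"

definition graph_points :: "'a set \<Rightarrow> ('a \<times> 'a) set \<Rightarrow> ('a \<Rightarrow> real) set" where
  "graph_points V E = vertex ` V \<union> {edge_point u v t | u v t. (u, v) \<in> E \<and> 0 \<le> t \<and> t \<le> 1}"

inductive pl_path :: "'a set \<Rightarrow> ('a \<times> 'a) set \<Rightarrow> ('a \<Rightarrow> real) \<Rightarrow> ('a \<Rightarrow> real) \<Rightarrow> real \<Rightarrow> bool"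
  for V E where
  const: "p \<in> graph_points V E \<Longrightarrow> pl_path V E p p 0"
| step: "\<lbrakk>pl_path V E p (edge_point u v s) l; (u, v) \<in> E; s \<in> {0..1}; t \<in> {0..1}\<rbrakk>
         \<Longrightarrow> pl_path V E p (edge_point u v t) (l + \<bar>s - t\<bar>)"

text \<open>The value 0 outside the realisation is forced by \<^locale>\<open>Metric_space\<close>, which asks for
  symmetry and non-negativity on the whole type.\<close>

definition graph_dist :: "'a set \<Rightarrow> ('a \<times> 'a) set \<Rightarrow> ('a \<Rightarrow> real) \<Rightarrow> ('a \<Rightarrow> real) \<Rightarrow> real" where
  "graph_dist V E p q =
     (if p \<in> graph_points V E \<and> q \<in> graph_points V E then Inf {l. pl_path V E p q l} else 0)"

lemma pl_path_points:
  assumes "pl_path V E p q l"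
  shows "p \<in> graph_points V E" "q \<in> graph_points V E"
  using assms by (induction, auto simp: graph_points_def)

lemma pl_path_coord_le:
  assumes "pl_path V E p q l"
  shows "\<bar>p w - q w\<bar> \<le> l"
  using assms
proof induction
  case (step p u v s l t)
  have "edge_point u v s w - edge_point u v t w = (t - s) * (indicator {u} w - indicator {v} w)"
    by (simp add: edge_point_def algebra_simps)
  then have "\<bar>edge_point u v s w - edge_point u v t w\<bar> \<le> \<bar>s - t\<bar>"
    by (auto simp: indicator_def abs_mult)
  with step.IH show ?case by linarith
qed simp

lemma pl_path_trans:
  assumes "pl_path V E q r l'" "pl_path V E p q l"
  shows "pl_path V E p r (l + l')"
  using assms
proof (induction arbitrary: l)
  case (step q u v s l' t)
  then show ?case
    using pl_path.step[of V E p u v s "l + l'" t] by (simp add: add.assoc)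
qed simp

lemma pl_path_edge:
  assumes "(u, v) \<in> E" "s \<in> {0..1}" "t \<in> {0..1}"
  shows "pl_path V E (edge_point u v s) (edge_point u v t) \<bar>s - t\<bar>"
proof -
  have "edge_point u v s \<in> graph_points V E"
    using assms by (auto simp: graph_points_def)
  from pl_path.step[OF pl_path.const[OF this] assms] show ?thesis by simp
qed

lemma pl_path_sym:
  assumes "pl_path V E p q l"
  shows "pl_path V E q p l"
  using assms
proof induction
  case (step p u v s l t)
  have "pl_path V E (edge_point u v t) (edge_point u v s) \<bar>t - s\<bar>"
    using step.hyps by (intro pl_path_edge)
  from pl_path_trans[OF step.IH this] show ?case
    by (simp add: add.commute abs_minus_commute)
qed (rule pl_path.const)

lemma edge_point_0 [simp]: "edge_point u v 0 = vertex u"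
  and edge_point_1 [simp]: "edge_point u v 1 = vertex v"
  by (auto simp: edge_point_def)

lemma pl_path_vertices:
  assumes "(u, v) \<in> E\<^sup>*" "u \<in> V"
  shows "\<exists>l. pl_path V E (vertex u) (vertex v) l"
  using assms
proof (induction)
  case base
  then have "vertex u \<in> graph_points V E" by (simp add: graph_points_def)
  then show ?case using pl_path.const by blast
next
  case (step v w)
  then obtain l where "pl_path V E (vertex u) (vertex v) l" by blast
  moreover have "pl_path V E (vertex v) (vertex w) \<bar>0 - 1\<bar>"
    using pl_path_edge[of v w E 0 1 V] step.hyps by simp
  ultimately show ?case using pl_path_trans by blast
qed

lemma pl_path_to_vertex:
  assumes "p \<in> graph_points V E" "E \<subseteq> V \<times> V"
  shows "\<exists>u\<in>V. \<exists>l. pl_path V E p (vertex u) l"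
proof (cases "p \<in> vertex ` V")
  case True
  then show ?thesis using assms pl_path.const by blast
next
  case False
  then obtain u v t where uv: "p = edge_point u v t" "(u, v) \<in> E" "0 \<le> t" "t \<le> 1"
    using assms by (auto simp: graph_points_def)
  then have "pl_path V E p (vertex u) \<bar>t - 0\<bar>"
    using pl_path_edge[of u v E t 0 V] by simp
  then show ?thesis using uv assms by blast
qed

lemma Metric_space_graph:
  assumes E: "E \<subseteq> V \<times> V" and conn: "\<And>u v. \<lbrakk>u \<in> V; v \<in> V\<rbrakk> \<Longrightarrow> (u, v) \<in> E\<^sup>*"
  shows "Metric_space (graph_points V E) (graph_dist V E)"
proof -
  let ?P = "graph_points V E"
  have ex: "\<exists>l. pl_path V E p q l" if pq: "p \<in> ?P" "q \<in> ?P" for p q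
  proof -
    obtain u l v l' where "u \<in> V" "pl_path V E p (vertex u) l" "v \<in> V" "pl_path V E q (vertex v) l'"
      using pl_path_to_vertex[OF _ E] pq by meson
    then show ?thesis
      using pl_path_vertices[OF conn, of u v] by (meson pl_path_trans pl_path_sym)
  qed
  have nonneg: "0 \<le> l" if "pl_path V E p q l" for p q l
    using pl_path_coord_le[OF that] by (meson abs_ge_zero order.trans)
  then have bdd: "bdd_below {l. pl_path V E p q l}" for p q
    by (intro bdd_belowI[where m=0]) auto
  have ge: "\<bar>p w - q w\<bar> \<le> graph_dist V E p q" if "p \<in> ?P" "q \<in> ?P" for p q w
  proof -
    have "\<bar>p w - q w\<bar> \<le> Inf {l. pl_path V E p q l}"
      using ex[OF that] pl_path_coord_le[of V E p q _ w] by (intro cInf_greatest) auto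
    then show ?thesis using that by (simp add: graph_dist_def)
  qed
  have le: "graph_dist V E p q \<le> l" if "pl_path V E p q l" for p q l
    using that pl_path_points[OF that] bdd by (auto simp: graph_dist_def intro!: cInf_lower)
  show ?thesis
  proof
    show "0 \<le> graph_dist V E p q" for p q
    proof (cases "p \<in> ?P \<and> q \<in> ?P")
      case True
      then show ?thesis using ge[of p q undefined] by linarith
    qed (auto simp: graph_dist_def)
    have "pl_path V E p q = pl_path V E q p" for p q
      by (intro ext iffI) (auto intro: pl_path_sym)
    then show "graph_dist V E p q = graph_dist V E q p" for p q
      by (simp add: graph_dist_def)
    show "graph_dist V E p q = 0 \<longleftrightarrow> p = q" if "p \<in> ?P" "q \<in> ?P" for p q
    proof
      assume "graph_dist V E p q = 0"
      then have "p w = q w" for w using ge[OF that, of w] by simp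
      then show "p = q" by blast
    next
      assume "p = q"
      then show "graph_dist V E p q = 0"
        using le[OF pl_path.const[OF that(1)]] ge[OF that, of undefined] by simp
    qed
    show "graph_dist V E p r \<le> graph_dist V E p q + graph_dist V E q r"
      if pqr: "p \<in> ?P" "q \<in> ?P" "r \<in> ?P" for p q r
    proof -
      have 1: "graph_dist V E p r \<le> l + l'" if "pl_path V E p q l" "pl_path V E q r l'" for l l'
        using le[OF pl_path_trans[OF that(2,1)]] .
      have 2: "graph_dist V E p r - l' \<le> graph_dist V E p q" if l': "pl_path V E q r l'" for l'
      proof -
        have "graph_dist V E p r - l' \<le> Inf {l. pl_path V E p q l}"
          using ex[OF pqr(1,2)] 1[OF _ l'] by (intro cInf_greatest) (auto simp: diff_le_eq)
        then show ?thesis using pqr by (simp add: graph_dist_def[of V E p q])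
      qed
      have "graph_dist V E p r - graph_dist V E p q \<le> Inf {l'. pl_path V E q r l'}"
        using ex[OF pqr(2,3)] 2 by (intro cInf_greatest) (auto simp: diff_le_eq add.commute)
      then have "graph_dist V E p r - graph_dist V E p q \<le> graph_dist V E q r"
        using pqr by (simp add: graph_dist_def[of V E q r])
      then show ?thesis by simp
    qed
  qed
qed


section \<open>Cayley graphs\<close>

definition finite_generating_set :: "('a, 'b) monoid_scheme \<Rightarrow> 'a set \<Rightarrow> bool" where
  "finite_generating_set G S \<longleftrightarrow> finite S \<and> S \<subseteq> carrier G \<and> generate G S = carrier G"

text \<open>The underlying graph is undirected and simple: \<open>S\<close> need not be symmetric, and loops
  (coming from \<open>\<one> \<in> S\<close>) and multiple edges are discarded.\<close>

definition cayley_edges :: "('a, 'b) monoid_scheme \<Rightarrow> 'a set \<Rightarrow> ('a \<times> 'a) set" where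
  "cayley_edges G S =
     {(u, v). u \<in> carrier G \<and> v \<in> carrier G \<and> u \<noteq> v \<and>
              (\<exists>s\<in>S. v = u \<otimes>\<^bsub>G\<^esub> s \<or> u = v \<otimes>\<^bsub>G\<^esub> s)}"

definition cayley_graph :: "('a, 'b) monoid_scheme \<Rightarrow> 'a set \<Rightarrow> ('a \<Rightarrow> real) metric" where
  "cayley_graph G S =
     metric (graph_points (carrier G) (cayley_edges G S), graph_dist (carrier G) (cayley_edges G S))"

lemma Metric_space_cayley_graph:
  assumes "group G" and gen: "finite_generating_set G S"
  shows "Metric_space (graph_points (carrier G) (cayley_edges G S))
                      (graph_dist (carrier G) (cayley_edges G S))"
proof (rule Metric_space_graph)
  interpret group G by fact
  let ?E = "cayley_edges G S"
  have S: "S \<subseteq> carrier G" and genS: "generate G S = carrier G"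
    using gen by (auto simp: finite_generating_set_def)
  show "?E \<subseteq> carrier G \<times> carrier G"
    by (auto simp: cayley_edges_def)
  have edge: "(g, g \<otimes>\<^bsub>G\<^esub> s) \<in> ?E\<^sup>*" "(g \<otimes>\<^bsub>G\<^esub> s, g) \<in> ?E\<^sup>*"
    if "s \<in> S" "g \<in> carrier G" for g s
  proof -
    have "s \<in> carrier G" using that S by blast
    then have "(g, g \<otimes>\<^bsub>G\<^esub> s) \<in> ?E \<and> (g \<otimes>\<^bsub>G\<^esub> s, g) \<in> ?E" if "g \<noteq> g \<otimes>\<^bsub>G\<^esub> s"
      unfolding cayley_edges_def using \<open>g \<in> carrier G\<close> \<open>s \<in> S\<close> that
      by (metis (mono_tags, lifting) case_prodI m_closed mem_Collect_eq)
    then show "(g, g \<otimes>\<^bsub>G\<^esub> s) \<in> ?E\<^sup>*" "(g \<otimes>\<^bsub>G\<^esub> s, g) \<in> ?E\<^sup>*"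
      by (metis r_into_rtrancl rtrancl.rtrancl_refl)+
  qed
  have right: "(g, g \<otimes>\<^bsub>G\<^esub> h) \<in> ?E\<^sup>*" if "h \<in> generate G S" "g \<in> carrier G" for g h
    using that
  proof (induction arbitrary: g)
    case one
    then show ?case by simp
  next
    case (incl s)
    then show ?case by (rule edge)
  next
    case (inv s)
    then have s: "s \<in> carrier G" using S by blast
    then have "g \<otimes>\<^bsub>G\<^esub> inv\<^bsub>G\<^esub> s \<otimes>\<^bsub>G\<^esub> s = g"
      using inv.prems by (simp add: m_assoc)
    then show ?case
      using edge(2)[of s "g \<otimes>\<^bsub>G\<^esub> inv\<^bsub>G\<^esub> s"] inv s by simp
  next
    case (eng h1 h2)
    then have h: "h1 \<in> carrier G" "h2 \<in> carrier G" using genS by auto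
    have "(g, g \<otimes>\<^bsub>G\<^esub> h1) \<in> ?E\<^sup>*"
      using eng.IH(1) eng.prems .
    moreover have "(g \<otimes>\<^bsub>G\<^esub> h1, g \<otimes>\<^bsub>G\<^esub> h1 \<otimes>\<^bsub>G\<^esub> h2) \<in> ?E\<^sup>*"
      using eng.IH(2)[of "g \<otimes>\<^bsub>G\<^esub> h1"] eng.prems h by simp
    ultimately show ?case
      using m_assoc[OF eng.prems h] by simp
  qed
  fix u v assume uv: "u \<in> carrier G" "v \<in> carrier G"
  then have "u \<otimes>\<^bsub>G\<^esub> (inv\<^bsub>G\<^esub> u \<otimes>\<^bsub>G\<^esub> v) = v"
    using m_assoc[of u "inv\<^bsub>G\<^esub> u" v] by simp
  then show "(u, v) \<in> ?E\<^sup>*"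
    using right[of "inv\<^bsub>G\<^esub> u \<otimes>\<^bsub>G\<^esub> v" u] genS uv by simp
qed

corollary
  assumes "group G" "finite_generating_set G S"
  shows mspace_cayley_graph: "mspace (cayley_graph G S) = graph_points (carrier G) (cayley_edges G S)"
    and mdist_cayley_graph: "mdist (cayley_graph G S) = graph_dist (carrier G) (cayley_edges G S)"
  using Metric_space_cayley_graph[OF assms]
  by (simp_all add: cayley_graph_def Metric_space.mspace_metric Metric_space.mdist_metric)


section \<open>Subgroups of finitely generated groups\<close>

abbreviation subgroup_as_group :: "('a, 'b) monoid_scheme \<Rightarrow> 'a set \<Rightarrow> ('a, 'b) monoid_scheme" where
  "subgroup_as_group G H \<equiv> G\<lparr>carrier := H\<rparr>"

definition hyperbolic_group :: "('a, 'b) monoid_scheme \<Rightarrow> bool" where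
  "hyperbolic_group G \<longleftrightarrow> (\<exists>S. finite_generating_set G S \<and> Gromov_hyperbolic (cayley_graph G S))"

text \<open>In the following notions \<open>S\<close> is the finite generating set of \<open>G\<close> whose Cayley graph is used.\<close>

definition strongly_quasiconvex :: "('a, 'b) monoid_scheme \<Rightarrow> 'a set \<Rightarrow> 'a set \<Rightarrow> bool" where
  "strongly_quasiconvex G S H \<longleftrightarrow>
     (\<forall>K\<ge>1. \<forall>C\<ge>0. \<exists>M. \<forall>a b c.
        quasi_geodesic K C (cayley_graph G S) a b c \<and> c a \<in> vertex ` H \<and> c b \<in> vertex ` H \<longrightarrow>
        c ` {a..b} \<subseteq> nbhd (cayley_graph G S) M (vertex ` H))"

text \<open>The vertices of a Cayley graph of \<open>H\<close>, with the induced metric, form \<open>H\<close> with its word metric.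
  They are also vertices of the Cayley graph of \<open>G\<close>, so the inclusion of \<open>H\<close> into \<open>G\<close> is the
  identity map.\<close>

definition undistorted :: "('a, 'b) monoid_scheme \<Rightarrow> 'a set \<Rightarrow> 'a set \<Rightarrow> bool" where
  "undistorted G S H \<longleftrightarrow>
     (\<exists>T. finite_generating_set (subgroup_as_group G H) T \<and>
        (\<exists>K\<ge>1. \<exists>L\<ge>0. quasi_isometric_embedding K L
           (submetric (cayley_graph (subgroup_as_group G H) T) (vertex ` H))
           (cayley_graph G S) (\<lambda>x. x)))"

text \<open>Finite generation of \<open>H\<close> is part of \<open>undistorted\<close>.\<close>

definition stable_subgroup :: "('a, 'b) monoid_scheme \<Rightarrow> 'a set \<Rightarrow> 'a set \<Rightarrow> bool" where
  "stable_subgroup G S H \<longleftrightarrow>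
     undistorted G S H \<and>
     (\<forall>K\<ge>1. \<forall>L\<ge>0. \<exists>R::real. \<forall>a b c a' b' c'.
        quasi_geodesic K L (cayley_graph G S) a b c \<and>
        quasi_geodesic K L (cayley_graph G S) a' b' c' \<and>
        c a = c' a' \<and> c b = c' b' \<and> c a \<in> vertex ` H \<and> c b \<in> vertex ` H \<longrightarrow>
        Hausdorff_distance (cayley_graph G S) (c ` {a..b}) (c' ` {a'..b'}) < ennreal R)"

definition lower_relative_divergence ::
    "('a, 'b) monoid_scheme \<Rightarrow> 'a set \<Rightarrow> 'a set \<Rightarrow> nat \<Rightarrow> real \<Rightarrow> real \<Rightarrow> ennreal" where
  "lower_relative_divergence G S H = lower_divergence (cayley_graph G S) (vertex ` H)"

end

theory Submission
  imports Defs
begin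

text \<open>
  Everything is reduced to sequences of vertices: a quasi-geodesic of the realisation is sampled at
  integer times and replaced by nearest vertices, and a rectifiable path by a walk of comparable
  length.

  If \<open>\<sigma>\<^sup>3\<^sub>\<rho>\<close> is not super linear, a short path between far apart points stays far from \<open>H\<close>. Joined to
  \<open>H\<close> by two geodesics it becomes a path \<open>\<Gamma>\<close> of length \<open>O(r)\<close>. A walk with the same endpoints that
  minimises the length weighted by \<open>r + B d(\<cdot>, \<Gamma>)\<close> is a quasi-geodesic whose constants do not depend
  on \<open>r\<close>. For large \<open>B\<close> it stays close to \<open>\<Gamma>\<close>, hence leaves a large neighbourhood of \<open>H\<close>. Conversely, an
  excursion of a quasi-geodesic to height about \<open>m r\<close> contains a piece of length \<open>O(r)\<close> which, once its
  ends are lowered to height \<open>r\<close> along geodesics, contradicts super linearity of \<open>\<sigma>\<^sup>n\<^sub>1\<close>.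

  If \<open>H\<close> is stable, quasi-geodesics of \<open>H\<close> with common endpoints are close. Apply this to a side of a
  geodesic triangle and to the path through the point of another side nearest to the opposite vertex:
  triangles are slim. If \<open>H\<close> is hyperbolic and strongly quasiconvex, quasi-geodesics of \<open>G\<close> with
  endpoints in \<open>H\<close> can be projected to \<open>H\<close>, where the Morse lemma applies.
\<close>

section \<open>Graph distance and discrete quasi-geodesics\<close>

text \<open>Strong quasiconvexity yields a bound \<open>M\<close> only after the quasi-geodesic
  constants are fixed, whereas a failure of super linearity is a family of paths with
  \<open>r\<close> unbounded. The weight is therefore homogeneous: lengths scale like
  \<open>r\<close>, total weights like \<open>r^2\<close>, and the constants of the minimal walk
  depend on the slope and on \<open>q\<close> alone. That walk may cut corners, but only by a
  quarter of the height \<open>r / q\<close> guaranteed on the middle part of \<Gamma>. Missing this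
  part altogether would put the end points at distance at most about \<open>5/2 r\<close>, which is
  why the separation factor 3 suffices.

  In the converse direction an excursion has two free parameters, height and duration. The constants
  \<open>m\<close> and \<Lambda> are chosen so that a short excursion cannot get high enough, while
  a long one is, after time \<open>\<Lambda> * r\<close>, too close to its start for a
  quasi-geodesic.

  Undistortedness, which (1) contains and (2) does not, uses the group: a geodesic of
  \<open>G\<close> between points of \<open>H\<close> stays near \<open>H\<close>, its projection to
  \<open>H\<close> moves by bounded steps, and up to left translation there are only finitely many
  such steps.\<close>

locale vgraph =
  fixes V :: "'a set" and E :: "('a \<times> 'a) set"
  assumes E_sub: "E \<subseteq> V \<times> V" and E_sym: "sym E" and E_irrefl: "(u, u) \<notin> E"
    and E_conn: "\<lbrakk>u \<in> V; v \<in> V\<rbrakk> \<Longrightarrow> (u, v) \<in> E\<^sup>*"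
begin

definition d :: "'a \<Rightarrow> 'a \<Rightarrow> nat" where
  "d u v = (LEAST n. (u, v) \<in> E ^^ n)"

lemma d_le: "(u, v) \<in> E ^^ n \<Longrightarrow> d u v \<le> n"
  unfolding d_def by (rule Least_le)

lemma d_relpow: "\<lbrakk>u \<in> V; v \<in> V\<rbrakk> \<Longrightarrow> (u, v) \<in> E ^^ d u v"
  unfolding d_def using E_conn[of u v] by (metis LeastI rtrancl_imp_relpow)

lemma relpow_sym: "(u, v) \<in> E ^^ n \<Longrightarrow> (v, u) \<in> E ^^ n"
proof (induction n arbitrary: u v)
  case (Suc n)
  then obtain w where "(u, w) \<in> E ^^ n" "(w, v) \<in> E" by auto
  then show ?case using Suc.IH E_sym by (metis relpow_Suc_I2 symD)
qed auto

lemma relpow_in_V: "(u, v) \<in> E ^^ n \<Longrightarrow> u \<in> V \<Longrightarrow> v \<in> V"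
  using E_sub by (cases n) auto

lemma d_refl [simp]: "d u u = 0"
  using d_le[of u u 0] by simp

lemma d_eq_0: "\<lbrakk>u \<in> V; v \<in> V\<rbrakk> \<Longrightarrow> d u v = 0 \<longleftrightarrow> u = v"
  using d_relpow[of u v] by auto

lemma d_sym: "\<lbrakk>u \<in> V; v \<in> V\<rbrakk> \<Longrightarrow> d u v = d v u"
  by (meson d_le d_relpow relpow_sym le_antisym)

lemma d_triangle:
  assumes "u \<in> V" "v \<in> V" "w \<in> V"
  shows "d u w \<le> d u v + d v w"
proof -
  have "(u, w) \<in> E ^^ (d u v + d v w)"
    using d_relpow[of u v] d_relpow[of v w] assms by (auto simp: relpow_add)
  then show ?thesis by (rule d_le)
qed

lemma d_edge: "(u, v) \<in> E \<Longrightarrow> d u v \<le> 1"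
  using d_le[of u v 1] by simp

definition discrete_geodesic :: "nat \<Rightarrow> (nat \<Rightarrow> 'a) \<Rightarrow> bool" where
  "discrete_geodesic n f \<longleftrightarrow> (\<forall>i\<le>n. f i \<in> V) \<and> (\<forall>i j. i \<le> j \<and> j \<le> n \<longrightarrow> d (f i) (f j) = j - i)"

lemma walk_relpow:
  assumes "\<And>i. i < n \<Longrightarrow> (f i, f (Suc i)) \<in> E" "i \<le> j" "j \<le> n"
  shows "(f i, f j) \<in> E ^^ (j - i)"
  using assms(2,3)
proof (induction j rule: dec_induct)
  case (step j)
  then show ?case using assms(1)[of j] by (auto simp: Suc_diff_le)
qed simp

lemma discrete_geodesic_ex:
  assumes "x \<in> V" "y \<in> V"
  obtains f where "discrete_geodesic (d x y) f" "f 0 = x" "f (d x y) = y" "\<And>i. i < d x y \<Longrightarrow> (f i, f (Suc i)) \<in> E"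
proof -
  from d_relpow[OF assms] obtain f where f: "f 0 = x" "f (d x y) = y"
    "\<And>i. i < d x y \<Longrightarrow> (f i, f (Suc i)) \<in> E"
    unfolding relpow_fun_conv by blast
  have V: "f i \<in> V" if "i \<le> d x y" for i
    using walk_relpow[of "d x y" f 0 i] f that relpow_in_V assms by auto
  have "d (f i) (f j) = j - i" if ij: "i \<le> j" "j \<le> d x y" for i j
  proof -
    have le: "d (f i) (f j) \<le> j - i" if "i \<le> j" "j \<le> d x y" for i j
      using walk_relpow[of "d x y" f i j] f(3) that d_le by blast
    have "d x y \<le> d x (f i) + d (f i) (f j) + d (f j) y"
      using d_triangle[of x "f i" y] d_triangle[of "f i" "f j" y] V ij assms by fastforce
    then show ?thesis using le[of 0 i] le[of i j] le[of j "d x y"] f ij by simp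
  qed
  then show thesis using that[of f] V f by (auto simp: discrete_geodesic_def)
qed

text \<open>The union of all geodesics between two vertices.\<close>
definition interval :: "'a \<Rightarrow> 'a \<Rightarrow> 'a set" where
  "interval x y = {p \<in> V. d x p + d p y = d x y}"

lemma interval_sym: "\<lbrakk>x \<in> V; y \<in> V\<rbrakk> \<Longrightarrow> interval x y = interval y x"
  unfolding interval_def by (auto simp: d_sym)

lemma geodesic_in_interval: "discrete_geodesic n f \<Longrightarrow> i \<le> n \<Longrightarrow> f i \<in> interval (f 0) (f n)"
  unfolding discrete_geodesic_def interval_def by auto

lemma d_mid:
  assumes "x \<in> V" "y \<in> V" "k \<le> d x y"
  obtains w where "w \<in> interval x y" "d x w = k"
proof -
  obtain f where f: "discrete_geodesic (d x y) f" "f 0 = x" "f (d x y) = y"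
    using discrete_geodesic_ex[OF assms(1,2)] by blast
  then have "f k \<in> interval x y" "d x (f k) = k"
    using geodesic_in_interval[OF f(1), of k] f assms unfolding discrete_geodesic_def by auto
  then show thesis by (rule that)
qed

lemma interval_walk:
  assumes "x \<in> V" "y \<in> V" "interval x y \<subseteq> Z"
  shows "(x, y) \<in> (Restr E Z) ^^ d x y"
proof -
  obtain f where f: "discrete_geodesic (d x y) f" "f 0 = x" "f (d x y) = y" "\<And>i. i < d x y \<Longrightarrow> (f i, f (Suc i)) \<in> E"
    using discrete_geodesic_ex[OF assms(1,2)] by blast
  have "f i \<in> Z" if "i \<le> d x y" for i
    using geodesic_in_interval[OF f(1) that] f assms by auto
  then show ?thesis unfolding relpow_fun_conv using f by (intro exI[of _ f]) auto
qed

text \<open>The graph distance to \<open>A\<close>. For \<open>A = H\<close> it measures excursions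
  of quasi-geodesics; for \<open>A\<close> = \<Gamma> it is the penalty in the weighted
  walks.\<close>

definition height :: "'a set \<Rightarrow> 'a \<Rightarrow> nat" where
  "height A v = (LEAST n. \<exists>a\<in>A. d v a = n)"

lemma height_le: "a \<in> A \<Longrightarrow> height A v \<le> d v a"
  unfolding height_def by (rule Least_le) auto

lemma height_attained:
  assumes "A \<noteq> {}"
  obtains a where "a \<in> A" "d v a = height A v"
proof -
  have "\<exists>n. \<exists>a\<in>A. d v a = n" using assms by blast
  then have "\<exists>a\<in>A. d v a = (LEAST n. \<exists>a\<in>A. d v a = n)" by (rule LeastI_ex)
  then show thesis using that unfolding height_def by blast
qed

lemma height_eq_0: "\<lbrakk>A \<subseteq> V; A \<noteq> {}; v \<in> V\<rbrakk> \<Longrightarrow> height A v = 0 \<longleftrightarrow> v \<in> A"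
  by (metis d_eq_0 d_refl height_attained height_le le_zero_eq subset_iff)

lemma height_Lipschitz:
  assumes "A \<subseteq> V" "A \<noteq> {}" "u \<in> V" "v \<in> V"
  shows "height A u \<le> d u v + height A v"
proof -
  obtain a where a: "a \<in> A" "d v a = height A v" using height_attained assms by metis
  then show ?thesis using height_le[of a A u] d_triangle[of u v a] assms by auto
qed

text \<open>The walk follows a geodesic to a nearest point of \<open>A\<close> and stops early.
  Heights drop no faster than the distance travelled, so nothing before the stopping point lies
  below \<open>r\<close>.\<close>

lemma descend:
  assumes A: "A \<subseteq> V" "A \<noteq> {}" and v: "v \<in> V" "r \<le> height A v"
  obtains x where "x \<in> V" "height A x = r" "d v x = height A v - r"
    "(v, x) \<in> (Restr E {w. r \<le> height A w}) ^^ (height A v - r)"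
proof -
  obtain a where a: "a \<in> A" "d v a = height A v" using height_attained A by metis
  have aV: "a \<in> V" using a A by blast
  obtain x where x: "x \<in> interval v a" "d v x = height A v - r" using d_mid[OF v(1) aV, of "height A v - r"] a by auto
  have xV: "x \<in> V" using x by (simp add: interval_def)
  have dxa: "d x a = r" using x a v by (auto simp: interval_def)
  have hx: "height A x = r" using height_le[OF a(1), of x] height_Lipschitz[OF A v(1) xV] dxa x v by linarith
  have "r \<le> height A w" if "w \<in> interval v x" for w
  proof -
    have w: "w \<in> V" "d v w + d w x = d v x" using that by (auto simp: interval_def)
    then show ?thesis using height_Lipschitz[OF A v(1) w(1)] x v by linarith
  qed
  then have "(v, x) \<in> (Restr E {w. r \<le> height A w}) ^^ d v x"
    by (intro interval_walk[OF v(1) xV]) auto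
  then show thesis using that xV hx x by simp
qed

text \<open>With \<open>K\<close> and \<open>L\<close> natural numbers the lower bound is stated as \<open>j - i \<le> K d + L\<close>, which avoids
  division and costs only a change of the additive constant.\<close>
definition discrete_qg :: "nat \<Rightarrow> nat \<Rightarrow> nat \<Rightarrow> (nat \<Rightarrow> 'a) \<Rightarrow> bool" where
  "discrete_qg K L N v \<longleftrightarrow> (\<forall>i\<le>N. v i \<in> V) \<and>
     (\<forall>i j. i \<le> j \<and> j \<le> N \<longrightarrow> d (v i) (v j) \<le> K * (j - i) + L \<and> j - i \<le> K * d (v i) (v j) + L)"

lemma dqgI:
  assumes "\<And>i. i \<le> N \<Longrightarrow> v i \<in> V"
    and "\<And>i j. \<lbrakk>i \<le> j; j \<le> N\<rbrakk> \<Longrightarrow> d (v i) (v j) \<le> K * (j - i) + L"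
    and "\<And>i j. \<lbrakk>i \<le> j; j \<le> N\<rbrakk> \<Longrightarrow> j - i \<le> K * d (v i) (v j) + L"
  shows "discrete_qg K L N v"
  using assms unfolding discrete_qg_def by blast

lemma dqgD:
  assumes "discrete_qg K L N v"
  shows "i \<le> N \<Longrightarrow> v i \<in> V"
    and "\<lbrakk>i \<le> j; j \<le> N\<rbrakk> \<Longrightarrow> d (v i) (v j) \<le> K * (j - i) + L"
    and "\<lbrakk>i \<le> j; j \<le> N\<rbrakk> \<Longrightarrow> j - i \<le> K * d (v i) (v j) + L"
  using assms unfolding discrete_qg_def by blast+

lemma discrete_qg_mono:
  assumes "discrete_qg K L N v" "K \<le> K'" "L \<le> L'"
  shows "discrete_qg K' L' N v"
proof (rule dqgI)
  fix i j assume ij: "i \<le> j" "j \<le> N"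
  show "d (v i) (v j) \<le> K' * (j - i) + L'"
    using dqgD(2)[OF assms(1) ij] mult_le_mono1[OF assms(2), of "j - i"] assms(3) by linarith
  show "j - i \<le> K' * d (v i) (v j) + L'"
    using dqgD(3)[OF assms(1) ij] mult_le_mono1[OF assms(2), of "d (v i) (v j)"] assms(3) by linarith
qed (use dqgD(1)[OF assms(1)] in blast)

lemma discrete_qg_rev:
  assumes "discrete_qg K L N v" "m \<le> N"
  shows "discrete_qg K L m (\<lambda>i. v (m - i))"
proof (rule dqgI)
  fix i j assume ij: "i \<le> j" "j \<le> m"
  have s: "d (v (m - i)) (v (m - j)) = d (v (m - j)) (v (m - i))"
    using assms by (intro d_sym dqgD(1)) auto
  have e: "m - i - (m - j) = j - i" using ij by auto
  show "d (v (m - i)) (v (m - j)) \<le> K * (j - i) + L"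
    using dqgD(2)[OF assms(1), of "m - j" "m - i"] ij assms(2) e unfolding s by simp
  show "j - i \<le> K * d (v (m - i)) (v (m - j)) + L"
    using dqgD(3)[OF assms(1), of "m - j" "m - i"] ij assms(2) e unfolding s by simp
qed (use dqgD(1)[OF assms(1)] assms(2) in auto)

lemma discrete_qg_shift:
  assumes "discrete_qg K L N v" "k \<le> N"
  shows "discrete_qg K L (N - k) (\<lambda>i. v (k + i))"
proof (rule dqgI)
  fix i j assume ij: "i \<le> j" "j \<le> N - k"
  show "d (v (k + i)) (v (k + j)) \<le> K * (j - i) + L"
    using dqgD(2)[OF assms(1), of "k + i" "k + j"] ij assms(2) by simp
  show "j - i \<le> K * d (v (k + i)) (v (k + j)) + L"
    using dqgD(3)[OF assms(1), of "k + i" "k + j"] ij assms(2) by simp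
qed (use dqgD(1)[OF assms(1)] assms(2) in auto)

lemma geodesic_qg: "discrete_geodesic n f \<Longrightarrow> discrete_qg 1 0 n f"
  unfolding discrete_geodesic_def discrete_qg_def by auto

definition discretely_quasiconvex :: "'a set \<Rightarrow> bool" where
  "discretely_quasiconvex A \<longleftrightarrow> (\<forall>K L. \<exists>M. \<forall>N v. discrete_qg K L N v \<and> v 0 \<in> A \<and> v N \<in> A \<longrightarrow> (\<forall>i\<le>N. height A (v i) \<le> M))"

text \<open>One-sided closeness is enough, since the two sides of the bigon may be
  exchanged.\<close>

definition thin_bigons :: "bool" where
  "thin_bigons \<longleftrightarrow> (\<forall>K L. \<exists>R. \<forall>N v N' v'. discrete_qg K L N v \<and> discrete_qg K L N' v' \<and> v 0 = v' 0 \<and> v N = v' N' \<longrightarrow>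
     (\<forall>i\<le>N. \<exists>j\<le>N'. d (v i) (v' j) \<le> R))"

text \<open>A form of slim triangles on vertices alone. With whole intervals as sides no geodesics
  have to be chosen.\<close>

definition slim_intervals :: "nat \<Rightarrow> bool" where
  "slim_intervals \<delta> \<longleftrightarrow> (\<forall>x\<in>V. \<forall>y\<in>V. \<forall>z\<in>V. \<forall>p\<in>interval x y. \<exists>q\<in>interval y z \<union> interval z x. d p q \<le> \<delta>)"

end

section \<open>Quasiconvexity and divergence\<close>

text \<open>Each step is charged at its source, so the final vertex is free and weights add exactly
  under concatenation.\<close>

inductive walk :: "('a \<times> 'a) set \<Rightarrow> ('a \<Rightarrow> nat) \<Rightarrow> 'a \<Rightarrow> 'a \<Rightarrow> nat \<Rightarrow> bool" for R W where
  walk_refl: "walk R W x x 0"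
| walk_step: "walk R W x y c \<Longrightarrow> (y, z) \<in> R \<Longrightarrow> walk R W x z (c + W y)"

lemma walk_trans: "walk R W y z c' \<Longrightarrow> walk R W x y c \<Longrightarrow> walk R W x z (c + c')"
proof (induction rule: walk.induct)
  case (walk_step y z c' z')
  then show ?case using walk.walk_step[of R W x z "c + c'" z'] by (simp add: add.assoc)
qed simp

lemma walk_fun:
  assumes "\<And>i. i < n \<Longrightarrow> (f i, f (Suc i)) \<in> R" "i \<le> j" "j \<le> n"
  shows "walk R W (f i) (f j) (\<Sum>k=i..<j. W (f k))"
  using assms(2,3)
proof (induction j rule: dec_induct)
  case (step j)
  then show ?case using assms(1)[of j] walk_step[of R W "f i" "f j" _ "f (Suc j)"] by simp
qed (simp add: walk_refl)

lemma walk_imp_fun: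
  assumes "walk R W x y c"
  shows "\<exists>N f. f 0 = x \<and> f N = y \<and> (\<forall>i<N. (f i, f (Suc i)) \<in> R) \<and> c = (\<Sum>k<N. W (f k))"
  using assms
proof (induction rule: walk.induct)
  case (walk_refl x)
  show ?case by (intro exI[of _ 0] exI[of _ "\<lambda>_. x"]) simp
next
  case (walk_step x y c z)
  then obtain N f where f: "f 0 = x" "f N = y" "\<forall>i<N. (f i, f (Suc i)) \<in> R" "c = (\<Sum>k<N. W (f k))"
    by blast
  show ?case
    by (intro exI[of _ "Suc N"] exI[of _ "f(Suc N := z)"])
       (use f walk_step in \<open>auto simp: less_Suc_eq\<close>)
qed

section \<open>From quasiconvexity to super linear divergence\<close>

context vgraph
begin

text \<open>A walk of minimal weight \<open>\<Sum> (r + B d(\<cdot>, \<Gamma>))\<close>. Reaching distance \<open>h\<close> from \<open>\<Gamma>\<close> costs at least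
  \<open>B h\<^sup>2 / 2\<close>, while the given path costs at most \<open>C r\<^sup>2\<close>; so \<open>h \<le> r\<close>, all weights on the walk lie
  between \<open>r\<close> and \<open>(1 + B) r\<close>, and minimality compares subwalks of endpoint distance at most \<open>r\<close> with
  geodesics. For larger endpoint distances the total length \<open>C r\<close> suffices.\<close>
lemma tame_walk:
  fixes q r C n :: nat
  defines "B \<equiv> 32 * q\<^sup>2 * C"
  assumes \<Gamma>: "\<Gamma> \<subseteq> V" "a \<in> \<Gamma>" and path: "(a, b) \<in> (Restr E \<Gamma>) ^^ n"
    and n: "n \<le> C * r" and pos: "C > 0" "q > 0" "r > 0" and r: "B \<le> 2 * r"
  obtains N w where "discrete_qg (1 + 2 * B) 0 N w" "w 0 = a" "w N = b"
    "\<And>i. i < N \<Longrightarrow> (w i, w (Suc i)) \<in> E" "\<And>i. i \<le> N \<Longrightarrow> 4 * q * height \<Gamma> (w i) \<le> r"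
proof -
  define W where "W v = r + B * height \<Gamma> v" for v
  have \<Gamma>ne: "\<Gamma> \<noteq> {}" using \<Gamma> by blast
  obtain f where f: "f 0 = a" "f n = b" "\<And>i. i < n \<Longrightarrow> (f i, f (Suc i)) \<in> Restr E \<Gamma>"
    using path unfolding relpow_fun_conv by blast
  have "W (f i) = r" if "i < n" for i
    using f(3)[OF that] height_eq_0[OF \<Gamma>(1) \<Gamma>ne, of "f i"] \<Gamma> by (auto simp: W_def)
  then have "walk E W a b (n * r)"
    using walk_fun[of n f E 0 n W] f by (simp add: sum.atLeast0_lessThan_Suc)
  then have ex: "\<exists>c. walk E W a b c" by blast
  define c0 where "c0 = (LEAST c. walk E W a b c)"
  have min: "c0 \<le> c" if "walk E W a b c" for c
    unfolding c0_def using that by (rule Least_le)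
  have "walk E W a b c0" unfolding c0_def using ex by (rule LeastI_ex)
  then obtain N w where w: "w 0 = a" "w N = b" "\<And>i. i < N \<Longrightarrow> (w i, w (Suc i)) \<in> E"
    and c0: "c0 = (\<Sum>k<N. W (w k))"
    using walk_imp_fun by metis
  have wV: "w i \<in> V" if "i \<le> N" for i
    using walk_relpow[of N w 0 i] w that relpow_in_V \<Gamma> by auto
  have c0_le: "c0 \<le> C * r * r"
    using min[OF \<open>walk E W a b (n * r)\<close>] mult_le_mono1[OF n, of r] by linarith
  have split: "c0 = (\<Sum>k<i. W (w k)) + (\<Sum>k=i..<j. W (w k)) + (\<Sum>k=j..<N. W (w k))"
    if "i \<le> j" "j \<le> N" for i j
    using that unfolding c0
    by (simp add: lessThan_atLeast0 sum.atLeastLessThan_concat)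
  have opt: "(\<Sum>k=i..<j. W (w k)) \<le> c" if ij: "i \<le> j" "j \<le> N" and c: "walk E W (w i) (w j) c" for i j c
  proof -
    have "walk E W a (w i) (\<Sum>k<i. W (w k))"
      using walk_fun[of N w E 0 i W] w ij by (simp add: lessThan_atLeast0)
    moreover have "walk E W (w j) b (\<Sum>k=j..<N. W (w k))"
      using walk_fun[of N w E j N W] w ij by simp
    ultimately have "walk E W a b ((\<Sum>k<i. W (w k)) + c + (\<Sum>k=j..<N. W (w k)))"
      using c walk_trans by metis
    then show ?thesis using min split[OF ij] by fastforce
  qed
  have lower: "(j - i) * r \<le> (\<Sum>k=i..<j. W (w k))" for i j
    using sum_bounded_below[of "{i..<j}" r "\<lambda>k. W (w k)"] by (simp add: W_def)
  have d_step: "height \<Gamma> (w (Suc i)) \<le> Suc (height \<Gamma> (w i))" if "i < N" for i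
  proof -
    have "d (w (Suc i)) (w i) \<le> 1" using w(3)[OF that] d_edge E_sym by (meson symD)
    then show ?thesis using height_Lipschitz[OF \<Gamma>(1) \<Gamma>ne, of "w (Suc i)" "w i"] wV that by simp
  qed
  have climb: "B * (height \<Gamma> (w i))\<^sup>2 \<le> 2 * (\<Sum>k<i. W (w k))" if "i \<le> N" for i
    using that
  proof (induction i)
    case 0
    then show ?case using height_eq_0[OF \<Gamma>(1) \<Gamma>ne, of a] w \<Gamma> by auto
  next
    case (Suc i)
    let ?h = "height \<Gamma> (w i)"
    have "B * (height \<Gamma> (w (Suc i)))\<^sup>2 \<le> B * (Suc ?h)\<^sup>2"
      using d_step[of i] Suc.prems by (intro mult_le_mono2 power_mono) auto
    also have "\<dots> = B * ?h\<^sup>2 + 2 * (B * ?h) + B"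
      by (simp add: power2_eq_square algebra_simps)
    \<comment> \<open>The hypothesis \<open>B \<le> 2 * r\<close> absorbs the term \<open>B\<close>
      left over from the square, so that the increment is twice the weight of the current
      vertex.\<close>
    also have "\<dots> \<le> 2 * (\<Sum>k<i. W (w k)) + 2 * (B * ?h) + 2 * r"
      using Suc r by simp
    finally show ?case by (simp add: W_def algebra_simps)
  qed
  have near: "4 * q * height \<Gamma> (w i) \<le> r" if "i \<le> N" for i
  proof -
    have "(\<Sum>k<i. W (w k)) \<le> c0" using split[of i i] that by simp
    then have "B * (height \<Gamma> (w i))\<^sup>2 \<le> 2 * (C * r * r)" using climb[OF that] c0_le by linarith
    \<comment> \<open>\<open>B\<close> is \<open>2 * C\<close> times the square of
      \<open>4 * q\<close>; this is the origin of the factor 32.\<close>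
    then have "(2 * C) * (4 * q * height \<Gamma> (w i))\<^sup>2 \<le> (2 * C) * r\<^sup>2"
      by (simp add: B_def power2_eq_square algebra_simps)
    then have "(4 * q * height \<Gamma> (w i))\<^sup>2 \<le> r\<^sup>2" using pos by simp
    then show ?thesis by (simp add: power2_nat_le_eq_le)
  qed
  have "discrete_qg (1 + 2 * B) 0 N w"
  proof (rule dqgI)
    fix i j assume ij: "i \<le> j" "j \<le> N"
    let ?d = "d (w i) (w j)"
    have le: "?d \<le> j - i" using walk_relpow[of N w i j] w(3) ij d_le by blast
    then show "?d \<le> (1 + 2 * B) * (j - i) + 0" by (simp add: trans_le_add1)
    show "j - i \<le> (1 + 2 * B) * ?d + 0"
    proof (cases "?d \<le> r")
      case True
      have wij: "w i \<in> V" "w j \<in> V" using wV ij by auto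
      obtain g where g: "discrete_geodesic ?d g" "g 0 = w i" "g ?d = w j" "\<And>k. k < ?d \<Longrightarrow> (g k, g (Suc k)) \<in> E"
        by (rule discrete_geodesic_ex[OF wij], rule that) blast+
      have Wg: "W (g k) \<le> r * (1 + 2 * B)" if "k < ?d" for k
      proof -
        have gV: "g k \<in> V" using g(1) that unfolding discrete_geodesic_def by simp
        have "d (g 0) (g k) = k - 0" using g(1) that less_imp_le unfolding discrete_geodesic_def by blast
        then have dk: "d (w i) (g k) = k" by (simp add: g(2))
        have "height \<Gamma> (g k) \<le> d (g k) (w i) + height \<Gamma> (w i)"
          using height_Lipschitz[OF \<Gamma>(1) \<Gamma>ne gV wij(1)] .
        also have "d (g k) (w i) = k" using d_sym[OF gV wij(1)] dk by simp
        also have "height \<Gamma> (w i) \<le> 4 * q * height \<Gamma> (w i)" using pos by simp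
        also have "\<dots> \<le> r" using near[of i] ij by simp
        finally have "height \<Gamma> (g k) \<le> 2 * r" using that True by simp
        then have "B * height \<Gamma> (g k) \<le> B * (2 * r)" by (rule mult_le_mono2)
        then show ?thesis by (simp add: W_def algebra_simps)
      qed
      have wg: "walk E W (w i) (w j) (\<Sum>k=0..<?d. W (g k))"
        using walk_fun[of ?d g E 0 ?d W] g by simp
      have "(j - i) * r \<le> (\<Sum>k=0..<?d. W (g k))"
        by (rule le_trans[OF lower opt[OF ij wg]])
      also have "\<dots> \<le> ?d * (r * (1 + 2 * B))"
        using sum_bounded_above[of "{0..<?d}" "\<lambda>k. W (g k)"] Wg by simp
      finally have "(j - i) * r \<le> ((1 + 2 * B) * ?d) * r" by (simp add: algebra_simps)
      then show ?thesis using pos by simp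
    next
      case False
      have "N * r \<le> C * r * r"
        using le_trans[OF lower[of N 0, simplified] c0_le[unfolded c0 lessThan_atLeast0]] .
      then have "N \<le> C * r" using pos by simp
      also have "\<dots> \<le> C * ?d" using False by simp
      also have "\<dots> \<le> (1 + 2 * B) * ?d"
      proof (rule mult_le_mono1)
        have "1 * C \<le> 32 * q\<^sup>2 * C" using pos by (intro mult_le_mono1) simp
        then show "C \<le> 1 + 2 * B" unfolding B_def by linarith
      qed
      finally show ?thesis using ij by simp
    qed
  qed (rule wV)
  then show thesis using that w near by blast
qed

text \<open>The slacks 1 and 5 leave room for replacing points of the realisation by vertices and a
  real radius by an integer; \<open>q\<close> stands for roughly \<open>2 / \<rho>\<close>.\<close>

lemma discretely_quasiconvex_imp_divergence:
  assumes A: "A \<subseteq> V" "A \<noteq> {}" and qc: "discretely_quasiconvex A" and q: "q > 0"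
  shows "\<exists>r0. \<forall>r>r0. \<forall>x\<in>V. \<forall>y\<in>V. \<forall>k. height A x \<le> r + 1 \<and> height A y \<le> r + 1 \<and> 3 * r \<le> d x y + 5 \<and>
     (x, y) \<in> (Restr E {w. r \<le> q * height A w}) ^^ k \<longrightarrow> C * r < k"
proof -
  define B where "B = 32 * q\<^sup>2 * (C + 4)"
  obtain M where M: "\<And>N v i. \<lbrakk>discrete_qg (1 + 2 * B) 0 N v; v 0 \<in> A; v N \<in> A; i \<le> N\<rbrakk> \<Longrightarrow> height A (v i) \<le> M"
    using qc unfolding discretely_quasiconvex_def by meson
  have False if r: "r > B + 16 + 4 * q * M" and xy: "x \<in> V" "y \<in> V" "height A x \<le> r + 1" "height A y \<le> r + 1"
      and far: "3 * r \<le> d x y + 5" and path: "(x, y) \<in> (Restr E {w. r \<le> q * height A w}) ^^ k" and k: "k \<le> C * r"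
    for r x y k
  proof -
    obtain a where a: "a \<in> A" "d x a = height A x" using height_attained A by metis
    obtain b where b: "b \<in> A" "d y b = height A y" using height_attained A by metis
    have abV: "a \<in> V" "b \<in> V" using a b A by auto
    obtain f where f: "f 0 = x" "f k = y" "\<And>i. i < k \<Longrightarrow> (f i, f (Suc i)) \<in> Restr E {w. r \<le> q * height A w}"
      using path unfolding relpow_fun_conv by blast
    \<comment> \<open>With at least one edge, every vertex of the walk is an end of an edge in the
      restricted relation and thus inherits the height bound.\<close>
    have "k > 0" using far f r by (cases k) auto
    define P2 where "P2 = f ` {..k}"
    have P2: "w \<in> V" "r \<le> q * height A w" if "w \<in> P2" for w
    proof -
      obtain i where i: "i \<le> k" "w = f i" using \<open>w \<in> P2\<close> by (auto simp: P2_def)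
      then have "w \<in> V \<and> r \<le> q * height A w"
        using f(3)[of i] f(3)[of "i - 1"] \<open>k > 0\<close> E_sub by (cases "i < k") auto
      then show "w \<in> V" "r \<le> q * height A w" by auto
    qed
    define \<Gamma> where "\<Gamma> = interval a x \<union> P2 \<union> interval y b"
    have \<Gamma>V: "\<Gamma> \<subseteq> V" using P2 by (auto simp: \<Gamma>_def interval_def)
    have aG: "a \<in> \<Gamma>" using abV by (simp add: \<Gamma>_def interval_def)
    have p1: "(a, x) \<in> (Restr E \<Gamma>) ^^ d a x" and p3: "(y, b) \<in> (Restr E \<Gamma>) ^^ d y b"
      using interval_walk[of a x \<Gamma>] interval_walk[of y b \<Gamma>] abV xy by (auto simp: \<Gamma>_def)
    have "(f i, f (Suc i)) \<in> Restr E \<Gamma>" if "i < k" for i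
      using f(3)[OF that] that by (auto simp: \<Gamma>_def P2_def)
    then have p2: "(x, y) \<in> (Restr E \<Gamma>) ^^ k"
      unfolding relpow_fun_conv using f(1,2) by blast
    have "(a, b) \<in> (Restr E \<Gamma>) ^^ (d a x + k + d y b)"
      unfolding relpow_add using p1 p2 p3 by blast
    moreover have dax: "d a x \<le> r + 1" and dyb: "d y b \<le> r + 1"
      using a b xy d_sym abV by auto
    then have "d a x + k + d y b \<le> (C + 4) * r"
      using k r by (simp add: algebra_simps)
    ultimately obtain N w where w: "discrete_qg (1 + 2 * B) 0 N w" "w 0 = a" "w N = b"
      "\<And>i. i < N \<Longrightarrow> (w i, w (Suc i)) \<in> E" "\<And>i. i \<le> N \<Longrightarrow> 4 * q * height \<Gamma> (w i) \<le> r"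
      using tame_walk[OF \<Gamma>V aG, of b _ "C + 4" r q] q r unfolding B_def by auto
    have q4: "4 * d u v \<le> 4 * q * d u v" for u v using q by (cases q) auto
    have wV: "w i \<in> V" if "i \<le> N" for i using dqgD(1)[OF w(1) that] .
    have close: "\<exists>p\<in>\<Gamma>. 4 * q * d (w i) p \<le> r" if "i \<le> N" for i
      using w(5)[OF that] aG height_attained[of \<Gamma> "w i"] by (metis empty_iff)
    have "\<exists>i\<le>N. \<exists>p\<in>P2. 4 * q * d (w i) p \<le> r"
    proof (rule ccontr)
      assume no: "\<not> ?thesis"
      \<comment> \<open>At the last index near the first geodesic, either the walk ends or its next
        vertex must be near the other geodesic; both ways the two geodesics come close to each
        other.\<close>
      define near1 where "near1 i \<longleftrightarrow> i \<le> N \<and> (\<exists>p\<in>interval a x. 4 * q * d (w i) p \<le> r)" for i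
      have "near1 0" using w abV by (auto simp: near1_def interval_def intro!: bexI[of _ a])
      define i where "i = (GREATEST i. near1 i)"
      have gt: "\<not> near1 j" if "j > i" for j
        using Greatest_le_nat[of near1 j N] that unfolding i_def by (auto simp: near1_def)
      have i: "near1 i" using GreatestI_nat[of near1 0 N] \<open>near1 0\<close> unfolding i_def by (auto simp: near1_def)
      then obtain p where p: "p \<in> interval a x" "4 * q * d (w i) p \<le> r" and iN: "i \<le> N" by (auto simp: near1_def)
      have "\<exists>s\<in>interval y b. 2 * d p s \<le> r + 2"
      proof (cases "i = N")
        case True
        have pV: "p \<in> V" using p by (simp add: interval_def)
        have "4 * d b p \<le> r" using le_trans[OF q4 p(2)] True w(3) by simp
        then show ?thesis using d_sym[of p b] abV pV xy by (intro bexI[of _ b]) (auto simp: interval_def)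
      next
        case False
        then have iN': "Suc i \<le> N" using iN by simp
        obtain s where s: "s \<in> \<Gamma>" "4 * q * d (w (Suc i)) s \<le> r" using close[OF iN'] by blast
        then have sI: "s \<in> interval y b"
          using gt[of "Suc i"] no iN' by (auto simp: near1_def \<Gamma>_def)
        have V: "p \<in> V" "s \<in> V" "w i \<in> V" "w (Suc i) \<in> V"
          using p sI wV iN iN' by (auto simp: interval_def)
        have "4 * d (w i) p \<le> r" "4 * d (w (Suc i)) s \<le> r"
          using le_trans[OF q4 p(2)] le_trans[OF q4 s(2)] by auto
        moreover have "d p s \<le> d p (w i) + d (w i) s" "d (w i) s \<le> d (w i) (w (Suc i)) + d (w (Suc i)) s"
          using d_triangle V by auto
        moreover have "d (w i) (w (Suc i)) \<le> 1" using w(4)[of i] iN' d_edge by simp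
        moreover have "d p (w i) = d (w i) p" using d_sym V by simp
        ultimately show ?thesis using sI by (intro bexI[of _ s]) linarith+
      qed
      then obtain s where s: "s \<in> interval y b" "2 * d p s \<le> r + 2" by blast
      have V: "p \<in> V" "s \<in> V" using p s by (auto simp: interval_def)
      have "d x y \<le> d x p + d p y" "d p y \<le> d p s + d s y"
        using d_triangle V xy by auto
      moreover have "d x p = d p x" "d s y = d y s" using d_sym V xy by auto
      moreover have "d p x \<le> d a x" "d y s \<le> d y b" using p s by (auto simp: interval_def)
      \<comment> \<open>The pieces give \<open>2 * d x y \<le> 5 * r + 6\<close>, which contradicts
        \<open>far\<close> once \<open>r > 16\<close>.\<close>
      ultimately show False using s far dax dyb r by linarith
    qed
    then obtain i p where i: "i \<le> N" "p \<in> P2" "4 * q * d (w i) p \<le> r" by blast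
    have "height A p \<le> d p (w i) + height A (w i)" using height_Lipschitz[OF A] P2[OF i(2)] wV[OF i(1)] by simp
    moreover have "d p (w i) = d (w i) p" using d_sym P2[OF i(2)] wV[OF i(1)] by simp
    moreover have "height A (w i) \<le> M" using M[OF w(1) _ _ i(1)] w a b by simp
    ultimately have "height A p \<le> d (w i) p + M" by simp
    \<comment> \<open>Since \<open>p\<close> has height at least \<open>r / q\<close> and lies
      within \<open>r / (4 * q)\<close> of a vertex of height at most \<open>M\<close>, this forces
      \<open>3 * r \<le> 4 * q * M\<close>.\<close>
    then have "4 * q * height A p \<le> 4 * q * (d (w i) p + M)" by (rule mult_le_mono2)
    moreover have "4 * r \<le> 4 * q * height A p" using P2(2)[OF i(2)] by simp
    ultimately show False using i(3) r by (simp add: algebra_simps)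
  qed
  then show ?thesis by (intro exI[of _ "B + 16 + 4 * q * M"]) (meson not_le)
qed

text \<open>Only \<open>\<rho> = 1\<close> is needed for the implication from divergence to quasiconvexity.\<close>
definition superlinear_divergence :: "nat \<Rightarrow> 'a set \<Rightarrow> bool" where
  "superlinear_divergence n0 A \<longleftrightarrow> (\<forall>C. \<exists>r0. \<forall>r>r0. \<forall>x\<in>V. \<forall>y\<in>V. \<forall>k. height A x = r \<and> height A y = r \<and> n0 * r \<le> d x y \<and>
     (x, y) \<in> (Restr E {w. r \<le> height A w}) ^^ k \<longrightarrow> C * r < k)"

section \<open>From super linear divergence to quasiconvexity\<close>

lemma relpow_Restr_sym: "(x, y) \<in> (Restr E Z) ^^ k \<Longrightarrow> (y, x) \<in> (Restr E Z) ^^ k"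
proof (induction k arbitrary: x y)
  case (Suc k)
  then obtain w where "(x, w) \<in> (Restr E Z) ^^ k" "(w, y) \<in> Restr E Z" by auto
  moreover have "(y, w) \<in> Restr E Z" using \<open>(w, y) \<in> Restr E Z\<close> E_sym by (auto dest: symD)
  ultimately show ?case using Suc.IH by (metis relpow_Suc_I2)
qed auto

text \<open>Consecutive samples are joined by geodesics; asking for whole intervals inside
  \<open>Z\<close> makes the choice of geodesic irrelevant.\<close>

lemma coarse_walk:
  assumes v: "\<And>l. i \<le> l \<Longrightarrow> l \<le> j \<Longrightarrow> v l \<in> V"
    and step: "\<And>l. i \<le> l \<Longrightarrow> l < j \<Longrightarrow> d (v l) (v (Suc l)) \<le> B \<and> interval (v l) (v (Suc l)) \<subseteq> Z"
    and "i \<le> j"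
  shows "\<exists>k \<le> B * (j - i). (v i, v j) \<in> (Restr E Z) ^^ k"
  using \<open>i \<le> j\<close> v step
proof (induction j rule: dec_induct)
  case base
  show ?case by (intro exI[of _ 0]) simp
next
  case (step j)
  then obtain k where k: "k \<le> B * (j - i)" "(v i, v j) \<in> (Restr E Z) ^^ k" by auto
  have s: "d (v j) (v (Suc j)) \<le> B" "(v j, v (Suc j)) \<in> (Restr E Z) ^^ d (v j) (v (Suc j))"
    using step.prems(2)[of j] interval_walk step.prems(1)[of j] step.prems(1)[of "Suc j"] step.hyps by auto
  have "(v i, v (Suc j)) \<in> (Restr E Z) ^^ (k + d (v j) (v (Suc j)))"
    unfolding relpow_add using k s by blast
  moreover have "k + d (v j) (v (Suc j)) \<le> B * (Suc j - i)"
    using k s step.hyps by (simp add: Suc_diff_le)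
  ultimately show ?case by blast
qed

text \<open>Around the highest sample, the piece above height \<open>2 * r\<close> is cut out and
  its ends are lowered to height \<open>r\<close>. If the piece lasts at most
  \<open>\<Lambda> * r\<close>, super linearity forces the lowered ends within
  \<open>n0 * r\<close>. The lower quasi-geodesic bound then limits the duration.\<close>

lemma divergence_imp_discretely_quasiconvex:
  assumes A: "A \<subseteq> V" "A \<noteq> {}" and dv: "superlinear_divergence n0 A"
  shows "discretely_quasiconvex A"
proof -
  have "\<exists>M. \<forall>N v. discrete_qg K L N v \<and> v 0 \<in> A \<and> v N \<in> A \<longrightarrow> (\<forall>i\<le>N. height A (v i) \<le> M)"
    if K: "K > 0" for K L
  proof -
    define B where "B = K + L"
    \<comment> \<open>A complete excursion with close ends lasts at most
      \<open>(K * (n0 + 2) + 1) * r\<close>, hence climbs at most \<open>B\<close> times that above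
      \<open>2 * r\<close>; \<open>m\<close> exceeds the resulting multiple of \<open>r\<close>. If
      the piece is truncated, its end may have height \<open>(m + 1) * r\<close>, which explains the
      \<open>m\<close> inside \<Lambda>.\<close>
    define m where "m = B * (K * (n0 + 2) + 1) + 3"
    define \<Lambda> where "\<Lambda> = K * (n0 + m + 2) + 2"
    \<comment> \<open>The slope covers the three pieces of the test walk: descents of lengths at
      most \<open>r\<close> and \<open>m * r\<close>, and at most \<open>\<Lambda> * r\<close>
      samples at cost \<open>B\<close> each.\<close>
    obtain r0 where r0: "\<And>r x y k. \<lbrakk>r > r0; x \<in> V; y \<in> V; height A x = r; height A y = r; n0 * r \<le> d x y;
      (x, y) \<in> (Restr E {w. r \<le> height A w}) ^^ k\<rbrakk> \<Longrightarrow> (m + 2 + B * \<Lambda>) * r < k"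
      using dv unfolding superlinear_divergence_def by meson
    have excursion: False
      if v: "discrete_qg K L N v" "v 0 \<in> A" "v N \<in> A" and i0: "i0 \<le> N" and max: "\<And>i. i \<le> N \<Longrightarrow> height A (v i) \<le> height A (v i0)"
        and big: "height A (v i0) \<ge> m * (r0 + 2 * B + L + 1 + m)" for N v i0
    proof -
      \<comment> \<open>The threshold \<open>big\<close> makes \<open>r\<close> exceed
        \<open>r0\<close> for super linearity, \<open>2 * B\<close> so that geodesics between
        samples stay above \<open>r\<close>, \<open>L\<close> so that additive errors are absorbed,
        and \<open>m\<close> so that the remainder of the division is at most
        \<open>r\<close>.\<close>
      define r where "r = height A (v i0) div m"
      have m0: "m > 0" by (simp add: m_def)
      have r_big: "r \<ge> r0 + 2 * B + L + 1 + m"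
        using big m0 by (simp add: r_def less_eq_div_iff_mult_less_eq mult.commute)
      have eq: "height A (v i0) = m * r + height A (v i0) mod m" unfolding r_def by simp
      moreover have "height A (v i0) mod m < m" using m0 by simp
      ultimately have D: "m * r \<le> height A (v i0)" "height A (v i0) \<le> (m + 1) * r"
        using r_big by (linarith, simp)
      have vV: "v i \<in> V" if "i \<le> N" for i using dqgD(1)[OF v(1) that] .
      have zero: "height A a = 0" if "a \<in> A" for a using height_le[OF that, of a] by simp
      have step: "d (v i) (v (Suc i)) \<le> B" if "Suc i \<le> N" for i
        using dqgD(2)[OF v(1), of i "Suc i"] that by (simp add: B_def)
      have lip: "height A u \<le> d u w + height A w \<and> height A w \<le> d u w + height A u" if "u \<in> V" "w \<in> V" for u w
        using height_Lipschitz[OF A that] height_Lipschitz[OF A that(2,1)] d_sym[OF that] by simp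
      have "2 * r < m * r" using r_big by (simp add: m_def)
      then have hi0: "2 * r < height A (v i0)" using D by linarith
      define low where "low i \<longleftrightarrow> i \<le> i0 \<and> height A (v i) < 2 * r" for i
      have "low 0" using zero[OF v(2)] r_big by (simp add: low_def)
      define i1 where "i1 = (GREATEST i. low i)"
      have i1: "low i1" using GreatestI_nat[of low 0 i0] \<open>low 0\<close> unfolding i1_def by (auto simp: low_def)
      have i1_max: "\<not> low i" if "i > i1" for i
        using Greatest_le_nat[of low i i0] that unfolding i1_def by (auto simp: low_def)
      have i1_less: "i1 < i0" using i1 hi0 unfolding low_def by (cases "i1 = i0") auto
      define high where "high i \<longleftrightarrow> i0 \<le> i \<and> i \<le> N \<and> height A (v i) < 2 * r" for i
      have "high N" using zero[OF v(3)] r_big i0 by (simp add: high_def)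
      define i2 where "i2 = (LEAST i. high i)"
      have i2: "high i2" unfolding i2_def using \<open>high N\<close> by (rule LeastI)
      have i2_min: "\<not> high i" if "i < i2" for i using that not_less_Least unfolding i2_def by blast
      have i02: "i0 < i2" using hi0 i2 by (cases "i0 = i2") (auto simp: high_def)
      have i12: "i1 < i2" "i2 \<le> N" using i2 i1_less by (auto simp: high_def)
      have mid: "2 * r \<le> height A (v i)" if "i1 < i" "i < i2" for i
        using i1_max[OF that(1)] i2_min[OF that(2)] that i12 unfolding low_def high_def
        by (cases "i \<le> i0") auto
      have all: "2 * r \<le> height A (v i) + B" if i: "i1 \<le> i" "i \<le> i2" for i
      proof -
        consider "i = i1" | "i = i2" | "i1 < i" "i < i2" using i by linarith
        then show ?thesis
        proof cases
          case 1
          have "2 * r \<le> height A (v (Suc i1))"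
            using mid[of "Suc i1"] i1_less i02 by simp
          then show ?thesis using lip[of "v i1" "v (Suc i1)"] step[of i1] vV[of i1] vV[of "Suc i1"] i12 1 by force
        next
          case 2
          have e: "Suc (i2 - 1) = i2" using i02 by simp
          have "2 * r \<le> height A (v (i2 - 1))" using mid[of "i2 - 1"] i1_less i02 by auto
          then show ?thesis
            using lip[of "v (i2 - 1)" "v i2"] step[of "i2 - 1"] vV[of i2] vV[of "i2 - 1"] i12 2 e by force
        next
          case 3
          then show ?thesis using mid[of i] by simp
        qed
      qed
      have connected: "\<exists>k \<le> B * (j - i1). (v i1, v j) \<in> (Restr E {w. r \<le> height A w}) ^^ k"
        if j: "i1 \<le> j" "j \<le> i2" for j
      proof (rule coarse_walk)
        fix l assume l: "i1 \<le> l" "l < j"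
        have lV: "v l \<in> V" "v (Suc l) \<in> V" using vV l j i12 by auto
        have "r \<le> height A w" if "w \<in> interval (v l) (v (Suc l))" for w
        proof -
          have "w \<in> V" "d (v l) w \<le> d (v l) (v (Suc l))" using that by (auto simp: interval_def)
          then show ?thesis using lip[OF lV(1), of w] step[of l] all[of l] l j i12 r_big by force
        qed
        then show "d (v l) (v (Suc l)) \<le> B \<and> interval (v l) (v (Suc l)) \<subseteq> {w. r \<le> height A w}"
          using step[of l] l j i12 by auto
      qed (use vV j i12 in auto)
      have drop: "n0 * r > d x y" if j: "i1 < j" "j \<le> i2" "j - i1 \<le> \<Lambda> * r"
        and x: "x \<in> V" "height A x = r" "d (v i1) x = height A (v i1) - r"
           "(v i1, x) \<in> (Restr E {w. r \<le> height A w}) ^^ (height A (v i1) - r)"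
        and y: "y \<in> V" "height A y = r" "d (v j) y = height A (v j) - r"
           "(v j, y) \<in> (Restr E {w. r \<le> height A w}) ^^ (height A (v j) - r)" for j x y
      proof (rule ccontr)
        assume "\<not> ?thesis"
        then have far: "n0 * r \<le> d x y" by simp
        obtain k where k: "k \<le> B * (j - i1)" "(v i1, v j) \<in> (Restr E {w. r \<le> height A w}) ^^ k"
          using connected[of j] j by auto
        have "(x, y) \<in> (Restr E {w. r \<le> height A w}) ^^ ((height A (v i1) - r) + k + (height A (v j) - r))"
          unfolding relpow_add using relpow_Restr_sym[OF x(4)] k(2) y(4) by blast
        then have "(m + 2 + B * \<Lambda>) * r < (height A (v i1) - r) + k + (height A (v j) - r)"
          using r0[of r x y] x y far r_big by simp
        moreover have "k \<le> B * (\<Lambda> * r)" using k(1) mult_le_mono2[OF j(3), of B] by linarith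
        moreover have "height A (v i1) < 2 * r" using i1 by (simp add: low_def)
        moreover have "height A (v j) \<le> (m + 1) * r" using max[of j] D j i12 by simp
        ultimately show False by (simp add: algebra_simps)
      qed
      obtain x where x: "x \<in> V" "height A x = r" "d (v i1) x = height A (v i1) - r"
           "(v i1, x) \<in> (Restr E {w. r \<le> height A w}) ^^ (height A (v i1) - r)"
        using descend[OF A, of "v i1" r] vV[of i1] all[of i1] i12 r_big by auto
      have descend_j: "\<exists>y. y \<in> V \<and> height A y = r \<and> d (v j) y = height A (v j) - r \<and>
           (v j, y) \<in> (Restr E {w. r \<le> height A w}) ^^ (height A (v j) - r)" if "i1 \<le> j" "j \<le> i2" for j
proof -
        have "v j \<in> V" "r \<le> height A (v j)" using vV[of j] all[of j] that i12 r_big by auto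
        from descend[OF A this] show ?thesis by metis
      qed
      have dist: "j - i1 \<le> K * (d x y + r + (height A (v j) - r)) + L"
        if j: "i1 < j" "j \<le> i2" and y: "y \<in> V" "d (v j) y = height A (v j) - r" for j y
      proof -
        have V: "v i1 \<in> V" "v j \<in> V" using vV i12 j by auto
        have "d (v i1) (v j) \<le> d (v i1) x + d x (v j)" "d x (v j) \<le> d x y + d y (v j)"
          using d_triangle V x(1) y(1) by auto
        moreover have "d y (v j) = d (v j) y" using d_sym V y by auto
        moreover have "d (v i1) x \<le> r" using x(3) i1 unfolding low_def by linarith
        ultimately have "d (v i1) (v j) \<le> d x y + r + (height A (v j) - r)" using y by linarith
        then have "K * d (v i1) (v j) \<le> K * (d x y + r + (height A (v j) - r))" by (rule mult_le_mono2)
        then show ?thesis using dqgD(3)[OF v(1), of i1 j] j i12 by linarith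
      qed
      show False
      \<comment> \<open>In the first case the whole excursion is tested and contradicts the choice
        of \<open>m\<close>; otherwise only its initial part of duration
        \<open>\<Lambda> * r\<close> is tested and contradicts the choice of \<Lambda>.\<close>
      proof (cases "i2 - i1 \<le> \<Lambda> * r")
        case True
        obtain y where y: "y \<in> V" "height A y = r" "d (v i2) y = height A (v i2) - r"
           "(v i2, y) \<in> (Restr E {w. r \<le> height A w}) ^^ (height A (v i2) - r)"
          using descend_j[of i2] i12 by auto
        have "d x y \<le> n0 * r" using drop[OF _ _ True x y] i12 by simp
        moreover have "height A (v i2) - r \<le> r" using i2 unfolding high_def by linarith
        ultimately have "d x y + r + (height A (v i2) - r) \<le> (n0 + 2) * r" by (simp add: algebra_simps)
        then have "K * (d x y + r + (height A (v i2) - r)) \<le> K * ((n0 + 2) * r)" by (rule mult_le_mono2)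
        then have "i2 - i1 \<le> K * ((n0 + 2) * r) + L"
          using dist[OF i12(1) le_refl y(1,3)] by linarith
        then have "i2 - i1 \<le> (K * (n0 + 2) + 1) * r" using r_big by (simp add: algebra_simps)
        then have "B * (i2 - i1) \<le> B * ((K * (n0 + 2) + 1) * r)" by (rule mult_le_mono2)
        moreover have "height A (v i0) \<le> 2 * r + B * (i2 - i1)"
        proof -
          have "d (v i1) (v i0) \<le> K * (i0 - i1) + L * 1"
            using dqgD(2)[OF v(1), of i1 i0] i0 i1_less by simp
          also have "\<dots> \<le> K * (i0 - i1) + L * (i0 - i1)"
            using i1_less by (intro add_left_mono mult_le_mono2) simp
          also have "\<dots> = B * (i0 - i1)" by (simp add: B_def algebra_simps)
          also have "\<dots> \<le> B * (i2 - i1)" using i2 by (intro mult_le_mono2) (auto simp: high_def)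
          finally show ?thesis using lip[of "v i1" "v i0"] vV[of i1] vV[of i0] i0 i12 i1 by (auto simp: low_def)
        qed
        ultimately have "m * r \<le> (2 + B * (K * (n0 + 2) + 1)) * r" using D by (simp add: algebra_simps)
        then have "m \<le> 2 + B * (K * (n0 + 2) + 1)" using r_big unfolding mult_le_cancel2 by linarith
        then show False by (simp add: m_def)
      next
        case False
        define j where "j = i1 + \<Lambda> * r"
        have "\<Lambda> * r > 0" using r_big by (simp add: \<Lambda>_def)
        then have j: "i1 < j" "j \<le> i2" "j - i1 \<le> \<Lambda> * r" "j - i1 = \<Lambda> * r" using False by (auto simp: j_def)
        obtain y where y: "y \<in> V" "height A y = r" "d (v j) y = height A (v j) - r"
           "(v j, y) \<in> (Restr E {w. r \<le> height A w}) ^^ (height A (v j) - r)"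
          using descend_j[of j] j by auto
        have "d x y \<le> n0 * r" using drop[OF j(1-3) x y] by simp
        moreover have "height A (v j) - r \<le> (m + 1) * r" using max[of j] D j i12 by simp
        ultimately have "d x y + r + (height A (v j) - r) \<le> (n0 + m + 2) * r" by (simp add: algebra_simps)
        then have "K * (d x y + r + (height A (v j) - r)) \<le> K * ((n0 + m + 2) * r)" by (rule mult_le_mono2)
        then have "\<Lambda> * r \<le> K * ((n0 + m + 2) * r) + L"
          using dist[OF j(1,2) y(1,3)] j(4) by linarith
        then have "\<Lambda> * r \<le> (K * (n0 + m + 2) + 1) * r" using r_big by (simp add: algebra_simps)
        then have "\<Lambda> \<le> K * (n0 + m + 2) + 1" using r_big unfolding mult_le_cancel2 by linarith
        then show False by (simp add: \<Lambda>_def)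
      qed
    qed
    then have "height A (v i) \<le> m * (r0 + 2 * B + L + 1 + m)"
      if v: "discrete_qg K L N v" "v 0 \<in> A" "v N \<in> A" and i: "i \<le> N" for N v i
    proof -
      obtain i0 where i0: "i0 \<le> N" "\<And>i. i \<le> N \<Longrightarrow> height A (v i) \<le> height A (v i0)"
        using Max_in[of "(\<lambda>i. height A (v i)) ` {..N}"] Max_ge[of "(\<lambda>i. height A (v i)) ` {..N}"] by fastforce
      have "height A (v i0) < m * (r0 + 2 * B + L + 1 + m)"
        using excursion[OF v i0(1) i0(2)] not_le by blast
      then show ?thesis using i0(2)[OF i] by linarith
    qed
    then show ?thesis by blast
  qed
  moreover have "discrete_qg (Suc K) L N v" if "discrete_qg K L N v" for K L N v using discrete_qg_mono[OF that] by simp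
  ultimately show ?thesis unfolding discretely_quasiconvex_def by (meson zero_less_Suc)
qed
end

section \<open>Thin bigons in hyperbolic graphs\<close>

context vgraph
begin

text \<open>Let \<open>D\<close> be the distance from \<open>f i\<close> to a later point of
  \<open>u\<close>. As the geodesic ends at a nearest point of \<open>u\<close>, its remaining
  length is at most \<open>D\<close>; the distance along \<open>u\<close> is then measured by at
  most \<open>2 * D\<close>. The sum explains the factor 3.\<close>

lemma concat_discrete_qg:
  assumes f: "discrete_geodesic n f" and u: "discrete_qg 1 L N u" "f n = u 0"
    and nearest: "\<And>j. j \<le> N \<Longrightarrow> n \<le> d (f 0) (u j)"
  shows "discrete_qg 3 L (n + N) (\<lambda>i. if i \<le> n then f i else u (i - n))"
proof (rule dqgI)
  have fV: "f i \<in> V" if "i \<le> n" for i using f that by (simp add: discrete_geodesic_def)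
  have fd: "d (f i) (f j) = j - i" if "i \<le> j" "j \<le> n" for i j using f that by (simp add: discrete_geodesic_def)
  show "(if i \<le> n then f i else u (i - n)) \<in> V" if "i \<le> n + N" for i
    using fV dqgD(1)[OF u(1)] that by auto
  fix i j assume ij: "i \<le> j" "j \<le> n + N"
  consider "j \<le> n" | "n < i" | "i \<le> n" "n < j" using ij by linarith
  then have "d (if i \<le> n then f i else u (i - n)) (if j \<le> n then f j else u (j - n)) \<le> 3 * (j - i) + L \<and>
     j - i \<le> 3 * d (if i \<le> n then f i else u (i - n)) (if j \<le> n then f j else u (j - n)) + L"
  proof cases
    case 1
    then show ?thesis using fd[of i j] ij by simp
  next
    case 2
    then have e: "i - n \<le> j - n" "j - n \<le> N" "j - n - (i - n) = j - i" using ij by auto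
    have eq: "(if i \<le> n then f i else u (i - n)) = u (i - n)" "(if j \<le> n then f j else u (j - n)) = u (j - n)"
      using 2 ij by auto
    show ?thesis
      using dqgD(2)[OF u(1) e(1,2)] dqgD(3)[OF u(1) e(1,2)] unfolding eq e(3) by linarith
  next
    case 3
    let ?b = "u (j - n)"
    have V: "f 0 \<in> V" "f i \<in> V" "f n \<in> V" "?b \<in> V" using fV 3 ij dqgD(1)[OF u(1)] by auto
    have "d (f i) ?b \<le> d (f i) (f n) + d (f n) ?b" "d (f n) ?b \<le> d (f n) (f i) + d (f i) ?b"
      "d (f 0) ?b \<le> d (f 0) (f i) + d (f i) ?b"
      using d_triangle V by auto
    moreover have "d (f n) (f i) = d (f i) (f n)" using d_sym V by simp
    moreover have "d (f i) (f n) = n - i" "d (f 0) (f i) = i" using fd 3 by auto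
    moreover have "n \<le> d (f 0) ?b" using nearest[of "j - n"] ij 3 by auto
    moreover have "d (f n) ?b \<le> 1 * (j - n) + L" "j - n \<le> 1 * d (f n) ?b + L"
      using dqgD(2)[OF u(1), of 0 "j - n"] dqgD(3)[OF u(1), of 0 "j - n"] ij u(2) 3 by auto
    moreover have eq: "(if i \<le> n then f i else u (i - n)) = f i" "(if j \<le> n then f j else u (j - n)) = ?b"
      using 3 by auto
    ultimately show ?thesis unfolding eq using 3 by linarith
  qed
  then show "d (if i \<le> n then f i else u (i - n)) (if j \<le> n then f j else u (j - n)) \<le> 3 * (j - i) + L"
    "j - i \<le> 3 * d (if i \<le> n then f i else u (i - n)) (if j \<le> n then f j else u (j - n)) + L"
    by blast+
qed

text \<open>The sides are quasi-geodesics and not geodesics because sides of triangles in the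
  realisation are only available after sampling.\<close>

lemma thin_bigons_imp_slim_triangles:
  assumes thin_bigons
  shows "\<exists>R. \<forall>Na a Nb b Nc c. discrete_qg 1 L Na a \<and> discrete_qg 1 L Nb b \<and> discrete_qg 1 L Nc c \<and>
     a Na = b 0 \<and> b Nb = c 0 \<and> c Nc = a 0 \<longrightarrow>
     (\<forall>i\<le>Na. (\<exists>j\<le>Nb. d (a i) (b j) \<le> R) \<or> (\<exists>j\<le>Nc. d (a i) (c j) \<le> R))"
proof -
  obtain R where R: "\<And>N v N' v' i. \<lbrakk>discrete_qg 3 L N v; discrete_qg 3 L N' v'; v 0 = v' 0; v N = v' N'; i \<le> N\<rbrakk>
      \<Longrightarrow> \<exists>j\<le>N'. d (v i) (v' j) \<le> R"
    using assms unfolding thin_bigons_def by meson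
  have "(\<exists>j\<le>Nb. d (a i) (b j) \<le> 2 * R) \<or> (\<exists>j\<le>Nc. d (a i) (c j) \<le> 2 * R)"
    if a: "discrete_qg 1 L Na a" and b: "discrete_qg 1 L Nb b" and c: "discrete_qg 1 L Nc c"
      and ends: "a Na = b 0" "b Nb = c 0" "c Nc = a 0" and i: "i \<le> Na" for Na a Nb b Nc c i
  proof -
    have aV: "a i \<in> V" "a 0 \<in> V" using dqgD(1)[OF a] i by auto
    obtain j0 where j0: "j0 \<le> Nb" "\<And>j. j \<le> Nb \<Longrightarrow> d (a 0) (b j0) \<le> d (a 0) (b j)"
      using ex_has_least_nat[of "\<lambda>j. j \<le> Nb" 0 "\<lambda>j. d (a 0) (b j)"] by auto
    define n where "n = d (a 0) (b j0)"
    have bV: "b j0 \<in> V" using dqgD(1)[OF b j0(1)] .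
    obtain f where f: "discrete_geodesic n f" "f 0 = a 0" "f n = b j0"
      by (rule discrete_geodesic_ex[OF aV(2) bV], fold n_def, rule that) blast+
    \<comment> \<open>\<open>p\<close> and \<open>q\<close> share the geodesic to the point of
      \<open>b\<close> nearest to \<open>a 0\<close> and then follow \<open>b\<close> in opposite
      directions. A point of \<open>a\<close> is close to \<open>p\<close>; if the close point is on
      the shared part, it lies on \<open>q\<close> as well and a second bigon leads to
      \<open>c\<close>.\<close>
    define p where "p = (\<lambda>i. if i \<le> n then f i else b (j0 - (i - n)))"
    define q where "q = (\<lambda>i. if i \<le> n then f i else b (j0 + (i - n)))"
    have p: "discrete_qg 3 L (n + j0) p" unfolding p_def
      using concat_discrete_qg[OF f(1) discrete_qg_rev[OF b j0(1)]] j0 f n_def by simp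
    have q: "discrete_qg 3 L (n + (Nb - j0)) q" unfolding q_def
      using concat_discrete_qg[OF f(1) discrete_qg_shift[OF b j0(1)]] j0 f n_def by simp
    have a3: "discrete_qg 3 L Na a" using discrete_qg_mono[OF a] by simp
    have c3: "discrete_qg 3 L Nc (\<lambda>i. c (Nc - i))" using discrete_qg_mono[OF discrete_qg_rev[OF c le_refl]] by simp
    have "\<exists>k\<le>n + j0. d (a i) (p k) \<le> R"
      using R[OF a3 p _ _ i] ends f by (cases "j0 = 0") (auto simp: p_def)
    then obtain k where k: "k \<le> n + j0" "d (a i) (p k) \<le> R" by blast
    show ?thesis
    proof (cases "k \<le> n")
      case False
      then have "d (a i) (b (j0 - (k - n))) \<le> 2 * R" using k by (simp add: p_def)
      then show ?thesis using j0(1) diff_le_self le_trans by blast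
    next
      case True
      then have pq: "p k = q k" "k \<le> n + (Nb - j0)" by (auto simp: p_def q_def)
      have qe: "q 0 = c Nc" "q (n + (Nb - j0)) = c 0"
        using f ends j0(1) by (cases "j0 = Nb"; force simp: q_def)+
      obtain j where j: "j \<le> Nc" "d (q k) (c (Nc - j)) \<le> R"
        using R[OF q c3 _ _ pq(2)] qe by auto
      have V: "p k \<in> V" "c (Nc - j) \<in> V" using dqgD(1)[OF p k(1)] dqgD(1)[OF c] by auto
      have "d (a i) (c (Nc - j)) \<le> 2 * R"
        using d_triangle[OF aV(1) V] k j pq by simp
      then show ?thesis using diff_le_self by blast
    qed
  qed
  then show ?thesis by (intro exI[of _ "2 * R"]) blast
qed

text \<open>Bisecting the path gives a bound logarithmic in its length; a quasi-geodesic detour of linear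
  length therefore cannot avoid a large ball around \<open>p\<close>.\<close>
lemma coarse_path_close:
  assumes slim: "slim_intervals \<delta>"
    and v: "\<And>l. l \<le> N \<Longrightarrow> v l \<in> V" and step: "\<And>l. l < N \<Longrightarrow> d (v l) (v (Suc l)) \<le> B"
  shows "\<lbrakk>i \<le> j; j \<le> N; j - i \<le> 2 ^ m; p \<in> interval (v i) (v j)\<rbrakk> \<Longrightarrow> \<exists>l\<le>N. d p (v l) \<le> \<delta> * m + B"
proof (induction m arbitrary: i j p)
  case 0
  then have "j = i \<or> j = Suc i" by auto
  then have "d (v i) (v j) \<le> B" using step[of i] 0 by auto
  moreover have "d p (v j) \<le> d (v i) (v j)" using 0 by (auto simp: interval_def)
  ultimately show ?case using 0 by (intro exI[of _ j]) simp
next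
  case (Suc m)
  define k where "k = (i + j) div 2"
  have k: "i \<le> k" "k \<le> j" "k - i \<le> 2 ^ m" "j - k \<le> 2 ^ m" using Suc.prems by (auto simp: k_def)
  have V: "v i \<in> V" "v j \<in> V" "v k \<in> V" "p \<in> V" using v Suc.prems k by (auto simp: interval_def)
  obtain q where q: "q \<in> interval (v j) (v k) \<union> interval (v k) (v i)" "d p q \<le> \<delta>"
    using slim V Suc.prems(4) unfolding slim_intervals_def by blast
  then have "q \<in> interval (v k) (v j) \<or> q \<in> interval (v i) (v k)" using interval_sym V by auto
  then obtain l where l: "l \<le> N" "d q (v l) \<le> \<delta> * m + B"
    using Suc.IH[of k j q] Suc.IH[of i k q] k Suc.prems by fastforce
  have "q \<in> V" using q by (auto simp: interval_def)
  then have "d p (v l) \<le> d p q + d q (v l)" using d_triangle V v l by simp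
  then show ?case using l q by (intro exI[of _ l]) simp
qed

section \<open>The Morse lemma\<close>

lemma linear_le_power2:
  fixes a b :: nat
  shows "\<exists>m1. \<forall>m\<ge>m1. a + b * m \<le> 2 ^ m"
proof -
  have sq: "m\<^sup>2 \<le> 2 ^ m" if "m \<ge> 4" for m :: nat
    using that
  proof (induction m rule: dec_induct)
    case (step m)
    have "(Suc m)\<^sup>2 = m\<^sup>2 + 2 * m + 1" by (simp add: power2_eq_square)
    also have "\<dots> \<le> m\<^sup>2 + m\<^sup>2"
    proof -
      have "4 * m \<le> m * m" using step.hyps(1) by (rule mult_le_mono1)
      then show ?thesis using step.hyps(1) unfolding power2_eq_square by linarith
    qed
    finally show ?case using step.IH by simp
  qed simp
  have "a + b * m \<le> 2 ^ m" if m: "m \<ge> a + b + 4" for m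
  proof -
    have "a + b * m \<le> a * m + b * m" using m by simp
    also have "\<dots> \<le> m * m" using mult_le_mono1[of "a + b" m m] m by (simp add: algebra_simps)
    also have "\<dots> \<le> 2 ^ m" using sq[of m] m by (simp add: power2_eq_square)
    finally show ?thesis .
  qed
  then show ?thesis by blast
qed

lemma slim_intervals_mono:
  assumes "slim_intervals \<delta>" "\<delta> \<le> \<delta>'"
  shows "slim_intervals \<delta>'"
  unfolding slim_intervals_def
proof (intro ballI)
  fix x y z p assume "x \<in> V" "y \<in> V" "z \<in> V" "p \<in> interval x y"
  then obtain q where "q \<in> interval y z \<union> interval z x" "d p q \<le> \<delta>"
    using assms(1) unfolding slim_intervals_def by blast
  then show "\<exists>q\<in>interval y z \<union> interval z x. d p q \<le> \<delta>'" using assms(2) le_trans by blast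
qed

text \<open>At the interval point farthest from the quasi-geodesic, a quadrilateral of size
  comparable to \<open>D\<close> bounds \<open>D\<close> by the logarithm of a linear function of
  \<open>D\<close>, and hence absolutely.\<close>

lemma interval_near_quasi_geodesic:
  assumes slim: "slim_intervals \<delta>" and \<delta>: "\<delta> > 0"
  shows "\<exists>R. \<forall>N v. discrete_qg K L N v \<longrightarrow> (\<forall>p\<in>interval (v 0) (v N). \<exists>l\<le>N. d p (v l) \<le> R)"
proof -
  define B where "B = K + L"
  obtain m1 where m1: "\<And>m. m \<ge> m1 \<Longrightarrow> (K * (6 * (2 * \<delta> + \<delta> + B)) + L) + (K * 6 * \<delta>) * m \<le> 2 ^ m"
    using linear_le_power2 by blast
  have "\<exists>l\<le>N. d p (v l) \<le> 2 * \<delta> + \<delta> * m1 + B" if v: "discrete_qg K L N v" and p: "p \<in> interval (v 0) (v N)" for N v p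
  proof -
    let ?S = "v ` {..N}"
    have vV: "v i \<in> V" if "i \<le> N" for i using dqgD(1)[OF v that] .
    have S: "?S \<subseteq> V" "?S \<noteq> {}" using vV by auto
    have step: "d (v l) (v (Suc l)) \<le> B" if "l < N" for l
      using dqgD(2)[OF v, of l "Suc l"] that by (simp add: B_def)
    \<comment> \<open>Intervals may be infinite in a general graph, so the maximum comes from a
      bound on the heights.\<close>
    have "height ?S x < Suc (d (v 0) (v N))" if "x \<in> interval (v 0) (v N)" for x
    proof -
      have "height ?S x \<le> d x (v N)" by (intro height_le) auto
      then show ?thesis using that by (simp add: interval_def)
    qed
    then obtain x where x: "x \<in> interval (v 0) (v N)" "\<And>y. y \<in> interval (v 0) (v N) \<Longrightarrow> height ?S y \<le> height ?S x"
      using ex_has_greatest_nat[of "\<lambda>x. x \<in> interval (v 0) (v N)" p "height ?S" "Suc (d (v 0) (v N))"] p by blast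
    define D where "D = height ?S x"
    have V: "x \<in> V" "v 0 \<in> V" "v N \<in> V" using x vV by (auto simp: interval_def)
    have D_le: "D \<le> d x (v l)" if "l \<le> N" for l unfolding D_def using that by (intro height_le) auto
    \<comment> \<open>\<open>y\<close> and \<open>z\<close> lie on the two sides of \<open>x\<close>
      at distance \<open>2 * D\<close>, or at the ends if these are nearer. This is far enough that
      the short sides towards \<open>v i\<close> and \<open>v j\<close>, of length at most
      \<open>D\<close>, cannot help to approximate \<open>x\<close>.\<close>
    obtain y where y: "y \<in> interval x (v 0)" "d x y = min (2 * D) (d x (v 0))"
      using d_mid[OF V(1,2), of "min (2 * D) (d x (v 0))"] by auto
    obtain z where z: "z \<in> interval x (v N)" "d x z = min (2 * D) (d x (v N))"
      using d_mid[OF V(1,3), of "min (2 * D) (d x (v N))"] by auto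
    have yzV: "y \<in> V" "z \<in> V" using y z by (auto simp: interval_def)
    have xx: "d (v 0) x + d x (v N) = d (v 0) (v N)" using x by (simp add: interval_def)
    have syms: "d (v 0) y = d y (v 0)" "d (v 0) x = d x (v 0)" "d y x = d x y" "d (v N) z = d z (v N)"
      using d_sym V yzV by auto
    have t: "d (v 0) (v N) \<le> d (v 0) y + d y (v N)" "d y (v N) \<le> d y x + d x (v N)" "d y (v N) \<le> d y z + d z (v N)"
      "d (v 0) (v N) \<le> d (v 0) z + d z (v N)" "d (v 0) z \<le> d (v 0) x + d x z" "d y z \<le> d y x + d x z"
      using d_triangle V yzV by auto
    have yd: "d x y + d y (v 0) = d x (v 0)" and zd: "d x z + d z (v N) = d x (v N)" using y z by (auto simp: interval_def)
    have yI: "y \<in> interval (v 0) (v N)" and zI: "z \<in> interval (v 0) (v N)" and xI: "x \<in> interval y z"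
      using t yd zd xx syms yzV V by (auto simp: interval_def)
    obtain i where i: "i \<le> N" "d y (v i) = height ?S y" using height_attained[OF S(2), of y] by auto
    obtain j where j: "j \<le> N" "d z (v j) = height ?S z" using height_attained[OF S(2), of z] by auto
    have dyi: "d y (v i) \<le> D" and dzj: "d z (v j) \<le> D" using x(2)[OF yI] x(2)[OF zI] i j by (auto simp: D_def)
    have key: "D \<le> 2 * \<delta> + \<delta> * m + B" if m: "K * (6 * D) + L \<le> 2 ^ m" for m
    proof -
      have vij: "v i \<in> V" "v j \<in> V" using vV i j by auto
      \<comment> \<open>If \<open>u\<close> is at distance \<open>2 * D\<close>, the triangle
        inequality leaves at least \<open>D\<close> between \<open>x\<close> and \<open>q\<close>.
        Otherwise \<open>u\<close> is an end point of the quasi-geodesic, its short side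
        degenerates, and \<open>q\<close> is a sample.\<close>
      have side: "D \<le> 2 * \<delta>"
        if u: "u \<in> V" "d x u = min (2 * D) (d x (v e))" "d x u + d u (v e) = d x (v e)" "e \<le> N"
          and k: "k \<le> N" "d u (v k) = height ?S u" "d u (v k) \<le> D"
          and q: "q \<in> V" "d x q \<le> 2 * \<delta>" "d u q + d q (v k) = d u (v k)" for u e k q
      proof (cases "d x u = 2 * D")
        case True
        have "d x u \<le> d x q + d q u" by (rule d_triangle[OF V(1) q(1) u(1)])
        moreover have "d q u = d u q" by (rule d_sym[OF q(1) u(1)])
        ultimately show ?thesis using True q k by linarith
      next
        case False
        then have "d u (v e) = 0" using u by (auto simp: min_def split: if_splits)
        then have ue: "u = v e" using d_eq_0 u vV by simp
        then have "d u (v k) = 0" using k(2) u(4) height_le[of u ?S u] by auto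
        then have "d u q = 0" using q by simp
        then have "q = u" using d_eq_0 u q by simp
        then show ?thesis using D_le[OF u(4)] q ue by simp
      qed
      obtain q where q: "q \<in> interval z (v j) \<union> interval (v j) y" "d x q \<le> \<delta>"
        using slim yzV vij xI unfolding slim_intervals_def by blast
      show ?thesis
      proof (cases "q \<in> interval z (v j)")
        case True
        then show ?thesis
          using side[of z N j q] yzV z zd j dzj q by (auto simp: interval_def)
      next
        case False
        then have "q \<in> interval (v j) y" using q by simp
        then obtain q' where q': "q' \<in> interval y (v i) \<union> interval (v i) (v j)" "d q q' \<le> \<delta>"
          using slim yzV vij unfolding slim_intervals_def by blast
        have qV: "q \<in> V" "q' \<in> V" using q q' by (auto simp: interval_def)
        have dxq': "d x q' \<le> 2 * \<delta>" using d_triangle[OF V(1) qV] q q' by simp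
        show ?thesis
        proof (cases "q' \<in> interval y (v i)")
          case True
          then show ?thesis
            using side[of y 0 i q'] yzV y yd i dyi dxq' qV by (auto simp: interval_def)
        next
          case False
          then have q'ij: "q' \<in> interval (v i) (v j)" using q' by simp
          have s: "d (v i) y = d y (v i)" using d_sym yzV vij by simp
          \<comment> \<open>\<open>6 * D\<close> is \<open>D + 4 * D + D\<close>, along
            \<open>v i\<close>, \<open>y\<close>, \<open>z\<close>, \<open>v j\<close>.\<close>
          have dij: "d (v i) (v j) \<le> 6 * D"
            using d_triangle[OF vij(1) yzV(1) vij(2)] d_triangle[OF yzV vij(2)] t(6) y(2) z(2) syms s dyi dzj
            by linarith
          have bound: "j' - i' \<le> 2 ^ m" if "i' \<le> j'" "j' \<le> N" "d (v i') (v j') \<le> 6 * D" for i' j'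
          proof -
            have "j' - i' \<le> K * d (v i') (v j') + L" using dqgD(3)[OF v that(1,2)] .
            also have "\<dots> \<le> K * (6 * D) + L" using that(3) by (intro add_right_mono mult_le_mono2)
            finally show ?thesis using m by linarith
          qed
          have close: "\<exists>l\<le>N. d p (v l) \<le> \<delta> * m + B"
            if "i \<le> j" "j \<le> N" "j - i \<le> 2 ^ m" "p \<in> interval (v i) (v j)" for i j p
            using coarse_path_close[OF slim, of N v B i j m p] vV step that by blast
          obtain l where l: "l \<le> N" "d q' (v l) \<le> \<delta> * m + B"
          proof (cases "i \<le> j")
            case True
            then show ?thesis
              using close[OF True j(1) bound[OF True j(1) dij] q'ij] that by blast
          next
            case False
            then have ji: "j \<le> i" by simp
            have "q' \<in> interval (v j) (v i)" "d (v j) (v i) \<le> 6 * D" using q'ij interval_sym vij dij d_sym by auto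
            then show ?thesis
              using close[OF ji i(1) bound[OF ji i(1)]] that by blast
          qed
          then show ?thesis
            using d_triangle[OF V(1) qV(2) vV[OF l(1)]] D_le[OF l(1)] dxq' by linarith
        qed
      qed
    qed
    have "D \<le> 2 * \<delta> + \<delta> * m1 + B"
    proof (rule ccontr)
      assume no: "\<not> ?thesis"
      \<comment> \<open>For the least exponent that accommodates \<open>D\<close>, its predecessor
        would already satisfy the hypothesis of \<open>key\<close> if it were at least
        \<open>m1\<close>, contradicting minimality. Positivity of \<delta> ensures that such an
        exponent exists.\<close>
      define m where "m = (LEAST m. D \<le> 2 * \<delta> + \<delta> * m + B)"
      have "D \<le> \<delta> * D" using \<delta> by simp
      then have "D \<le> 2 * \<delta> + \<delta> * D + B" by linarith
      then have m: "D \<le> 2 * \<delta> + \<delta> * m + B" unfolding m_def by (rule LeastI)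
      have "m1 < m"
      proof (rule ccontr)
        assume "\<not> m1 < m"
        then have "\<delta> * m \<le> \<delta> * m1" by simp
        then show False using m no by linarith
      qed
      then obtain m' where m': "m = Suc m'" "m1 \<le> m'" by (cases m) auto
      have "\<not> D \<le> 2 * \<delta> + \<delta> * m' + B" 
        using not_less_Least[of m' "\<lambda>m. D \<le> 2 * \<delta> + \<delta> * m + B"] m'(1) unfolding m_def by simp
      moreover have "K * (6 * D) + L \<le> K * (6 * (2 * \<delta> + \<delta> * m + B)) + L" using m by (intro add_right_mono mult_le_mono2) simp
      moreover have "K * (6 * (2 * \<delta> + \<delta> * m + B)) + L = (K * (6 * (2 * \<delta> + \<delta> + B)) + L) + (K * 6 * \<delta>) * m'"
        by (simp add: m' algebra_simps)
      ultimately show False using key[of m'] m1[OF m'(2)] by linarith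
    qed
    then have "height ?S p \<le> 2 * \<delta> + \<delta> * m1 + B" using x(2)[OF p] by (simp add: D_def)
    then show ?thesis using height_attained[OF S(2), of p] by (metis atMost_iff imageE)
  qed
  then show ?thesis by blast
qed

text \<open>A discrete connectedness argument: somewhere along a geodesic the close samples pass
  from indices at most \<open>i\<close> to indices at least \<open>i\<close>. Two such samples are
  within \<open>2 * R + 1\<close>, so their indices, and with them \<open>i\<close>, are close
  together.\<close>

lemma quasi_geodesic_near_interval:
  assumes v: "discrete_qg K L N v"
    and near: "\<And>p. p \<in> interval (v 0) (v N) \<Longrightarrow> \<exists>l\<le>N. d p (v l) \<le> R" and i: "i \<le> N"
  shows "\<exists>p\<in>interval (v 0) (v N). d (v i) p \<le> K * (K * (2 * R + 1) + L) + L + R"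
proof -
  have vV: "v i \<in> V" if "i \<le> N" for i using dqgD(1)[OF v that] .
  let ?n = "d (v 0) (v N)"
  have V0: "v 0 \<in> V" "v N \<in> V" using vV by auto
  obtain f where f: "discrete_geodesic ?n f" "f 0 = v 0" "f ?n = v N" "\<And>k. k < ?n \<Longrightarrow> (f k, f (Suc k)) \<in> E"
    by (rule discrete_geodesic_ex[OF V0], rule that) blast+
  have fI: "f k \<in> interval (v 0) (v N)" if "k \<le> ?n" for k using geodesic_in_interval[OF f(1) that] f by simp
  have fV: "f k \<in> V" if "k \<le> ?n" for k using fI[OF that] by (simp add: interval_def)
  define P where "P k \<longleftrightarrow> k \<le> ?n \<and> (\<exists>l\<le>i. d (f k) (v l) \<le> R)" for k
  have "P 0" using f by (auto simp: P_def intro!: exI[of _ 0])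
  define k where "k = (GREATEST k. P k)"
  have k: "P k" unfolding k_def by (rule GreatestI_nat[of P 0 ?n]) (use \<open>P 0\<close> in \<open>auto simp: P_def\<close>)
  have k_max: "\<not> P (Suc k)"
    using Greatest_le_nat[of P "Suc k" ?n] unfolding k_def by (auto simp: P_def)
  obtain l where l: "l \<le> i" "d (f k) (v l) \<le> R" and kn: "k \<le> ?n" using k by (auto simp: P_def)
  have "\<exists>l'\<ge>i. l' \<le> N \<and> d (v l) (v l') \<le> 2 * R + 1"
  proof (cases "k = ?n")
    case True
    then have "d (v l) (v N) \<le> R" using l f d_sym[of "v l" "v N"] vV i by simp
    then show ?thesis using i by (intro exI[of _ N]) auto
  next
    case False
    then have Sk: "Suc k \<le> ?n" using kn by simp
    obtain l' where l': "l' \<le> N" "d (f (Suc k)) (v l') \<le> R" using near[OF fI[OF Sk]] by blast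
    then have "i \<le> l'" using k_max Sk unfolding P_def by (meson nat_le_linear)
    have V: "v l \<in> V" "f k \<in> V" "f (Suc k) \<in> V" "v l' \<in> V" using vV fV kn Sk l l' i by auto
    have "d (v l) (v l') \<le> d (v l) (f k) + d (f k) (v l')" "d (f k) (v l') \<le> d (f k) (f (Suc k)) + d (f (Suc k)) (v l')"
      "d (v l) (f k) = d (f k) (v l)"
      by (rule d_triangle[OF V(1,2,4)] d_triangle[OF V(2,3,4)] d_sym[OF V(1,2)])+
    moreover have "d (f k) (f (Suc k)) \<le> 1" using f(4)[of k] Sk d_edge by simp
    ultimately show ?thesis using \<open>i \<le> l'\<close> l l' by (intro exI[of _ l']) linarith
  qed
  then obtain l' where l': "i \<le> l'" "l' \<le> N" "d (v l) (v l') \<le> 2 * R + 1" by blast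
  have "i - l \<le> l' - l" using l' by simp
  also have "\<dots> \<le> K * d (v l) (v l') + L" using dqgD(3)[OF v, of l l'] l l' by simp
  also have "\<dots> \<le> K * (2 * R + 1) + L" using l' by (intro add_right_mono mult_le_mono2)
  finally have "K * (i - l) \<le> K * (K * (2 * R + 1) + L)" by (rule mult_le_mono2)
  then have "d (v l) (v i) \<le> K * (K * (2 * R + 1) + L) + L"
    using dqgD(2)[OF v l(1) i] by linarith
  moreover have V: "v i \<in> V" "v l \<in> V" "f k \<in> V" using vV fV l i kn by auto
  have "d (v i) (f k) \<le> d (v i) (v l) + d (v l) (f k)" "d (v i) (v l) = d (v l) (v i)" "d (v l) (f k) = d (f k) (v l)"
    by (rule d_triangle[OF V] d_sym[OF V(1,2)] d_sym[OF V(2,3)])+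
  ultimately show ?thesis using l by (intro bexI[of _ "f k"] fI kn) linarith
qed

lemma slim_intervals_imp_thin_bigons:
  assumes "slim_intervals \<delta>"
  shows thin_bigons
  unfolding thin_bigons_def
proof (intro allI)
  fix K L
  \<comment> \<open>The Morse bound requires a positive slimness constant.\<close>
  have "slim_intervals (Suc \<delta>)" using slim_intervals_mono[OF assms] by simp
  then obtain R where "\<forall>N v. discrete_qg K L N v \<longrightarrow> (\<forall>p\<in>interval (v 0) (v N). \<exists>l\<le>N. d p (v l) \<le> R)"
    using interval_near_quasi_geodesic[of "Suc \<delta>" K L] by blast
  then have R: "\<exists>l\<le>N. d p (v l) \<le> R" if "discrete_qg K L N v" "p \<in> interval (v 0) (v N)" for N v p
    using that by blast
  have "\<exists>j\<le>N'. d (v i) (v' j) \<le> K * (K * (2 * R + 1) + L) + L + R + R"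
    if v: "discrete_qg K L N v" "discrete_qg K L N' v'" "v 0 = v' 0" "v N = v' N'" "i \<le> N" for N v N' v' i
  proof -
    obtain p where p: "p \<in> interval (v 0) (v N)" "d (v i) p \<le> K * (K * (2 * R + 1) + L) + L + R"
      using quasi_geodesic_near_interval[OF v(1) R[OF v(1)] v(5)] by blast
    obtain j where j: "j \<le> N'" "d p (v' j) \<le> R" using R[OF v(2), of p] p v by auto
    have "d (v i) (v' j) \<le> d (v i) p + d p (v' j)"
      using p dqgD(1)[OF v(1,5)] dqgD(1)[OF v(2) j(1)] by (intro d_triangle) (auto simp: interval_def)
    then show ?thesis using p j by (intro exI[of _ j]) linarith
  qed
  then show "\<exists>R. \<forall>N v N' v'. discrete_qg K L N v \<and> discrete_qg K L N' v' \<and> v 0 = v' 0 \<and> v N = v' N' \<longrightarrow>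
     (\<forall>i\<le>N. \<exists>j\<le>N'. d (v i) (v' j) \<le> R)" by blast
qed

end

section \<open>Curves in the realisation of a graph\<close>

context vgraph
begin

definition realisation :: "('a \<Rightarrow> real) metric" where
  "realisation = metric (graph_points V E, graph_dist V E)"

lemma Metric_space_realisation: "Metric_space (graph_points V E) (graph_dist V E)"
  by (rule Metric_space_graph[OF E_sub E_conn])

lemma mspace_realisation [simp]: "mspace realisation = graph_points V E"
  and mdist_realisation: "mdist realisation = graph_dist V E"
  using Metric_space_realisation by (simp_all add: realisation_def Metric_space.mspace_metric Metric_space.mdist_metric)

lemma edgeD: "(u, v) \<in> E \<Longrightarrow> u \<in> V \<and> v \<in> V \<and> u \<noteq> v"
  using E_sub E_irrefl by auto

lemma vertex_in [simp]: "v \<in> V \<Longrightarrow> vertex v \<in> graph_points V E"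
  by (simp add: graph_points_def)

lemma edge_point_in: "\<lbrakk>(u, v) \<in> E; t \<in> {0..1}\<rbrakk> \<Longrightarrow> edge_point u v t \<in> graph_points V E"
  by (auto simp: graph_points_def)

lemma vertex_eq [simp]: "vertex u = vertex v \<longleftrightarrow> u = v"
  by (metis indicator_eq_1_iff singletonD singletonI)

lemma edge_point_swap: "edge_point u v t = edge_point v u (1 - t)"
  by (simp add: edge_point_def add.commute)

lemma graph_pointsE:
  assumes "p \<in> graph_points V E"
  obtains v where "v \<in> V" "p = vertex v" | u v t where "(u, v) \<in> E" "0 < t" "t < 1" "p = edge_point u v t"
proof -
  consider v where "v \<in> V" "p = vertex v" | u v t where "(u, v) \<in> E" "0 \<le> t" "t \<le> 1" "p = edge_point u v t"
    using assms unfolding graph_points_def by blast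
  then show thesis
  proof cases
    case 2
    then consider "t = 0" | "t = 1" | "0 < t" "t < 1" by linarith
    then show thesis
    proof cases
      case 1
      then show thesis using 2 that(1)[of u] edgeD by simp
    next
      case 2
      then show thesis using \<open>(u, v) \<in> E\<close> \<open>p = edge_point u v t\<close> that(1)[of v] edgeD by simp
    next
      case 3
      then show thesis using 2 that(2) by blast
    qed
  qed (rule that)
qed

lemma mdist_le: "pl_path V E p q l \<Longrightarrow> mdist realisation p q \<le> l"
proof -
  assume l: "pl_path V E p q l"
  have "0 \<le> l'" if "pl_path V E p q l'" for l'
    using pl_path_coord_le[OF that] by (meson abs_ge_zero order.trans)
  then have "bdd_below {l. pl_path V E p q l}" by (intro bdd_belowI[where m=0]) auto
  then show ?thesis using l pl_path_points[OF l] by (auto simp: mdist_realisation graph_dist_def intro!: cInf_lower)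
qed

lemma mdist_ge:
  assumes "p \<in> graph_points V E" "q \<in> graph_points V E" "\<And>l. pl_path V E p q l \<Longrightarrow> x \<le> l"
  shows "x \<le> mdist realisation p q"
proof -
  obtain u l v l' where "u \<in> V" "pl_path V E p (vertex u) l" "v \<in> V" "pl_path V E q (vertex v) l'"
    using pl_path_to_vertex[OF _ E_sub] assms by meson
  then have "\<exists>l. pl_path V E p q l"
    using pl_path_vertices[OF E_conn, of u v] by (meson pl_path_trans pl_path_sym)
  then show ?thesis using assms by (auto simp: mdist_realisation graph_dist_def intro!: cInf_greatest)
qed

lemma mdist_edge:
  assumes "(u, v) \<in> E" "s \<in> {0..1}" "t \<in> {0..1}"
  shows "mdist realisation (edge_point u v s) (edge_point u v t) = \<bar>s - t\<bar>"
proof (rule antisym)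
  show "mdist realisation (edge_point u v s) (edge_point u v t) \<le> \<bar>s - t\<bar>"
    using assms by (intro mdist_le pl_path_edge)
  have "edge_point u v s v = s" "edge_point u v t v = t"
    using edgeD[OF assms(1)] by (auto simp: edge_point_def)
  then show "\<bar>s - t\<bar> \<le> mdist realisation (edge_point u v s) (edge_point u v t)"
    using assms edge_point_in pl_path_coord_le[of V E _ _ _ v] by (intro mdist_ge) metis+
qed

text \<open>Extending a 1-Lipschitz function on the vertices affinely over the edges gives lower bounds for
  distances in the realisation.\<close>
definition affine_extension :: "('a \<Rightarrow> real) \<Rightarrow> ('a \<Rightarrow> real) \<Rightarrow> real" where
  "affine_extension \<phi> p = (\<Sum>w | p w \<noteq> 0. p w * \<phi> w)"

lemma affine_extension_edge_point:
  assumes "u \<noteq> v"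
  shows "affine_extension \<phi> (edge_point u v t) = (1 - t) * \<phi> u + t * \<phi> v"
proof -
  have "affine_extension \<phi> (edge_point u v t) = (\<Sum>w\<in>{u, v}. edge_point u v t w * \<phi> w)"
    unfolding affine_extension_def by (rule sum.mono_neutral_left) (auto simp: edge_point_def split: split_indicator_asm)
  then show ?thesis using assms by (simp add: edge_point_def)
qed

lemma affine_extension_vertex [simp]: "affine_extension \<phi> (vertex v) = \<phi> v"
proof -
  have "affine_extension \<phi> (vertex v) = (\<Sum>w\<in>{v}. vertex v w * \<phi> w)"
    unfolding affine_extension_def by (rule sum.mono_neutral_left) (auto split: split_indicator_asm)
  then show ?thesis by simp
qed

lemma affine_extension_Lipschitz:
  assumes \<phi>: "\<And>u v. (u, v) \<in> E \<Longrightarrow> \<bar>\<phi> u - \<phi> v\<bar> \<le> 1"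
    and pq: "p \<in> graph_points V E" "q \<in> graph_points V E"
  shows "\<bar>affine_extension \<phi> p - affine_extension \<phi> q\<bar> \<le> mdist realisation p q"
proof (rule mdist_ge[OF pq])
  fix l assume "pl_path V E p q l"
  then show "\<bar>affine_extension \<phi> p - affine_extension \<phi> q\<bar> \<le> l"
  proof induction
    case (step p u v s l t)
    have eq: "affine_extension \<phi> (edge_point u v s) - affine_extension \<phi> (edge_point u v t) = (t - s) * (\<phi> u - \<phi> v)"
      using edgeD[OF step.hyps(2)] by (simp add: affine_extension_edge_point algebra_simps)
    have "\<bar>affine_extension \<phi> (edge_point u v s) - affine_extension \<phi> (edge_point u v t)\<bar> \<le> \<bar>t - s\<bar> * 1"
      unfolding eq abs_mult using \<phi>[OF step.hyps(2)] by (intro mult_left_mono) auto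
    then show ?case using step.IH by (smt (verit))
  qed simp
qed

lemma pl_path_relpow: "\<lbrakk>(u, v) \<in> E ^^ n; u \<in> V\<rbrakk> \<Longrightarrow> pl_path V E (vertex u) (vertex v) (real n)"
proof (induction n arbitrary: v)
  case 0
  then show ?case by (auto intro: pl_path.const)
next
  case (Suc n)
  then obtain w where w: "(u, w) \<in> E ^^ n" "(w, v) \<in> E" by auto
  have "pl_path V E (vertex w) (vertex v) \<bar>0 - 1\<bar>"
    using pl_path_edge[of w v E 0 1 V] w by simp
  from pl_path_trans[OF this Suc.IH[OF w(1) Suc.prems(2)]] show ?case by (simp add: add.commute)
qed

lemma mdist_vertex:
  assumes "u \<in> V" "v \<in> V"
  shows "mdist realisation (vertex u) (vertex v) = real (d u v)"
proof (rule antisym)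
  show "mdist realisation (vertex u) (vertex v) \<le> real (d u v)"
    using assms by (intro mdist_le pl_path_relpow d_relpow)
  have "\<bar>real (d u x) - real (d u y)\<bar> \<le> 1" if "(x, y) \<in> E" for x y
    using d_triangle[of u x y] d_triangle[of u y x] d_edge[OF that] d_sym[of x y] edgeD[OF that] assms by auto
  then have "\<bar>affine_extension (\<lambda>w. real (d u w)) (vertex u) - affine_extension (\<lambda>w. real (d u w)) (vertex v)\<bar> \<le> mdist realisation (vertex u) (vertex v)"
    using assms by (intro affine_extension_Lipschitz) auto
  then show "real (d u v) \<le> mdist realisation (vertex u) (vertex v)" by simp
qed

text \<open>The support of the barycentric coordinates recovers the edge of an interior point up to
  orientation.\<close>

lemma edge_point_cases:
  assumes "(u, v) \<in> E" "(u', v') \<in> E" "s \<in> {0..1}" "s' \<in> {0..1}"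
    and eq: "edge_point u v s = edge_point u' v' s'"
  shows "edge_point u v s = vertex u \<or> edge_point u v s = vertex v \<or> (u = u' \<and> v = v') \<or> (u = v' \<and> v = u')"
proof (cases "s = 0 \<or> s = 1")
  case False
  have ne: "u \<noteq> v" "u' \<noteq> v'" using edgeD assms(1,2) by auto
  have "edge_point u v s w \<noteq> 0 \<longleftrightarrow> w = u \<or> w = v" for w
    using False ne by (auto simp: edge_point_def indicator_def)
  moreover have "edge_point u' v' s' w \<noteq> 0 \<Longrightarrow> w = u' \<or> w = v'" for w
    by (auto simp: edge_point_def indicator_def split: if_splits)
  ultimately show ?thesis using eq ne by metis
qed auto

text \<open>A path starting on the edge either is still on it or has passed through one of its ends.
  In the second case its length is at least \<open>m q\<close>, the cheaper of the two routes; this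
  alternative is the induction invariant.\<close>

lemma via_endpoint:
  assumes uv: "(u, v) \<in> E" "s \<in> {0..1}" and q: "q \<in> graph_points V E"
    and off: "\<And>t. t \<in> {0..1} \<Longrightarrow> q \<noteq> edge_point u v t"
  shows "\<exists>a\<in>{u, v}. mdist realisation (edge_point u v s) q = mdist realisation (edge_point u v s) (vertex a) + mdist realisation (vertex a) q"
proof -
  let ?p = "edge_point u v s"
  define m where "m q = min (mdist realisation ?p (vertex u) + mdist realisation (vertex u) q) (mdist realisation ?p (vertex v) + mdist realisation (vertex v) q)" for q
  have uvV: "u \<in> V" "v \<in> V" using edgeD uv by auto
  have pin: "?p \<in> graph_points V E" using edge_point_in uv by auto
  have "(\<exists>t\<in>{0..1}. q = edge_point u v t) \<or> m q \<le> l" if "pl_path V E p q l" "p = ?p" for p q l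
    using that
  proof induction
    case (const p)
    then show ?case using uv by auto
  next
    case (step p u' v' s' l t)
    let ?q = "edge_point u' v' s'" and ?r = "edge_point u' v' t"
    have in': "?q \<in> graph_points V E" "?r \<in> graph_points V E" using edge_point_in step.hyps by auto
    have qr: "mdist realisation ?q ?r = \<bar>s' - t\<bar>" using mdist_edge step.hyps by simp
    have tri: "mdist realisation (vertex a) ?r \<le> mdist realisation (vertex a) ?q + \<bar>s' - t\<bar>" if "a \<in> V" for a
      using mdist_triangle[of "vertex a" realisation ?q ?r] in' that qr by simp
    have pq: "mdist realisation ?p ?q \<le> l" using mdist_le step by blast
    from step.IH[OF step.prems] show ?case
    proof
      assume "m ?q \<le> l"
      then show ?thesis using tri[of u] tri[of v] uvV unfolding m_def by linarith
    next
      assume "\<exists>t\<in>{0..1}. ?q = edge_point u v t"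
      then obtain \<tau> where \<tau>: "\<tau> \<in> {0..1}" "?q = edge_point u v \<tau>" by blast
      have "?q = vertex u \<or> ?q = vertex v \<or> (u = u' \<and> v = v') \<or> (u = v' \<and> v = u')"
        using edge_point_cases[OF uv(1) step.hyps(2) \<tau>(1) step.hyps(3)] \<tau>(2) by auto
      then consider "?q = vertex u" | "?q = vertex v" | "u = u'" "v = v'" | "u = v'" "v = u'" by blast
      then show ?thesis
      proof cases
        case 1
        then have "mdist realisation ?p (vertex u) \<le> l" "mdist realisation (vertex u) ?r \<le> \<bar>s' - t\<bar>"
          using pq qr by auto
        then show ?thesis unfolding m_def by linarith
      next
        case 2
        then have "mdist realisation ?p (vertex v) \<le> l" "mdist realisation (vertex v) ?r \<le> \<bar>s' - t\<bar>"
          using pq qr by auto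
        then show ?thesis unfolding m_def by linarith
      next
        case 3
        then show ?thesis using step.hyps by blast
      next
        case 4
        then show ?thesis using step.hyps edge_point_swap[of u' v' t] by (intro disjI1 bexI[of _ "1 - t"]) auto
      qed
    qed
  qed
  then have "m q \<le> mdist realisation ?p q" using off by (intro mdist_ge[OF pin q]) blast
  moreover have "mdist realisation ?p q \<le> mdist realisation ?p (vertex a) + mdist realisation (vertex a) q" if "a \<in> V" for a
    using mdist_triangle[of ?p realisation "vertex a" q] pin q that by simp
  ultimately show ?thesis using uvV unfolding m_def by (smt (verit) insertI1 insertI2)
qed

text \<open>The infimum is attained: distances split at end points of edges, and between vertices or
  along a single edge explicit shortest paths are known. Exact geodesics, not only almost shortest
  paths, depend on this.\<close>

lemma pl_path_mdist:
  assumes p: "p \<in> graph_points V E" and q: "q \<in> graph_points V E"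
  shows "pl_path V E p q (mdist realisation p q)"
proof -
  have join: "pl_path V E p r (mdist realisation p r)" if "pl_path V E p q (mdist realisation p q)" "pl_path V E q r (mdist realisation q r)"
      "mdist realisation p r = mdist realisation p q + mdist realisation q r" for p q r
    using pl_path_trans[OF that(2,1)] that(3) by simp
  have edge: "pl_path V E (edge_point u v s) (edge_point u v t) (mdist realisation (edge_point u v s) (edge_point u v t))"
    if "(u, v) \<in> E" "s \<in> {0..1}" "t \<in> {0..1}" for u v s t
    using pl_path_edge[OF that] mdist_edge[OF that] by simp
  have to_end: "pl_path V E (edge_point u v s) (vertex a) (mdist realisation (edge_point u v s) (vertex a))"
    if "(u, v) \<in> E" "s \<in> {0..1}" "a \<in> {u, v}" for u v s a
    using edge[OF that(1,2), of 0] edge[OF that(1,2), of 1] that(3) by auto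
  have vertices: "pl_path V E (vertex u) (vertex v) (mdist realisation (vertex u) (vertex v))" if "u \<in> V" "v \<in> V" for u v
    using pl_path_relpow[OF d_relpow[OF that] that(1)] mdist_vertex[OF that] by simp
  have to_vertex: "pl_path V E p (vertex w) (mdist realisation p (vertex w))" if p: "p \<in> graph_points V E" and w: "w \<in> V" for p w
    using p
  proof (cases rule: graph_pointsE)
    case (1 v)
    then show ?thesis using vertices w by simp
  next
    case (2 u v t)
    show ?thesis
    proof (cases "\<exists>t\<in>{0..1}. vertex w = edge_point u v t")
      case True
      then show ?thesis using edge 2 by auto
    next
      case False
      then obtain a where a: "a \<in> {u, v}" "mdist realisation p (vertex w) = mdist realisation p (vertex a) + mdist realisation (vertex a) (vertex w)"
        using via_endpoint[OF 2(1), of t "vertex w"] 2 w by auto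
      then have "a \<in> V" using edgeD 2 by auto
      show ?thesis using join[OF to_end[OF 2(1) _ a(1)] vertices[OF \<open>a \<in> V\<close> w]] a(2) 2 by auto
    qed
  qed
  from p show ?thesis
  proof (cases rule: graph_pointsE)
    case (1 v)
    then show ?thesis using pl_path_sym[OF to_vertex[OF q 1(1)]] mdist_commute by metis
  next
    case (2 u v t)
    show ?thesis
    proof (cases "\<exists>t\<in>{0..1}. q = edge_point u v t")
      case True
      then show ?thesis using edge 2 by auto
    next
      case False
      then obtain a where a: "a \<in> {u, v}" "mdist realisation p q = mdist realisation p (vertex a) + mdist realisation (vertex a) q"
        using via_endpoint[OF 2(1), of t q] 2 q by auto
      then have "a \<in> V" using edgeD 2 by auto
      have "pl_path V E (vertex a) q (mdist realisation (vertex a) q)"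
        using pl_path_sym[OF to_vertex[OF q \<open>a \<in> V\<close>]] mdist_commute by metis
      then show ?thesis using join[OF to_end[OF 2(1) _ a(1)]] a(2) 2 by auto
    qed
  qed
qed

lemma mdist_self [simp]: "p \<in> graph_points V E \<Longrightarrow> mdist realisation p p = 0"
  using mdist_zero[of p realisation p] by (simp del: mdist_zero)

lemma nearest_vertex_ex:
  assumes "p \<in> graph_points V E"
  shows "\<exists>v. v \<in> V \<and> mdist realisation p (vertex v) \<le> 1 \<and> (p \<in> vertex ` V \<longrightarrow> p = vertex v)"
  using assms
proof (cases rule: graph_pointsE)
  case (1 v)
  then show ?thesis by (intro exI[of _ v]) simp
next
  case (2 u v t)
  show ?thesis
  proof (cases "p \<in> vertex ` V")
    case True
    then obtain w where "w \<in> V" "p = vertex w" by blast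
    then show ?thesis by (intro exI[of _ w]) simp
  next
    case False
    have "mdist realisation p (vertex u) = t" using mdist_edge[OF 2(1), of t 0] 2 by simp
    then show ?thesis using 2(2,3) edgeD[OF 2(1)] False by (intro exI[of _ u]) simp
  qed
qed

text \<open>The last clause makes sampled quasi-geodesics start and end at the given vertices.\<close>
definition nearest_vertex :: "('a \<Rightarrow> real) \<Rightarrow> 'a" where
  "nearest_vertex p = (SOME v. v \<in> V \<and> mdist realisation p (vertex v) \<le> 1 \<and> (p \<in> vertex ` V \<longrightarrow> p = vertex v))"

lemma nearest_vertex:
  assumes "p \<in> graph_points V E"
  shows "nearest_vertex p \<in> V" "mdist realisation p (vertex (nearest_vertex p)) \<le> 1" "p \<in> vertex ` V \<Longrightarrow> vertex (nearest_vertex p) = p"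
  using someI_ex[OF nearest_vertex_ex[OF assms]] unfolding nearest_vertex_def by auto

lemma nearest_vertex_vertex [simp]: "v \<in> V \<Longrightarrow> nearest_vertex (vertex v) = v"
  using nearest_vertex(3)[of "vertex v"] by simp

lemma d_nearest_vertex:
  assumes "p \<in> graph_points V E" "q \<in> graph_points V E"
  shows "real (d (nearest_vertex p) (nearest_vertex q)) \<le> mdist realisation p q + 2" "mdist realisation p q \<le> real (d (nearest_vertex p) (nearest_vertex q)) + 2"
proof -
  let ?p = "vertex (nearest_vertex p)" and ?q = "vertex (nearest_vertex q)"
  have in': "?p \<in> mspace realisation" "?q \<in> mspace realisation" using nearest_vertex(1) assms by auto
  have "mdist realisation ?p ?q \<le> mdist realisation ?p p + mdist realisation p ?q" "mdist realisation p ?q \<le> mdist realisation p q + mdist realisation q ?q"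
    "mdist realisation p q \<le> mdist realisation p ?p + mdist realisation ?p q" "mdist realisation ?p q \<le> mdist realisation ?p ?q + mdist realisation ?q q"
    using in' assms by (auto intro!: mdist_triangle)
  then show "real (d (nearest_vertex p) (nearest_vertex q)) \<le> mdist realisation p q + 2" "mdist realisation p q \<le> real (d (nearest_vertex p) (nearest_vertex q)) + 2"
    using nearest_vertex(2)[OF assms(1)] nearest_vertex(2)[OF assms(2)] mdist_vertex[OF nearest_vertex(1) nearest_vertex(1), OF assms]
    by (auto simp: mdist_commute)
qed

text \<open>Curves of length at most \<open>l\<close>, with a parametrisation that need not be by
  arc length. They serve both as geodesics, when \<open>l\<close> is the distance of the ends, and
  as upper bounds for induced length distances; \<open>Y\<close> records the region they stay
  in.\<close>

definition lip_curve :: "('a \<Rightarrow> real) set \<Rightarrow> (real \<Rightarrow> 'a \<Rightarrow> real) \<Rightarrow> real \<Rightarrow> bool" where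
  "lip_curve Y c l \<longleftrightarrow> 0 \<le> l \<and> c ` {0..l} \<subseteq> Y \<and>
     (\<forall>s\<in>{0..l}. \<forall>t\<in>{0..l}. s \<le> t \<longrightarrow> mdist realisation (c s) (c t) \<le> t - s)"

lemma lip_curveD: "\<lbrakk>lip_curve Y c l; 0 \<le> s; s \<le> t; t \<le> l\<rbrakk> \<Longrightarrow> mdist realisation (c s) (c t) \<le> t - s"
  unfolding lip_curve_def by simp

definition lip_joined :: "('a \<Rightarrow> real) set \<Rightarrow> ('a \<Rightarrow> real) \<Rightarrow> ('a \<Rightarrow> real) \<Rightarrow> real \<Rightarrow> bool" where
  "lip_joined Y p q l \<longleftrightarrow> (\<exists>c. c 0 = p \<and> c l = q \<and> lip_curve Y c l)"

lemma lip_joined_refl: "p \<in> Y \<Longrightarrow> p \<in> graph_points V E \<Longrightarrow> lip_joined Y p p 0"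
  unfolding lip_joined_def lip_curve_def by (intro exI[of _ "\<lambda>_. p"]) auto

text \<open>The passage through \<open>q\<close> is kept in the conclusion in order to build
  geodesics through a prescribed vertex.\<close>

lemma lip_curve_concat:
  assumes Y: "Y \<subseteq> graph_points V E" and "lip_joined Y p q l" "lip_joined Y q r l'"
  shows "\<exists>c. c 0 = p \<and> c l = q \<and> c (l + l') = r \<and> lip_curve Y c (l + l')"
proof -
  obtain c where c: "c 0 = p" "c l = q" "lip_curve Y c l" using assms(2) unfolding lip_joined_def by blast
  obtain c' where c': "c' 0 = q" "c' l' = r" "lip_curve Y c' l'" using assms(3) unfolding lip_joined_def by blast
  define e where "e x = (if x \<le> l then c x else c' (x - l))" for x
  have l: "0 \<le> l" "0 \<le> l'" using c c' unfolding lip_curve_def by auto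
  have cY: "c x \<in> Y" if "0 \<le> x" "x \<le> l" for x using c(3) that unfolding lip_curve_def by auto
  have cY': "c' x \<in> Y" if "0 \<le> x" "x \<le> l'" for x using c'(3) that unfolding lip_curve_def by auto
  have "mdist realisation (e s) (e t) \<le> t - s" if st: "0 \<le> s" "s \<le> t" "t \<le> l + l'" for s t
  proof -
    consider "t \<le> l" | "l < s" | "s \<le> l" "l < t" using st by linarith
    then show ?thesis
    proof cases
      case 1
      then show ?thesis using c(3) st unfolding lip_curve_def e_def by simp
    next
      case 2
      have "mdist realisation (c' (s - l)) (c' (t - l)) \<le> (t - l) - (s - l)"
        using st 2 by (intro lip_curveD[OF c'(3)]) auto
      then show ?thesis using 2 st unfolding e_def by simp
    next
      case 3
      have "mdist realisation (c s) (c l) \<le> l - s" using st 3 by (intro lip_curveD[OF c(3)]) auto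
      moreover have "mdist realisation (c' 0) (c' (t - l)) \<le> t - l - 0"
        using st 3 by (intro lip_curveD[OF c'(3)]) auto
      moreover have "mdist realisation (c s) (c' (t - l)) \<le> mdist realisation (c s) (c l) + mdist realisation (c l) (c' (t - l))"
        using cY[of s] cY[of l] cY'[of "t - l"] st 3 l Y by (intro mdist_triangle) auto
      ultimately show ?thesis using 3 c c' unfolding e_def by simp
    qed
  qed
  moreover have "e ` {0..l + l'} \<subseteq> Y" unfolding e_def using cY cY' by auto
  moreover have "e 0 = p" "e l = q" "e (l + l') = r" unfolding e_def using c c' l by auto
  ultimately show ?thesis unfolding lip_curve_def using l by (intro exI[of _ e]) auto
qed

lemma lip_joined_trans:
  assumes "Y \<subseteq> graph_points V E" "lip_joined Y p q l" "lip_joined Y q r l'"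
  shows "lip_joined Y p r (l + l')"
  using lip_curve_concat[OF assms] unfolding lip_joined_def by blast

lemma lip_joined_edge:
  assumes uv: "(u, v) \<in> E" "s \<in> {0..1}" "t \<in> {0..1}"
    and Y: "\<And>x. x \<in> {0..1} \<Longrightarrow> edge_point u v x \<in> Y"
  shows "lip_joined Y (edge_point u v s) (edge_point u v t) \<bar>s - t\<bar>"
proof -
  define h where "h x = (if s \<le> t then s + x else s - x)" for x
  have h: "h x \<in> {0..1}" if "0 \<le> x" "x \<le> \<bar>s - t\<bar>" for x using that uv by (auto simp: h_def)
  have "mdist realisation (edge_point u v (h x)) (edge_point u v (h y)) = y - x" if "0 \<le> x" "x \<le> y" "y \<le> \<bar>s - t\<bar>" for x y
    using mdist_edge[OF uv(1) h h, of x y] that by (auto simp: h_def)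
  moreover have "h 0 = s" "h \<bar>s - t\<bar> = t" by (auto simp: h_def)
  ultimately show ?thesis
    unfolding lip_joined_def lip_curve_def using h Y by (intro exI[of _ "\<lambda>x. edge_point u v (h x)"]) auto
qed

lemma lip_joined_pl_path: "pl_path V E p q l \<Longrightarrow> lip_joined (graph_points V E) p q l"
proof (induction rule: pl_path.induct)
  case (const p)
  then show ?case by (rule lip_joined_refl) fact
next
  case (step p u v s l t)
  then show ?case
    using lip_joined_trans[OF order.refl step.IH] lip_joined_edge[OF step.hyps(2-4)] edge_point_in by blast
qed

lemma lip_joined_relpow:
  assumes Y: "Y \<subseteq> graph_points V E" "vertex u \<in> Y"
    and edges: "\<And>a b x. \<lbrakk>(a, b) \<in> Restr E Z; x \<in> {0..1}\<rbrakk> \<Longrightarrow> edge_point a b x \<in> Y"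
  shows "(u, v) \<in> (Restr E Z) ^^ n \<Longrightarrow> lip_joined Y (vertex u) (vertex v) (real n)"
proof (induction n arbitrary: v)
  case 0
  then show ?case using Y by (auto intro!: lip_joined_refl)
next
  case (Suc n)
  then obtain w where w: "(u, w) \<in> (Restr E Z) ^^ n" "(w, v) \<in> Restr E Z" by auto
  have "lip_joined Y (edge_point w v 0) (edge_point w v 1) \<bar>0 - 1\<bar>"
    using w(2) edges[OF w(2)] by (intro lip_joined_edge) auto
  from lip_joined_trans[OF Y(1) Suc.IH[OF w(1)], of "vertex v" 1] this show ?case by (simp add: add.commute)
qed

text \<open>Any loss on a subinterval would make the distance of the ends smaller than
  \<open>l\<close>.\<close>

lemma lip_curve_isometric:
  assumes Y: "Y \<subseteq> graph_points V E" and c: "lip_curve Y c l" "l \<le> mdist realisation (c 0) (c l)"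
    and st: "0 \<le> s" "s \<le> t" "t \<le> l"
  shows "mdist realisation (c s) (c t) = t - s"
proof -
  have lip: "mdist realisation (c x) (c y) \<le> y - x" if "0 \<le> x" "x \<le> y" "y \<le> l" for x y
    using lip_curveD[OF c(1) that] .
  have in': "c x \<in> mspace realisation" if "0 \<le> x" "x \<le> l" for x
  proof -
    have "c x \<in> c ` {0..l}" using that by simp
    then show ?thesis using c(1) Y unfolding lip_curve_def by auto
  qed
  have "mdist realisation (c 0) (c l) \<le> mdist realisation (c 0) (c s) + mdist realisation (c s) (c l)"
    "mdist realisation (c s) (c l) \<le> mdist realisation (c s) (c t) + mdist realisation (c t) (c l)"
    using st by (auto intro!: mdist_triangle in')
  then show ?thesis using lip[of 0 s] lip[of s t] lip[of t l] c(2) st by linarith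
qed

lemma lip_curve_geodesic_segment:
  assumes Y: "Y \<subseteq> graph_points V E" and c: "lip_curve Y c l" "l = mdist realisation (c 0) (c l)"
  shows "geodesic_segment realisation (c 0) (c l) (c ` {0..l})" "c ` {0..l} \<subseteq> Y"
proof -
  show cY: "c ` {0..l} \<subseteq> Y" using c unfolding lip_curve_def by blast
  have l: "0 \<le> l" using c unfolding lip_curve_def by blast
  have iso: "mdist realisation (c s) (c t) = \<bar>s - t\<bar>" if "s \<in> {0..l}" "t \<in> {0..l}" for s t
  proof (cases "s \<le> t")
    case True
    then show ?thesis using lip_curve_isometric[OF Y c(1), of s t] c(2) that by auto
  next
    case False
    then show ?thesis
      using lip_curve_isometric[OF Y c(1), of t s] c(2) that mdist_commute[of realisation "c s" "c t"] by auto
  qed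
  then show "geodesic_segment realisation (c 0) (c l) (c ` {0..l})"
    unfolding geodesic_segment_def using l cY Y by (intro exI[of _ l] conjI exI[of _ c]) auto
qed

lemma geodesic_segment_of_lip_joined:
  assumes Y: "Y \<subseteq> graph_points V E" and j: "lip_joined Y p q (mdist realisation p q)"
  obtains \<gamma> where "geodesic_segment realisation p q \<gamma>" "\<gamma> \<subseteq> Y"
proof -
  obtain c where c: "c 0 = p" "c (mdist realisation p q) = q" "lip_curve Y c (mdist realisation p q)"
    using j unfolding lip_joined_def by blast
  show thesis using that lip_curve_geodesic_segment[OF Y c(3)] c(1,2) by metis
qed

lemma geodesic_space_realisation: "geodesic_space realisation"
  unfolding geodesic_space_def
  using geodesic_segment_of_lip_joined[OF order.refl lip_joined_pl_path[OF pl_path_mdist]] by (metis mspace_realisation)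

end

section \<open>Distance to a set, and sampling of quasi-geodesics\<close>

lemma dist_to_set_le: "a \<in> A \<Longrightarrow> dist_to_set m x A \<le> mdist m x a"
  unfolding dist_to_set_def by (rule cINF_lower) (auto intro!: bdd_belowI[of _ 0])

lemma dist_to_set_ge: "A \<noteq> {} \<Longrightarrow> (\<And>a. a \<in> A \<Longrightarrow> b \<le> mdist m x a) \<Longrightarrow> b \<le> dist_to_set m x A"
  unfolding dist_to_set_def by (rule cINF_greatest)

lemma dist_to_set_Lipschitz:
  assumes "A \<noteq> {}" "A \<subseteq> mspace m" "x \<in> mspace m" "y \<in> mspace m"
  shows "dist_to_set m x A \<le> mdist m x y + dist_to_set m y A"
proof -
  have "dist_to_set m x A - mdist m x y \<le> mdist m y a" if "a \<in> A" for a
    using dist_to_set_le[OF that, of m x] mdist_triangle[of x m y a] assms that by fastforce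
  then show ?thesis using dist_to_set_ge[OF assms(1), of "dist_to_set m x A - mdist m x y" m y] by simp
qed

context vgraph
begin

lemma dist_to_set_vertex:
  assumes A: "A \<subseteq> V" "A \<noteq> {}" and v: "v \<in> V"
  shows "dist_to_set realisation (vertex v) (vertex ` A) = real (height A v)"
proof (rule antisym)
  obtain a where a: "a \<in> A" "d v a = height A v" using height_attained A by metis
  then show "dist_to_set realisation (vertex v) (vertex ` A) \<le> real (height A v)"
    using dist_to_set_le[of "vertex a" "vertex ` A" realisation "vertex v"] mdist_vertex[of v a] A v by auto
  show "real (height A v) \<le> dist_to_set realisation (vertex v) (vertex ` A)"
  proof (rule dist_to_set_ge)
    fix b assume "b \<in> vertex ` A"
    then show "real (height A v) \<le> mdist realisation (vertex v) b"
      using height_le[of _ A v] mdist_vertex[OF v] A by auto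
  qed (use A in simp)
qed

text \<open>The affine extension of the height is 1-Lipschitz and vanishes on \<open>A\<close>. Thus
  a walk at height at least \<open>r\<close> sweeps out a curve that avoids the open
  \<open>r\<close>-neighbourhood.\<close>

lemma dist_to_set_edge_ge:
  assumes A: "A \<subseteq> V" "A \<noteq> {}" and uv: "(u, v) \<in> E" "t \<in> {0..1}" and r: "r \<le> height A u" "r \<le> height A v"
  shows "real r \<le> dist_to_set realisation (edge_point u v t) (vertex ` A)"
proof (rule dist_to_set_ge)
  fix b assume "b \<in> vertex ` A"
  then obtain a where a: "a \<in> A" "b = vertex a" by blast
  let ?\<phi> = "\<lambda>w. real (height A w)"
  have "\<bar>?\<phi> x - ?\<phi> y\<bar> \<le> 1" if "(x, y) \<in> E" for x y
    using height_Lipschitz[OF A, of x y] height_Lipschitz[OF A, of y x] d_edge[OF that] d_sym[of x y] edgeD[OF that] by auto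
  then have "\<bar>affine_extension ?\<phi> (edge_point u v t) - affine_extension ?\<phi> b\<bar> \<le> mdist realisation (edge_point u v t) b"
    using edge_point_in uv a A by (intro affine_extension_Lipschitz) auto
  moreover have "affine_extension ?\<phi> b = 0" using a height_le[OF a(1), of a] by simp
  moreover have "affine_extension ?\<phi> (edge_point u v t) = (1 - t) * ?\<phi> u + t * ?\<phi> v"
    using edgeD uv by (intro affine_extension_edge_point) auto
  moreover have "(1 - t) * real r + t * real r \<le> (1 - t) * ?\<phi> u + t * ?\<phi> v"
    using uv r by (intro add_mono mult_left_mono) auto
  ultimately show "real r \<le> mdist realisation (edge_point u v t) b" by (simp add: algebra_simps)
qed (use A in simp)

text \<open>Quasi-geodesics may jump, so a step function suffices. Rounding times down changes
  differences by at most 1, and \<open>K + 1\<close> is at least 1 even if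
  \<open>K = 0\<close>.\<close>

lemma quasi_geodesic_of_discrete_qg:
  assumes v: "discrete_qg K L N v"
  shows "quasi_geodesic (real (K + 1)) (real (K + L + 1)) realisation 0 (real N) (\<lambda>t. vertex (v (nat \<lfloor>t\<rfloor>)))"
  unfolding quasi_geodesic_def quasi_isometric_embedding_def
proof (intro conjI ballI)
  have le: "nat \<lfloor>t\<rfloor> \<le> N" if "t \<in> {0..real N}" for t using that by (auto simp: nat_le_iff floor_le_iff)
  then show "(\<lambda>t. vertex (v (nat \<lfloor>t\<rfloor>))) ` mspace (submetric euclidean_metric {0..real N}) \<subseteq> mspace realisation"
    using dqgD(1)[OF v] by auto
  have *: "(t - s) / real (K + 1) - real (K + L + 1) \<le> mdist realisation (vertex (v (nat \<lfloor>s\<rfloor>))) (vertex (v (nat \<lfloor>t\<rfloor>)))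
     \<and> mdist realisation (vertex (v (nat \<lfloor>s\<rfloor>))) (vertex (v (nat \<lfloor>t\<rfloor>))) \<le> real (K + 1) * (t - s) + real (K + L + 1)"
    if st: "s \<in> {0..real N}" "t \<in> {0..real N}" "s \<le> t" for s t
  proof -
    let ?i = "nat \<lfloor>s\<rfloor>" and ?j = "nat \<lfloor>t\<rfloor>"
    let ?D = "d (v ?i) (v ?j)"
    have ij: "?i \<le> ?j" "?j \<le> N" using st le by (auto intro: nat_mono floor_mono)
    have m: "mdist realisation (vertex (v ?i)) (vertex (v ?j)) = real ?D"
      using ij dqgD(1)[OF v] by (intro mdist_vertex) auto
    have f: "real (?j - ?i) \<le> t - s + 1" "t - s \<le> real (?j - ?i) + 1"
      using ij st by (auto simp: of_nat_diff) linarith+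
    have "real ?D \<le> real (K * (?j - ?i) + L)" using dqgD(2)[OF v ij] by (simp only: of_nat_le_iff)
    also have "\<dots> = real K * real (?j - ?i) + real L" by simp
    also have "\<dots> \<le> real K * (t - s + 1) + real L" using f by (intro add_right_mono mult_left_mono) auto
    also have "\<dots> \<le> real (K + 1) * (t - s) + real (K + L + 1)" using st by (simp add: algebra_simps)
    finally have u: "real ?D \<le> real (K + 1) * (t - s) + real (K + L + 1)" .
    have "real (?j - ?i) \<le> real (K * ?D + L)" using dqgD(3)[OF v ij] by (simp only: of_nat_le_iff)
    then have "t - s \<le> real K * real ?D + real L + 1" using f by simp
    also have "\<dots> \<le> (real ?D + real (K + L + 1)) * real (K + 1)" by (simp add: algebra_simps)
    finally have "(t - s) / real (K + 1) \<le> real ?D + real (K + L + 1)"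
      by (simp add: divide_le_eq)
    then show ?thesis using u m by simp
  qed
  fix s t assume "s \<in> mspace (submetric euclidean_metric {0..real N})" "t \<in> mspace (submetric euclidean_metric {0..real N})"
  then have st: "s \<in> {0..real N}" "t \<in> {0..real N}" by auto
  have eq: "mdist (submetric euclidean_metric {0..real N}) s t = \<bar>t - s\<bar>" by (simp add: dist_real_def)
  have "\<bar>t - s\<bar> / real (K + 1) - real (K + L + 1) \<le> mdist realisation (vertex (v (nat \<lfloor>s\<rfloor>))) (vertex (v (nat \<lfloor>t\<rfloor>)))
     \<and> mdist realisation (vertex (v (nat \<lfloor>s\<rfloor>))) (vertex (v (nat \<lfloor>t\<rfloor>))) \<le> real (K + 1) * \<bar>t - s\<bar> + real (K + L + 1)"
  proof (cases "s \<le> t")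
    case True
    then show ?thesis using *[OF st True] by simp
  next
    case False
    then have ts: "t \<le> s" and abs: "\<bar>t - s\<bar> = s - t" by auto
    show ?thesis unfolding abs mdist_commute[of realisation "vertex (v (nat \<lfloor>s\<rfloor>))"] by (rule *[OF st(2,1) ts])
  qed
  then show "mdist (submetric euclidean_metric {0..real N}) s t / real (K + 1) - real (K + L + 1)
       \<le> mdist realisation (vertex (v (nat \<lfloor>s\<rfloor>))) (vertex (v (nat \<lfloor>t\<rfloor>)))"
    "mdist realisation (vertex (v (nat \<lfloor>s\<rfloor>))) (vertex (v (nat \<lfloor>t\<rfloor>)))
       \<le> real (K + 1) * mdist (submetric euclidean_metric {0..real N}) s t + real (K + L + 1)"
    unfolding eq by blast+
qed simp

lemma image_floor:
  "(\<lambda>t. f (nat \<lfloor>t\<rfloor>)) ` {0..real N} = f ` {..N}"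
proof
  show "(\<lambda>t. f (nat \<lfloor>t\<rfloor>)) ` {0..real N} \<subseteq> f ` {..N}"
    by (auto simp: nat_le_iff floor_le_iff)
  show "f ` {..N} \<subseteq> (\<lambda>t. f (nat \<lfloor>t\<rfloor>)) ` {0..real N}"
    by (auto intro!: image_eqI[of _ _ "real _"])
qed

lemma discrete_qg_of_quasi_geodesic:
  assumes K: "K \<ge> 1" and L: "L \<ge> 0" and c: "quasi_geodesic K L realisation a b c"
  defines "N \<equiv> nat \<lceil>b - a\<rceil>" and "v \<equiv> \<lambda>i. nearest_vertex (c (min (a + real i) b))"
  shows "discrete_qg (nat \<lceil>K\<rceil>) (nat \<lceil>K * (2 + L) + L + 3\<rceil>) N v" "v 0 = nearest_vertex (c a)" "v N = nearest_vertex (c b)"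
    "\<And>t. t \<in> {a..b} \<Longrightarrow> \<exists>i\<le>N. mdist realisation (c t) (vertex (v i)) \<le> K + L + 1"
    "\<And>i. i \<le> N \<Longrightarrow> \<exists>t\<in>{a..b}. mdist realisation (c t) (vertex (v i)) \<le> 1"
proof -
  have ab: "a \<le> b" using c by (simp add: quasi_geodesic_def)
  have cin: "c t \<in> graph_points V E" if "t \<in> {a..b}" for t
    using c that unfolding quasi_geodesic_def quasi_isometric_embedding_def by auto
  have qi: "\<bar>s - t\<bar> / K - L \<le> mdist realisation (c s) (c t)" "mdist realisation (c s) (c t) \<le> K * \<bar>s - t\<bar> + L"
    if "s \<in> {a..b}" "t \<in> {a..b}" for s t
    using c that unfolding quasi_geodesic_def quasi_isometric_embedding_def by (auto simp: dist_real_def)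
  \<comment> \<open>Sample times are clamped at \<open>b\<close>, so the last step may be shorter
    than 1 and the final sample is exactly the end point.\<close>
  define \<tau> where "\<tau> i = min (a + real i) b" for i
  have \<tau>: "\<tau> i \<in> {a..b}" for i using ab by (auto simp: \<tau>_def)
  have v: "v i = nearest_vertex (c (\<tau> i))" for i by (simp add: v_def \<tau>_def)
  have N: "b - a \<le> real N" "real N < b - a + 1" using ab unfolding N_def by linarith+
  have "min (a + real N) b = b" "min (a + real 0) b = a" using ab N by auto
  then show "v 0 = nearest_vertex (c a)" "v N = nearest_vertex (c b)" unfolding v_def by auto
  show "\<exists>t\<in>{a..b}. mdist realisation (c t) (vertex (v i)) \<le> 1" if "i \<le> N" for i
    using \<tau>[of i] nearest_vertex(2)[OF cin[OF \<tau>]] unfolding v by blast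
  show "\<exists>i\<le>N. mdist realisation (c t) (vertex (v i)) \<le> K + L + 1" if t: "t \<in> {a..b}" for t
  proof -
    define i where "i = nat \<lfloor>t - a\<rfloor>"
    have "real i = of_int \<lfloor>t - a\<rfloor>" using t by (simp add: i_def)
    then have i: "real i \<le> t - a" "t - a < real i + 1" by linarith+
    then have "real i \<le> real N" using t N(1) by auto
    then have "i \<le> N" by simp
    have "\<tau> i = a + real i" using i t by (auto simp: \<tau>_def)
    then have "\<bar>t - \<tau> i\<bar> \<le> 1" using i by simp
    then have "mdist realisation (c t) (c (\<tau> i)) \<le> K * 1 + L"
      using qi(2)[OF t \<tau>[of i]] mult_left_mono[of "\<bar>t - \<tau> i\<bar>" 1 K] K by linarith
    moreover have "mdist realisation (c t) (vertex (v i)) \<le> mdist realisation (c t) (c (\<tau> i)) + mdist realisation (c (\<tau> i)) (vertex (v i))"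
      using cin[OF t] cin[OF \<tau>] nearest_vertex(1)[OF cin[OF \<tau>]] unfolding v by (intro mdist_triangle) auto
    ultimately show ?thesis using \<open>i \<le> N\<close> nearest_vertex(2)[OF cin[OF \<tau>], of i] unfolding v by (intro exI[of _ i]) linarith
  qed
  show "discrete_qg (nat \<lceil>K\<rceil>) (nat \<lceil>K * (2 + L) + L + 3\<rceil>) N v"
  proof (rule dqgI)
    show "v i \<in> V" for i using nearest_vertex(1)[OF cin[OF \<tau>]] unfolding v .
    fix i j assume ij: "i \<le> j" "j \<le> N"
    let ?D = "real (d (v i) (v j))"
    have KK: "K \<le> real (nat \<lceil>K\<rceil>)" using K by linarith
    \<comment> \<open>One additive constant serves both estimates: \<open>L + 2\<close> for the
      upper one, by rounding to vertices, and \<open>K * (2 + L) + 1\<close> for the lower one,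
      where the 1 is the clamped last step.\<close>
    have LL: "K * (2 + L) + L + 3 \<le> real (nat \<lceil>K * (2 + L) + L + 3\<rceil>)" by linarith
    have KL: "0 \<le> K * (2 + L)" using K L by simp
    have t: "\<bar>\<tau> i - \<tau> j\<bar> \<le> real (j - i)" "real (j - i) \<le> \<bar>\<tau> i - \<tau> j\<bar> + 1"
      using ij N by (auto simp: \<tau>_def min_def of_nat_diff)
    have "?D \<le> mdist realisation (c (\<tau> i)) (c (\<tau> j)) + 2" unfolding v using d_nearest_vertex(1)[OF cin[OF \<tau>] cin[OF \<tau>]] .
    also have "\<dots> \<le> K * \<bar>\<tau> i - \<tau> j\<bar> + L + 2" using qi(2)[OF \<tau> \<tau>] by simp
    also have "\<dots> \<le> K * real (j - i) + L + 2" using t K by (simp add: mult_left_mono)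
    also have "\<dots> \<le> real (nat \<lceil>K\<rceil>) * real (j - i) + real (nat \<lceil>K * (2 + L) + L + 3\<rceil>)"
      using mult_right_mono[OF KK, of "real (j - i)"] LL KL by linarith
    finally show "d (v i) (v j) \<le> nat \<lceil>K\<rceil> * (j - i) + nat \<lceil>K * (2 + L) + L + 3\<rceil>"
      by (metis of_nat_add of_nat_le_iff of_nat_mult)
    have "\<bar>\<tau> i - \<tau> j\<bar> / K \<le> ?D + 2 + L"
      using qi(1)[OF \<tau>[of i] \<tau>[of j]] d_nearest_vertex(2)[OF cin[OF \<tau>[of i]] cin[OF \<tau>[of j]]] unfolding v by linarith
    then have "\<bar>\<tau> i - \<tau> j\<bar> \<le> K * (?D + 2 + L)" using K by (simp add: divide_le_eq mult.commute)
    then have "real (j - i) \<le> K * ?D + K * (2 + L) + 1" using t by (simp add: algebra_simps)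
    also have "\<dots> \<le> real (nat \<lceil>K\<rceil>) * ?D + real (nat \<lceil>K * (2 + L) + L + 3\<rceil>)"
      using mult_right_mono[OF KK, of ?D] LL L by linarith
    finally show "j - i \<le> nat \<lceil>K\<rceil> * d (v i) (v j) + nat \<lceil>K * (2 + L) + L + 3\<rceil>"
      by (metis of_nat_add of_nat_le_iff of_nat_mult)
  qed
qed

end

section \<open>Passing from the realisation to the vertices\<close>

context vgraph
begin

lemma strongly_quasiconvex_iff_discretely_quasiconvex:
  assumes A: "A \<subseteq> V" "A \<noteq> {}"
  shows "(\<forall>K\<ge>1. \<forall>C\<ge>0. \<exists>M. \<forall>a b c. quasi_geodesic K C realisation a b c \<and> c a \<in> vertex ` A \<and> c b \<in> vertex ` A \<longrightarrow>
        c ` {a..b} \<subseteq> nbhd realisation M (vertex ` A)) \<longleftrightarrow> discretely_quasiconvex A" (is "?lhs \<longleftrightarrow> _")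
proof
  assume ?lhs
  show "discretely_quasiconvex A"
    unfolding discretely_quasiconvex_def
  proof (intro allI)
    fix K L
    have K1: "1 \<le> real (K + 1)" "0 \<le> real (K + L + 1)" by auto
    obtain M where M: "\<And>a b c. \<lbrakk>quasi_geodesic (real (K + 1)) (real (K + L + 1)) realisation a b c; c a \<in> vertex ` A; c b \<in> vertex ` A\<rbrakk>
        \<Longrightarrow> c ` {a..b} \<subseteq> nbhd realisation M (vertex ` A)"
      using \<open>?lhs\<close>[rule_format, OF K1] by meson
    have "height A (v i) \<le> nat \<lceil>M\<rceil>" if v: "discrete_qg K L N v" "v 0 \<in> A" "v N \<in> A" "i \<le> N" for N v i
    proof -
      have "(\<lambda>t. vertex (v (nat \<lfloor>t\<rfloor>))) ` {0..real N} \<subseteq> nbhd realisation M (vertex ` A)"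
        using v by (intro M quasi_geodesic_of_discrete_qg) auto
      moreover have "vertex (v i) \<in> (\<lambda>t. vertex (v (nat \<lfloor>t\<rfloor>))) ` {0..real N}"
        using v(4) image_floor[of "\<lambda>i. vertex (v i)" N] by blast
      ultimately have "dist_to_set realisation (vertex (v i)) (vertex ` A) < M" by (auto simp: nbhd_def)
      then show ?thesis using dist_to_set_vertex[OF A dqgD(1)[OF v(1,4)]] by linarith
    qed
    then show "\<exists>M. \<forall>N v. discrete_qg K L N v \<and> v 0 \<in> A \<and> v N \<in> A \<longrightarrow> (\<forall>i\<le>N. height A (v i) \<le> M)" by blast
  qed
next
  assume sqc: "discretely_quasiconvex A"
  show ?lhs
  proof (intro allI impI)
    fix K C :: real assume K: "1 \<le> K" and C: "0 \<le> C"
    obtain M where M: "\<And>N v i. \<lbrakk>discrete_qg (nat \<lceil>K\<rceil>) (nat \<lceil>K * (2 + C) + C + 3\<rceil>) N v; v 0 \<in> A; v N \<in> A; i \<le> N\<rbrakk> \<Longrightarrow> height A (v i) \<le> M"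
      using sqc unfolding discretely_quasiconvex_def by meson
    \<comment> \<open>Moving to a sampled vertex costs \<open>K + C + 1\<close>; the remaining 1
      makes the inequality strict.\<close>
    have "c ` {a..b} \<subseteq> nbhd realisation (real M + K + C + 2) (vertex ` A)"
      if c: "quasi_geodesic K C realisation a b c" "c a \<in> vertex ` A" "c b \<in> vertex ` A" for a b c
    proof
      fix p assume "p \<in> c ` {a..b}"
      then obtain t where t: "t \<in> {a..b}" "p = c t" by blast
      define v where "v i = nearest_vertex (c (min (a + real i) b))" for i
      define N where "N = nat \<lceil>b - a\<rceil>"
      note v = discrete_qg_of_quasi_geodesic[OF K C c(1), folded v_def N_def]
      have ends: "v 0 \<in> A" "v N \<in> A" using v(2,3) c A by auto
      obtain i where i: "i \<le> N" "mdist realisation (c t) (vertex (v i)) \<le> K + C + 1" using v(4)[OF t(1)] by blast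
      have vi: "v i \<in> V" using dqgD(1)[OF v(1) i(1)] .
      have p: "p \<in> mspace realisation"
        using c(1) t unfolding quasi_geodesic_def quasi_isometric_embedding_def by auto
      have "dist_to_set realisation p (vertex ` A) \<le> mdist realisation p (vertex (v i)) + dist_to_set realisation (vertex (v i)) (vertex ` A)"
        using p vi A by (intro dist_to_set_Lipschitz) auto
      also have "\<dots> \<le> K + C + 1 + real M"
        using i t M[OF v(1) ends i(1)] dist_to_set_vertex[OF A vi] by auto
      finally show "p \<in> nbhd realisation (real M + K + C + 2) (vertex ` A)"
        using p by (simp add: nbhd_def)
    qed
    then show "\<exists>M. \<forall>a b c. quasi_geodesic K C realisation a b c \<and> c a \<in> vertex ` A \<and> c b \<in> vertex ` A \<longrightarrow>
        c ` {a..b} \<subseteq> nbhd realisation M (vertex ` A)" by blast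
  qed
qed

text \<open>The Hausdorff bound is stated in one direction; exchanging the two quasi-geodesics gives
  the other.\<close>

definition discretely_stable :: "'a set \<Rightarrow> bool" where
  "discretely_stable A \<longleftrightarrow> (\<forall>K L. \<exists>R. \<forall>N v N' v'. discrete_qg K L N v \<and> discrete_qg K L N' v' \<and> v 0 = v' 0 \<and> v N = v' N' \<and>
     v 0 \<in> A \<and> v N \<in> A \<longrightarrow> (\<forall>i\<le>N. \<exists>j\<le>N'. d (v i) (v' j) \<le> R))"

end

section \<open>Stability and the Hausdorff distance\<close>

lemma Hausdorff_distance_less_imp:
  assumes "Hausdorff_distance m A B < ennreal R" "x \<in> A"
  obtains y where "y \<in> B" "mdist m x y < R"
proof -
  have "(INF y\<in>B. ennreal (mdist m x y)) \<le> (SUP x\<in>A. INF y\<in>B. ennreal (mdist m x y))"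
    using assms(2) by (rule SUP_upper)
  also have "\<dots> < ennreal R" using assms(1) by (simp add: Hausdorff_distance_def)
  finally obtain y where y: "y \<in> B" "ennreal (mdist m x y) < ennreal R" by (auto simp: INF_less_iff)
  then have "mdist m x y < R" by (simp add: ennreal_less_iff)
  then show thesis using that y by blast
qed

lemma Hausdorff_distance_le:
  assumes "\<And>x. x \<in> A \<Longrightarrow> \<exists>y\<in>B. mdist m x y \<le> R" "\<And>y. y \<in> B \<Longrightarrow> \<exists>x\<in>A. mdist m x y \<le> R"
  shows "Hausdorff_distance m A B \<le> ennreal R"
proof -
  have "(INF y\<in>B. ennreal (mdist m x y)) \<le> ennreal R" if "x \<in> A" for x
    using assms(1)[OF that] by (meson INF_lower2 ennreal_leI)
  moreover have "(INF x\<in>A. ennreal (mdist m x y)) \<le> ennreal R" if "y \<in> B" for y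
    using assms(2)[OF that] by (meson INF_lower2 ennreal_leI)
  ultimately show ?thesis unfolding Hausdorff_distance_def by (simp add: SUP_least)
qed

context vgraph
begin

lemma stable_iff_discretely_stable:
  assumes A: "A \<subseteq> V"
  shows "(\<forall>K\<ge>1. \<forall>L\<ge>0. \<exists>R::real. \<forall>a b c a' b' c'.
        quasi_geodesic K L realisation a b c \<and> quasi_geodesic K L realisation a' b' c' \<and>
        c a = c' a' \<and> c b = c' b' \<and> c a \<in> vertex ` A \<and> c b \<in> vertex ` A \<longrightarrow>
        Hausdorff_distance realisation (c ` {a..b}) (c' ` {a'..b'}) < ennreal R) \<longleftrightarrow> discretely_stable A" (is "?lhs \<longleftrightarrow> _")
proof
  assume ?lhs
  show "discretely_stable A"
    unfolding discretely_stable_def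
  proof (intro allI)
    fix K L
    have K1: "1 \<le> real (K + 1)" "0 \<le> real (K + L + 1)" by auto
    obtain R where R: "\<And>a b c a' b' c'. \<lbrakk>quasi_geodesic (real (K + 1)) (real (K + L + 1)) realisation a b c;
        quasi_geodesic (real (K + 1)) (real (K + L + 1)) realisation a' b' c'; c a = c' a'; c b = c' b';
        c a \<in> vertex ` A; c b \<in> vertex ` A\<rbrakk> \<Longrightarrow> Hausdorff_distance realisation (c ` {a..b}) (c' ` {a'..b'}) < ennreal R"
      using \<open>?lhs\<close>[rule_format, OF K1] by meson
    have "\<exists>j\<le>N'. d (v i) (v' j) \<le> nat \<lceil>R\<rceil>"
      if v: "discrete_qg K L N v" "discrete_qg K L N' v'" "v 0 = v' 0" "v N = v' N'" "v 0 \<in> A" "v N \<in> A" "i \<le> N" for N v N' v' i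
    proof -
      define c c' where "c t = vertex (v (nat \<lfloor>t\<rfloor>))" and "c' t = vertex (v' (nat \<lfloor>t\<rfloor>))" for t :: real
      have "Hausdorff_distance realisation (c ` {0..real N}) (c' ` {0..real N'}) < ennreal R"
        unfolding c_def c'_def using v by (intro R quasi_geodesic_of_discrete_qg) auto
      moreover have im: "c ` {0..real N} = (\<lambda>i. vertex (v i)) ` {..N}" "c' ` {0..real N'} = (\<lambda>i. vertex (v' i)) ` {..N'}"
        unfolding c_def c'_def by (rule image_floor)+
      moreover have "vertex (v i) \<in> c ` {0..real N}" using im v(7) by auto
      ultimately obtain y where "y \<in> (\<lambda>i. vertex (v' i)) ` {..N'}" "mdist realisation (vertex (v i)) y < R"
        using Hausdorff_distance_less_imp[of realisation "c ` {0..real N}" "c' ` {0..real N'}" R "vertex (v i)"] by metis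
      then obtain j where j: "j \<le> N'" "mdist realisation (vertex (v i)) (vertex (v' j)) < R" by auto
      then show ?thesis
        using mdist_vertex[OF dqgD(1)[OF v(1,7)] dqgD(1)[OF v(2) j(1)]] by (intro exI[of _ j]) linarith
    qed
    then show "\<exists>R. \<forall>N v N' v'. discrete_qg K L N v \<and> discrete_qg K L N' v' \<and> v 0 = v' 0 \<and> v N = v' N' \<and>
       v 0 \<in> A \<and> v N \<in> A \<longrightarrow> (\<forall>i\<le>N. \<exists>j\<le>N'. d (v i) (v' j) \<le> R)" by blast
  qed
next
  assume stab: "discretely_stable A"
  show ?lhs
  proof (intro allI impI)
    fix K L :: real assume K: "1 \<le> K" and L: "0 \<le> L"
    define K' L' where "K' = nat \<lceil>K\<rceil>" and "L' = nat \<lceil>K * (2 + L) + L + 3\<rceil>"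
    obtain R where R: "\<And>N v N' v' i. \<lbrakk>discrete_qg K' L' N v; discrete_qg K' L' N' v'; v 0 = v' 0; v N = v' N'; v 0 \<in> A; v N \<in> A; i \<le> N\<rbrakk>
        \<Longrightarrow> \<exists>j\<le>N'. d (v i) (v' j) \<le> R"
      using stab unfolding discretely_stable_def by meson
    \<comment> \<open>\<open>K + L + 1\<close> leads to a sampled vertex, \<open>R\<close> to a
      vertex sampled from the other curve, and the final 1 back onto that curve.\<close>
    define B where "B = K + L + 1 + real R + 1"
    have close: "\<exists>y\<in>c' ` {a'..b'}. mdist realisation x y \<le> B"
      if c: "quasi_geodesic K L realisation a b c" "quasi_geodesic K L realisation a' b' c'"
        "c a = c' a'" "c b = c' b'" "c a \<in> vertex ` A" "c b \<in> vertex ` A" and x: "x \<in> c ` {a..b}" for a b c a' b' c' x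
    proof -
      obtain t where t: "t \<in> {a..b}" "x = c t" using x by blast
      define v N where "v i = nearest_vertex (c (min (a + real i) b))" and "N = nat \<lceil>b - a\<rceil>" for i
      define v' N' where "v' i = nearest_vertex (c' (min (a' + real i) b'))" and "N' = nat \<lceil>b' - a'\<rceil>" for i
      note v = discrete_qg_of_quasi_geodesic[OF K L c(1), folded v_def N_def K'_def L'_def]
      note v' = discrete_qg_of_quasi_geodesic[OF K L c(2), folded v'_def N'_def K'_def L'_def]
      have ends: "v 0 = v' 0" "v N = v' N'" "v 0 \<in> A" "v N \<in> A" using v(2,3) v'(2,3) c A by auto
      obtain i where i: "i \<le> N" "mdist realisation x (vertex (v i)) \<le> K + L + 1" using v(4)[OF t(1)] t by blast
      obtain j where j: "j \<le> N'" "d (v i) (v' j) \<le> R" using R[OF v(1) v'(1) ends i(1)] by blast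
      obtain t' where t': "t' \<in> {a'..b'}" "mdist realisation (c' t') (vertex (v' j)) \<le> 1" using v'(5)[OF j(1)] by blast
      have V: "v i \<in> V" "v' j \<in> V" using dqgD(1)[OF v(1) i(1)] dqgD(1)[OF v'(1) j(1)] .
      have in': "x \<in> mspace realisation" "c' t' \<in> mspace realisation"
        using c(1,2) t t' unfolding quasi_geodesic_def quasi_isometric_embedding_def by auto
      have "mdist realisation x (c' t') \<le> mdist realisation x (vertex (v i)) + mdist realisation (vertex (v i)) (c' t')"
        using in' V by (intro mdist_triangle) auto
      moreover have "mdist realisation (vertex (v i)) (c' t') \<le> mdist realisation (vertex (v i)) (vertex (v' j)) + mdist realisation (vertex (v' j)) (c' t')"
        using in' V by (intro mdist_triangle) auto
      moreover have "mdist realisation (vertex (v i)) (vertex (v' j)) \<le> real R" using mdist_vertex[OF V] j by simp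
      moreover have "mdist realisation (vertex (v' j)) (c' t') \<le> 1" using t'(2) mdist_commute by metis
      ultimately have "mdist realisation x (c' t') \<le> B" using i(2) unfolding B_def by linarith
      then show ?thesis using t' by blast
    qed
    have "Hausdorff_distance realisation (c ` {a..b}) (c' ` {a'..b'}) < ennreal (B + 1)"
      if c: "quasi_geodesic K L realisation a b c" "quasi_geodesic K L realisation a' b' c'"
        "c a = c' a'" "c b = c' b'" "c a \<in> vertex ` A" "c b \<in> vertex ` A" for a b c a' b' c'
    proof -
      have "\<exists>x\<in>c ` {a..b}. mdist realisation x y \<le> B" if "y \<in> c' ` {a'..b'}" for y
        using close[OF c(2,1) c(3,4)[symmetric] _ _ that] c mdist_commute by metis
      then have "Hausdorff_distance realisation (c ` {a..b}) (c' ` {a'..b'}) \<le> ennreal B"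
        using close[OF c] by (intro Hausdorff_distance_le)
      also have "\<dots> < ennreal (B + 1)" using K L by (simp add: B_def ennreal_less_iff)
      finally show ?thesis .
    qed
    then show "\<exists>R::real. \<forall>a b c a' b' c'.
        quasi_geodesic K L realisation a b c \<and> quasi_geodesic K L realisation a' b' c' \<and>
        c a = c' a' \<and> c b = c' b' \<and> c a \<in> vertex ` A \<and> c b \<in> vertex ` A \<longrightarrow>
        Hausdorff_distance realisation (c ` {a..b}) (c' ` {a'..b'}) < ennreal R" by blast
  qed
qed

text \<open>The segment is composed of edges with both ends in the interval.\<close>

lemma geodesic_segment_near_interval:
  assumes V: "x \<in> V" "y \<in> V"
  obtains \<gamma> where "geodesic_segment realisation (vertex x) (vertex y) \<gamma>"
    "\<And>p. p \<in> \<gamma> \<Longrightarrow> p \<in> mspace realisation \<and> (\<exists>w\<in>interval x y. mdist realisation p (vertex w) \<le> 1)"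
proof -
  define Y where "Y = {p \<in> graph_points V E. \<exists>w\<in>interval x y. mdist realisation p (vertex w) \<le> 1}"
  have "lip_joined Y (vertex x) (vertex y) (mdist realisation (vertex x) (vertex y))"
    unfolding mdist_vertex[OF V]
  proof (rule lip_joined_relpow[OF _ _ _ interval_walk[OF V order.refl]])
    show "vertex x \<in> Y" using V by (auto simp: Y_def interval_def intro!: bexI[of _ x])
    fix a b t assume ab: "(a, b) \<in> Restr E (interval x y)" "t \<in> {0..1::real}"
    then have "mdist realisation (edge_point a b t) (vertex a) = \<bar>t - 0\<bar>"
      using mdist_edge[of a b t 0] by simp
    then show "edge_point a b t \<in> Y" using ab edge_point_in[of a b t] by (auto simp: Y_def intro!: bexI[of _ a])
  qed (auto simp: Y_def)
  then obtain \<gamma> where "geodesic_segment realisation (vertex x) (vertex y) \<gamma>" "\<gamma> \<subseteq> Y"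
    by (rule geodesic_segment_of_lip_joined[rotated]) (auto simp: Y_def)
  then show thesis using that[of \<gamma>] unfolding Y_def by auto
qed

lemma geodesic_segment_through:
  assumes V: "x \<in> V" "y \<in> V" and p: "p \<in> interval x y"
  obtains \<gamma> where "geodesic_segment realisation (vertex x) (vertex y) \<gamma>" "vertex p \<in> \<gamma>"
proof -
  have pV: "p \<in> V" "d x p + d p y = d x y" using p by (auto simp: interval_def)
  let ?G = "graph_points V E" and ?l = "real (d x p)" and ?l' = "real (d p y)"
  have "lip_joined ?G (vertex x) (vertex p) ?l" "lip_joined ?G (vertex p) (vertex y) ?l'"
    using lip_joined_pl_path[OF pl_path_mdist] V pV mdist_vertex by (metis vertex_in)+
  then obtain c where c: "c 0 = vertex x" "c ?l = vertex p" "c (?l + ?l') = vertex y" "lip_curve ?G c (?l + ?l')"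
    using lip_curve_concat[OF order.refl] by blast
  have "?l + ?l' = mdist realisation (c 0) (c (?l + ?l'))" using c mdist_vertex[OF V] pV by simp
  from lip_curve_geodesic_segment(1)[OF order.refl c(4) this] have "geodesic_segment realisation (vertex x) (vertex y) (c ` {0..?l + ?l'})"
    using c by simp
  moreover have "vertex p \<in> c ` {0..?l + ?l'}" by (rule image_eqI[of _ _ ?l]) (auto simp: c)
  ultimately show thesis by (rule that)
qed

text \<open>The side carrying \<open>p\<close> must pass through it, whereas the other two sides
  must stay within 1 of their intervals; the two preceding constructions supply these
  segments.\<close>

lemma slim_intervals_if_hyperbolic:
  assumes "Gromov_hyperbolic realisation"
  shows "\<exists>\<delta>. slim_intervals \<delta>"
proof -
  obtain \<delta> where \<delta>: "\<And>x y z \<alpha> \<beta> \<gamma> p. \<lbrakk>geodesic_segment realisation x y \<alpha>; geodesic_segment realisation y z \<beta>; geodesic_segment realisation z x \<gamma>; p \<in> \<alpha>\<rbrakk>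
      \<Longrightarrow> \<exists>q\<in>\<beta> \<union> \<gamma>. mdist realisation p q \<le> \<delta>"
    using assms unfolding Gromov_hyperbolic_def by meson
  have "\<exists>q\<in>interval y z \<union> interval z x. d p q \<le> nat \<lceil>\<delta> + 1\<rceil>" if V: "x \<in> V" "y \<in> V" "z \<in> V" and p: "p \<in> interval x y" for x y z p
  proof -
    obtain \<alpha> where \<alpha>: "geodesic_segment realisation (vertex x) (vertex y) \<alpha>" "vertex p \<in> \<alpha>"
      by (rule geodesic_segment_through[OF V(1,2) p])
    obtain \<beta> where \<beta>: "geodesic_segment realisation (vertex y) (vertex z) \<beta>"
      "\<And>p. p \<in> \<beta> \<Longrightarrow> p \<in> mspace realisation \<and> (\<exists>w\<in>interval y z. mdist realisation p (vertex w) \<le> 1)"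
      by (rule geodesic_segment_near_interval[OF V(2,3)]) blast
    obtain \<gamma> where \<gamma>: "geodesic_segment realisation (vertex z) (vertex x) \<gamma>"
      "\<And>p. p \<in> \<gamma> \<Longrightarrow> p \<in> mspace realisation \<and> (\<exists>w\<in>interval z x. mdist realisation p (vertex w) \<le> 1)"
      by (rule geodesic_segment_near_interval[OF V(3,1)]) blast
    obtain q where q: "q \<in> \<beta> \<union> \<gamma>" "mdist realisation (vertex p) q \<le> \<delta>" using \<delta>[OF \<alpha>(1) \<beta>(1) \<gamma>(1) \<alpha>(2)] by blast
    then obtain w where w: "w \<in> interval y z \<union> interval z x" "mdist realisation q (vertex w) \<le> 1" "q \<in> mspace realisation"
      using \<beta>(2)[of q] \<gamma>(2)[of q] by blast
    have pw: "p \<in> V" "w \<in> V" using p w by (auto simp: interval_def)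
    have "mdist realisation (vertex p) (vertex w) \<le> mdist realisation (vertex p) q + mdist realisation q (vertex w)"
      using w pw by (intro mdist_triangle) auto
    then have "real (d p w) \<le> \<delta> + 1" using q w mdist_vertex[OF pw] by linarith
    then show ?thesis using w by (intro bexI[of _ w]) linarith+
  qed
  then show ?thesis unfolding slim_intervals_def by blast
qed

text \<open>Rounding depends only on the corner itself, so the three sampled sides close up to a
  triangle.\<close>

lemma hyperbolic_if_thin_bigons:
  assumes thin_bigons
  shows "Gromov_hyperbolic realisation"
proof -
  \<comment> \<open>Sampling a geodesic, a quasi-geodesic with constants 1 and 0, has additive
    constant \<open>1 * (2 + 0) + 0 + 3 = 5\<close>.\<close>
  from thin_bigons_imp_slim_triangles[OF assms, of 5] obtain R where R: "\<forall>Na a Nb b Nc c. discrete_qg 1 5 Na a \<and> discrete_qg 1 5 Nb b \<and> discrete_qg 1 5 Nc c \<and>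
     a Na = b 0 \<and> b Nb = c 0 \<and> c Nc = a 0 \<longrightarrow>
     (\<forall>i\<le>Na. (\<exists>j\<le>Nb. d (a i) (b j) \<le> R) \<or> (\<exists>j\<le>Nc. d (a i) (c j) \<le> R))" ..
  have disc: "\<exists>N v. discrete_qg 1 5 N v \<and> v 0 = nearest_vertex x \<and> v N = nearest_vertex y \<and>
      (\<forall>p\<in>\<alpha>. \<exists>i\<le>N. mdist realisation p (vertex (v i)) \<le> 2) \<and> (\<forall>i\<le>N. \<exists>p\<in>\<alpha>. mdist realisation p (vertex (v i)) \<le> 1) \<and> \<alpha> \<subseteq> mspace realisation"
    if "geodesic_segment realisation x y \<alpha>" for x y \<alpha>
  proof -
    obtain l c where c: "0 \<le> l" "c ` {0..l} \<subseteq> mspace realisation" "c 0 = x" "c l = y" "\<alpha> = c ` {0..l}"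
      "\<And>s t. s \<in> {0..l} \<Longrightarrow> t \<in> {0..l} \<Longrightarrow> mdist realisation (c s) (c t) = \<bar>s - t\<bar>"
      using \<open>geodesic_segment realisation x y \<alpha>\<close> unfolding geodesic_segment_def by blast
    have qg: "quasi_geodesic 1 0 realisation 0 l c"
      unfolding quasi_geodesic_def quasi_isometric_embedding_def using c by (auto simp: dist_real_def)
    define v N where "v i = nearest_vertex (c (min (0 + real i) l))" and "N = nat \<lceil>l - 0\<rceil>" for i
    note v = discrete_qg_of_quasi_geodesic[OF order.refl order.refl qg, folded v_def N_def]
    have "discrete_qg 1 5 N v" using v(1) by simp
    moreover have "\<exists>i\<le>N. mdist realisation p (vertex (v i)) \<le> 2" if "p \<in> \<alpha>" for p
      using v(4) that c(5) by auto
    moreover have "\<exists>p\<in>\<alpha>. mdist realisation p (vertex (v i)) \<le> 1" if "i \<le> N" for i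
      using v(5)[OF that] c(5) by auto
    ultimately show ?thesis using v(2,3) c by (intro exI[of _ N] exI[of _ v]) auto
  qed
  have "\<exists>q\<in>\<beta> \<union> \<gamma>. mdist realisation p q \<le> real R + 3"
    if seg: "geodesic_segment realisation x y \<alpha>" "geodesic_segment realisation y z \<beta>" "geodesic_segment realisation z x \<gamma>" and p: "p \<in> \<alpha>"
    for x y z \<alpha> \<beta> \<gamma> p
  proof -
    obtain Na a where a: "discrete_qg 1 5 Na a" "a 0 = nearest_vertex x" "a Na = nearest_vertex y"
      "\<And>p. p \<in> \<alpha> \<Longrightarrow> \<exists>i\<le>Na. mdist realisation p (vertex (a i)) \<le> 2" "\<alpha> \<subseteq> mspace realisation" using disc[OF seg(1)] by blast
    obtain Nb b where b: "discrete_qg 1 5 Nb b" "b 0 = nearest_vertex y" "b Nb = nearest_vertex z"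
      "\<And>i. i \<le> Nb \<Longrightarrow> \<exists>p\<in>\<beta>. mdist realisation p (vertex (b i)) \<le> 1" "\<beta> \<subseteq> mspace realisation" using disc[OF seg(2)] by blast
    obtain Nc c where c: "discrete_qg 1 5 Nc c" "c 0 = nearest_vertex z" "c Nc = nearest_vertex x"
      "\<And>i. i \<le> Nc \<Longrightarrow> \<exists>p\<in>\<gamma>. mdist realisation p (vertex (c i)) \<le> 1" "\<gamma> \<subseteq> mspace realisation" using disc[OF seg(3)] by blast
    obtain i where i: "i \<le> Na" "mdist realisation p (vertex (a i)) \<le> 2" using a(4)[OF p] by blast
    have "(\<exists>j\<le>Nb. d (a i) (b j) \<le> R) \<or> (\<exists>j\<le>Nc. d (a i) (c j) \<le> R)"
      using R[rule_format, of Na a Nb b Nc c i] a(1-3) b(1-3) c(1-3) i(1) by simp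
    then obtain w q where w: "w \<in> V" "d (a i) w \<le> R" "q \<in> \<beta> \<union> \<gamma>" "mdist realisation q (vertex w) \<le> 1"
      using b(4) c(4) dqgD(1)[OF b(1)] dqgD(1)[OF c(1)] by blast
    have in': "p \<in> mspace realisation" "q \<in> mspace realisation" "a i \<in> V" using p w a b c dqgD(1)[OF a(1) i(1)] by auto
    have "mdist realisation p q \<le> mdist realisation p (vertex (a i)) + mdist realisation (vertex (a i)) q"
      "mdist realisation (vertex (a i)) q \<le> mdist realisation (vertex (a i)) (vertex w) + mdist realisation (vertex w) q"
      using in' w by (auto intro!: mdist_triangle)
    moreover have "mdist realisation (vertex (a i)) (vertex w) \<le> real R" using mdist_vertex in' w by simp
    moreover have "mdist realisation (vertex w) q \<le> 1" using w(4) mdist_commute by metis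
    ultimately show ?thesis using i w(3) by (intro bexI[of _ q]) linarith
  qed
  then show ?thesis
    unfolding Gromov_hyperbolic_def using geodesic_space_realisation by (intro conjI exI[of _ "real R + 3"]) auto
qed

end

section \<open>Rectifiable paths and lower divergence\<close>

lemma path_length_ge_partition:
  "(\<Sum>i<N. ennreal (mdist m (g (real i / real N)) (g (real (Suc i) / real N)))) \<le> path_length m g"
proof (cases "N = 0")
  case False
  define ts where "ts = map (\<lambda>i. real i / real N) [0..<Suc N]"
  have "sorted ts"
    unfolding ts_def sorted_map by (rule sorted_wrt_mono_rel[OF _ sorted_upt]) (simp add: divide_right_mono)
  moreover have "set ts \<subseteq> {0..1}" using False by (auto simp: ts_def simp del: upt_Suc)
  ultimately have "(\<Sum>i<length ts - 1. ennreal (mdist m (g (ts ! i)) (g (ts ! Suc i)))) \<le> path_length m g"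
    unfolding path_length_def by (intro SUP_upper) auto
  moreover have "(\<Sum>i<length ts - 1. ennreal (mdist m (g (ts ! i)) (g (ts ! Suc i))))
     = (\<Sum>i<N. ennreal (mdist m (g (real i / real N)) (g (real (Suc i) / real N))))"
    by (intro sum.cong) (auto simp: ts_def simp del: upt_Suc)
  ultimately show ?thesis by simp
qed simp

text \<open>A Lebesgue number argument on the unit interval.\<close>

lemma pathin_fine_partition:
  assumes "pathin (mtopology_of m) g"
  obtains N where "N > 0" "\<And>i. i < N \<Longrightarrow> mdist m (g (real i / real N)) (g (real (Suc i) / real N)) \<le> 1"
proof -
  have cont: "continuous_map (top_of_set {0..1}) (mtopology_of m) g" using assms by (simp add: pathin_def)
  have gin: "g t \<in> mspace m" if "t \<in> {0..1}" for t
    using continuous_map_image_subset_topspace[OF cont] that by auto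
  \<comment> \<open>Each set of the cover is an open set of reals on whose part in the unit interval
    \<open>g\<close> stays in a ball of radius 1/2, hence has oscillation at most 1.\<close>
  define \<G> where "\<G> = {U :: real set. open U \<and> (\<exists>p\<in>mspace m. \<forall>t\<in>{0..1} \<inter> U. mdist m p (g t) < 1/2)}"
  have cover: "{0..1} \<subseteq> \<Union>\<G>"
  proof
    fix t :: real assume t: "t \<in> {0..1}"
    have "openin (mtopology_of m) (mball_of m (g t) (1/2))"
      using Metric_space.openin_mball[OF Metric_space_mspace_mdist] by (simp add: mtopology_of_def mball_of_def)
    from openin_continuous_map_preimage[OF cont this]
    have "openin (top_of_set {0..1}) {s \<in> {0..1}. g s \<in> mball_of m (g t) (1/2)}"
      by (simp del: in_mball_of)
    then obtain U where U: "open U" "{s \<in> {0..1}. g s \<in> mball_of m (g t) (1/2)} = {0..1} \<inter> U"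
      by (auto simp: openin_open)
    have "\<forall>s\<in>{0..1} \<inter> U. mdist m (g t) (g s) < 1/2" unfolding U(2)[symmetric] by simp
    then have "U \<in> \<G>" unfolding \<G>_def using gin[OF t] U(1) by blast
    moreover have zero: "mdist m (g t) (g t) = 0" by (subst mdist_zero) (use gin[OF t] in auto)
    have "t \<in> {s \<in> {0..1}. g s \<in> mball_of m (g t) (1/2)}" using t gin[OF t] by (simp add: zero)
    then have "t \<in> U" unfolding U(2) by simp
    ultimately show "t \<in> \<Union>\<G>" by blast
  qed
  obtain e where e: "e > 0" "\<And>t. t \<in> {0..1} \<Longrightarrow> \<exists>G\<in>\<G>. ball t e \<subseteq> G"
    using Heine_Borel_lemma[OF compact_Icc cover] unfolding \<G>_def by blast
  obtain N where N: "N > 0" "1 / real N < e" using e(1) nat_approx_posE[of e] by (metis zero_less_Suc)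
  have "mdist m (g (real i / real N)) (g (real (Suc i) / real N)) \<le> 1" if i: "i < N" for i
  proof -
    let ?s = "real i / real N" and ?t = "real (Suc i) / real N"
    have st: "?s \<in> {0..1}" "?t \<in> {0..1}" using i by auto
    obtain G where G: "G \<in> \<G>" "ball ?s e \<subseteq> G" using e(2)[OF st(1)] by blast
    have "dist ?s ?t = 1 / real N" by (simp add: dist_real_def diff_divide_distrib[symmetric])
    then have "?s \<in> G" "?t \<in> G" using G(2) N(2) e(1) by auto
    then obtain p where p: "p \<in> mspace m" "mdist m p (g ?s) < 1/2" "mdist m p (g ?t) < 1/2"
      using G(1) st unfolding \<G>_def by blast
    have "mdist m (g ?s) (g ?t) \<le> mdist m (g ?s) p + mdist m p (g ?t)"
      using p gin st by (intro mdist_triangle) auto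
    then show ?thesis using p mdist_commute[of m p] by simp
  qed
  then show thesis using that N(1) by blast
qed

context vgraph
begin

text \<open>Walk length is charged to path length with factor 4. The radius 5 is 1 for rounding plus
  at most 4 along a geodesic between the rounded samples.\<close>

lemma walk_along_path:
  assumes g: "pathin (mtopology_of (submetric realisation Y)) g" and len: "path_length realisation g \<le> ennreal l" "0 \<le> l"
  obtains k where "real k \<le> 4 * l + 4"
    "(nearest_vertex (g 0), nearest_vertex (g 1)) \<in> (Restr E {w \<in> V. \<exists>t\<in>{0..1}. mdist realisation (vertex w) (g t) \<le> 5}) ^^ k"
proof -
  let ?Z = "{w \<in> V. \<exists>t\<in>{0..1}. mdist realisation (vertex w) (g t) \<le> 5}"
  obtain N where N: "N > 0" "\<And>i. i < N \<Longrightarrow> mdist realisation (g (real i / real N)) (g (real (Suc i) / real N)) \<le> 1"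
    using pathin_fine_partition[OF g] by auto
  define q where "q i = g (real i / real N)" for i
  have gin: "g t \<in> graph_points V E" if "t \<in> {0..1}" for t
    using path_image_subset_topspace[OF g] that by auto
  have qin: "q i \<in> graph_points V E" if "i \<le> N" for i using gin[of "real i / real N"] that N(1) by (simp add: q_def)
  define S where "S n = (\<Sum>i<n. mdist realisation (q i) (q (Suc i)))" for n
  have "ennreal (S N) \<le> ennreal l"
    using path_length_ge_partition[where N = N and m = realisation and g = g] len(1) by (simp add: S_def q_def sum_ennreal)
  then have SN: "S N \<le> l" using len(2) by simp
  have mono: "S i \<le> S j" if "i \<le> j" for i j
    unfolding S_def using that by (intro sum_mono2) auto
  have link: "(nearest_vertex (q i), nearest_vertex (q j)) \<in> (Restr E ?Z) ^^ d (nearest_vertex (q i)) (nearest_vertex (q j))"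
    if ij: "i \<le> N" "j \<le> N" "mdist realisation (q i) (q j) \<le> 2" for i j
  proof (rule interval_walk)
    have V: "nearest_vertex (q i) \<in> V" "nearest_vertex (q j) \<in> V" using nearest_vertex(1) qin ij by auto
    then show "nearest_vertex (q i) \<in> V" "nearest_vertex (q j) \<in> V" .
    have dd: "real (d (nearest_vertex (q i)) (nearest_vertex (q j))) \<le> 4" using d_nearest_vertex(1)[OF qin[OF ij(1)] qin[OF ij(2)]] ij by linarith
    show "interval (nearest_vertex (q i)) (nearest_vertex (q j)) \<subseteq> ?Z"
    proof
      fix w assume "w \<in> interval (nearest_vertex (q i)) (nearest_vertex (q j))"
      then have w: "w \<in> V" "d (nearest_vertex (q i)) w \<le> d (nearest_vertex (q i)) (nearest_vertex (q j))" by (auto simp: interval_def)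
      have "mdist realisation (q i) (vertex w) \<le> mdist realisation (q i) (vertex (nearest_vertex (q i))) + mdist realisation (vertex (nearest_vertex (q i))) (vertex w)"
        using w V qin ij by (intro mdist_triangle) auto
      also have "\<dots> \<le> 1 + 4"
        using nearest_vertex(2)[OF qin[OF ij(1)]] mdist_vertex[OF V(1) w(1)] w(2) dd by linarith
      finally have "mdist realisation (vertex w) (g (real i / real N)) \<le> 5" using mdist_commute[of realisation "vertex w"] by (simp add: q_def)
      then show "w \<in> ?Z" using w(1) ij N(1) by (intro CollectI conjI bexI[of _ "real i / real N"]) auto
    qed
  qed
  \<comment> \<open>Rounding costs up to 2 per step, so following every sample would make the walk
    depend on the fineness of the partition. The walk therefore waits at \<open>q j\<close> until
    the path has moved by more than 1; only then can the rounding error be charged to the length in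
    between.\<close>
  have "\<exists>j\<le>n. \<exists>k. real k \<le> 4 * S j \<and> (nearest_vertex (q 0), nearest_vertex (q j)) \<in> (Restr E ?Z) ^^ k \<and>
      mdist realisation (q j) (q n) \<le> 1 \<and> mdist realisation (q j) (q n) \<le> S n - S j" if "n \<le> N" for n
    using that
  proof (induction n)
    case 0
    show ?case using qin[of 0] by (intro exI[of _ 0]) (auto simp: S_def)
  next
    case (Suc n)
    then obtain j k where jk: "j \<le> n" "real k \<le> 4 * S j" "(nearest_vertex (q 0), nearest_vertex (q j)) \<in> (Restr E ?Z) ^^ k"
      "mdist realisation (q j) (q n) \<le> 1" "mdist realisation (q j) (q n) \<le> S n - S j" by auto
    have SS: "S (Suc n) = S n + mdist realisation (q n) (q (Suc n))" by (simp add: S_def)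
    have one: "mdist realisation (q n) (q (Suc n)) \<le> 1" using N(2)[of n] Suc.prems by (simp add: q_def)
    have tri: "mdist realisation (q j) (q (Suc n)) \<le> mdist realisation (q j) (q n) + mdist realisation (q n) (q (Suc n))"
      using qin jk Suc.prems by (intro mdist_triangle) auto
    show ?case
    proof (cases "mdist realisation (q j) (q (Suc n)) \<le> 1")
      case True
      then show ?thesis using jk tri SS by (intro exI[of _ j]) auto
    next
      case False
      let ?e = "d (nearest_vertex (q j)) (nearest_vertex (q (Suc n)))"
      have two: "mdist realisation (q j) (q (Suc n)) \<le> 2" using tri jk one by linarith
      have "real ?e \<le> mdist realisation (q j) (q (Suc n)) + 2" using d_nearest_vertex(1) qin jk Suc.prems by simp
      then have "real ?e \<le> 4 * mdist realisation (q j) (q (Suc n))" using False by linarith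
      then have "real (k + ?e) \<le> 4 * S (Suc n)" using jk tri SS by simp
      moreover have "(nearest_vertex (q 0), nearest_vertex (q (Suc n))) \<in> (Restr E ?Z) ^^ (k + ?e)"
        unfolding relpow_add using jk(3) link[of j "Suc n"] jk(1) Suc.prems two by auto
      ultimately show ?thesis
        using qin[OF Suc.prems] by (intro exI[of _ "Suc n"] conjI le_refl exI[of _ "k + ?e"]) auto
    qed
  qed
  from this[of N] obtain j k where jk: "j \<le> N" "real k \<le> 4 * S j" "(nearest_vertex (q 0), nearest_vertex (q j)) \<in> (Restr E ?Z) ^^ k"
    "mdist realisation (q j) (q N) \<le> 1" by auto
  let ?e = "d (nearest_vertex (q j)) (nearest_vertex (q N))"
  have "(nearest_vertex (q 0), nearest_vertex (q N)) \<in> (Restr E ?Z) ^^ (k + ?e)"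
    unfolding relpow_add using jk(3) link[of j N] jk(1,4) by auto
  moreover have "real ?e \<le> 4" using d_nearest_vertex(1)[OF qin[OF jk(1)] qin[of N]] jk(4) by simp
  then have "real (k + ?e) \<le> 4 * l + 4" using jk(2) mono[OF jk(1)] SN by simp
  moreover have "q 0 = g 0" "q N = g 1" using N(1) by (auto simp: q_def)
  ultimately show thesis using that[of "k + ?e"] by simp
qed

lemma induced_length_dist_le:
  assumes Y: "Y \<subseteq> graph_points V E" and j: "lip_joined Y p q l"
  shows "induced_length_dist realisation Y p q \<le> ennreal l"
proof -
  obtain c where c: "c 0 = p" "c l = q" "lip_curve Y c l" using j unfolding lip_joined_def by blast
  have l: "0 \<le> l" "c ` {0..l} \<subseteq> Y" using c(3) unfolding lip_curve_def by auto
  define g where "g t = c (l * t)" for t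
  have dom: "l * t \<in> {0..l}" if "t \<in> {0..1}" for t using that l by (auto simp: mult_left_le)
  have lip: "mdist realisation (g s) (g t) \<le> l * (t - s)" if "s \<in> {0..1}" "t \<in> {0..1}" "s \<le> t" for s t
    using lip_curveD[OF c(3), of "l * s" "l * t"] dom[OF that(1)] dom[OF that(2)] that l
    by (auto simp: g_def right_diff_distrib mult_left_mono)
  have lip': "mdist realisation (g s) (g t) \<le> l * dist s t" if "s \<in> {0..1}" "t \<in> {0..1}" for s t
  proof (cases "s \<le> t")
    case True
    then show ?thesis using lip[OF that] by (simp add: dist_real_def)
  next
    case False
    then show ?thesis using lip[OF that(2,1)] by (subst mdist_commute) (simp add: dist_real_def)
  qed
  have gY: "g t \<in> Y" if "t \<in> {0..1}" for t using dom[OF that] l(2) unfolding g_def by blast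
  have "Lipschitz_continuous_map (submetric euclidean_metric {0..1}) (submetric realisation Y) g"
    unfolding Lipschitz_continuous_map_def using gY Y lip' by (intro conjI exI[of _ l]) auto
  then have path: "pathin (mtopology_of (submetric realisation Y)) g"
    using Lipschitz_continuous_imp_continuous_map unfolding pathin_def
    by (metis mtopology_of_euclidean mtopology_of_submetric)
  have "path_length realisation g \<le> ennreal l"
    unfolding path_length_def
  proof (rule SUP_least)
    fix ts :: "real list" assume "ts \<in> {ts. sorted ts \<and> set ts \<subseteq> {0..1}}"
    then have ts: "sorted ts" "set ts \<subseteq> {0..1}" by auto
    show "(\<Sum>i<length ts - 1. ennreal (mdist realisation (g (ts ! i)) (g (ts ! Suc i)))) \<le> ennreal l"
    proof (cases "ts = []")
      case False
      have el: "ts ! i \<in> {0..1}" if "i < length ts" for i using ts(2) nth_mem[OF that] by blast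
      have "(\<Sum>i<length ts - 1. mdist realisation (g (ts ! i)) (g (ts ! Suc i))) \<le> (\<Sum>i<length ts - 1. l * (ts ! Suc i - ts ! i))"
        using ts(1) by (intro sum_mono lip el) (auto simp: sorted_iff_nth_mono)
      also have "\<dots> = l * (ts ! (length ts - 1) - ts ! 0)"
        by (simp only: sum_distrib_left[symmetric] sum_lessThan_telescope)
      also have "\<dots> \<le> l * 1"
        using el[of 0] el[of "length ts - 1"] False l(1) by (intro mult_left_mono) auto
      finally show ?thesis by (simp add: sum_ennreal ennreal_leI)
    qed simp
  qed
  moreover have "induced_length_dist realisation Y p q \<le> path_length realisation g"
    unfolding induced_length_dist_def using path c by (intro INF_lower) (auto simp: g_def)
  ultimately show ?thesis by (rule order.trans[rotated])
qed

text \<open>For \<rho> = 1 the finiteness condition and the infimum concern the same region, so the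
  given walk is both a witness of finiteness and a competitor for the infimum.\<close>

lemma superlinear_divergence_if_super_linear:
  assumes A: "A \<subseteq> V" "A \<noteq> {}" and sl: "completely_super_linear_family (lower_divergence realisation (vertex ` A))"
  shows "\<exists>n0. superlinear_divergence n0 A"
proof -
  obtain n0 where n0: "completely_super_linear (lower_divergence realisation (vertex ` A) n0 1)"
    using sl unfolding completely_super_linear_family_def by (metis order.refl zero_less_one)
  have "\<exists>r0. \<forall>r>r0. \<forall>x\<in>V. \<forall>y\<in>V. \<forall>k. height A x = r \<and> height A y = r \<and> n0 * r \<le> d x y \<and>
     (x, y) \<in> (Restr E {w. r \<le> height A w}) ^^ k \<longrightarrow> C * r < k" for C
  proof -
    \<comment> \<open>\<open>C\<close> may be 0, whereas complete super linearity speaks about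
      positive slopes.\<close>
    have "bounded {x. 0 \<le> x \<and> lower_divergence realisation (vertex ` A) n0 1 x \<le> ennreal (real (C + 1) * x)}"
      using n0 unfolding completely_super_linear_def by (metis add_is_0 gr0I of_nat_0_less_iff one_neq_zero)
    then obtain b where b: "\<And>x. 0 \<le> x \<Longrightarrow> lower_divergence realisation (vertex ` A) n0 1 x \<le> ennreal (real (C + 1) * x) \<Longrightarrow> \<bar>x\<bar> \<le> b"
      unfolding bounded_iff by auto
    have "C * r < k" if r: "r > nat \<lceil>b\<rceil>" and xy: "x \<in> V" "y \<in> V" "height A x = r" "height A y = r" "n0 * r \<le> d x y"
      and path: "(x, y) \<in> (Restr E {w. r \<le> height A w}) ^^ k" for r x y k
    proof -
      define Y where "Y = mspace realisation - nbhd realisation (real r) (vertex ` A)"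
      have "lip_joined Y (vertex x) (vertex y) (real k)"
      proof (rule lip_joined_relpow[OF _ _ _ path])
        show "vertex x \<in> Y" using dist_to_set_vertex[OF A xy(1)] xy by (simp add: Y_def nbhd_def)
        fix a b t assume ab: "(a, b) \<in> Restr E {w. r \<le> height A w}" "t \<in> {0..1::real}"
        then have "real r \<le> dist_to_set realisation (edge_point a b t) (vertex ` A)"
          by (intro dist_to_set_edge_ge[OF A]) auto
        then show "edge_point a b t \<in> Y" using ab edge_point_in by (auto simp: Y_def nbhd_def)
      qed (auto simp: Y_def)
      then have le: "induced_length_dist realisation Y (vertex x) (vertex y) \<le> ennreal (real k)"
        by (intro induced_length_dist_le) (auto simp: Y_def)
      have "lower_divergence realisation (vertex ` A) n0 1 (real r) \<le> induced_length_dist realisation Y (vertex x) (vertex y)"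
        unfolding lower_divergence_def
      proof (rule INF_lower2[of "(vertex x, vertex y)"])
        have "real (n0 * r) \<le> real (d x y)" using xy(5) by (simp only: of_nat_le_iff)
        moreover have "induced_length_dist realisation Y (vertex x) (vertex y) < \<infinity>" using le by (auto intro: le_less_trans)
        ultimately show "(vertex x, vertex y) \<in> {(x, y). x \<in> nbhd_boundary realisation (real r) (vertex ` A) \<and> y \<in> nbhd_boundary realisation (real r) (vertex ` A) \<and>
            induced_length_dist realisation (mspace realisation - nbhd realisation (real r) (vertex ` A)) x y < \<infinity> \<and> real n0 * real r \<le> mdist realisation x y}"
          using xy dist_to_set_vertex[OF A] mdist_vertex[OF xy(1,2)] by (simp add: nbhd_boundary_def Y_def)
      qed (simp add: Y_def)
      moreover have "\<not> lower_divergence realisation (vertex ` A) n0 1 (real r) \<le> ennreal (real (C + 1) * real r)"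
        using b[of "real r"] r by linarith
      ultimately have "ennreal (real (C + 1) * real r) < ennreal (real k)" using le by (meson le_less_trans not_le order.trans)
      then have "real (C + 1) * real r < real k" by (subst (asm) ennreal_less_iff) auto
      then have "(C + 1) * r < k" unfolding of_nat_mult[symmetric] of_nat_less_iff .
      then show ?thesis by simp
    qed
    then show ?thesis by blast
  qed
  then show ?thesis unfolding superlinear_divergence_def by blast
qed

text \<open>The index 3 works for all \<rho> at once; \<rho> only influences the height factor
  \<open>q\<close>.\<close>

lemma super_linear_if_discretely_quasiconvex:
  assumes A: "A \<subseteq> V" "A \<noteq> {}" and qc: "discretely_quasiconvex A"
  shows "completely_super_linear_family (lower_divergence realisation (vertex ` A))"
  unfolding completely_super_linear_family_def completely_super_linear_def
proof (intro exI[of _ 3] conjI allI impI)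
  fix \<rho> C :: real assume \<rho>: "0 < \<rho> \<and> \<rho> \<le> 1" and C: "0 < C"
  \<comment> \<open>The factor 2 is a reserve: along the walk \<open>q\<close> times the height is
    at least \<open>2 * r - 5 * q\<close>, which is still at least \<open>r + 1\<close> for large
    \<open>r\<close>.\<close>
  define q where "q = nat \<lceil>2 / \<rho>\<rceil>"
  have q2: "2 / \<rho> \<le> real q" unfolding q_def by linarith
  then have q: "2 \<le> real q * \<rho>" using \<rho> by (simp add: pos_divide_le_eq)
  then have "q > 0" by (cases q) auto
  \<comment> \<open>A path of length at most \<open>C * r + 1\<close> becomes a walk of length at
    most \<open>4 * (C * r + 1) + 4\<close>, and this is at most \<open>(4 * C + 8) * r\<close> once
    \<open>r \<ge> 1\<close>.\<close>
  define C' where "C' = nat \<lceil>4 * C + 8\<rceil>"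
  have C': "4 * C + 8 \<le> real C'" unfolding C'_def by linarith
  obtain r0 where r0: "\<And>r x y k. \<lbrakk>r > r0; x \<in> V; y \<in> V; height A x \<le> r + 1; height A y \<le> r + 1; 3 * r \<le> d x y + 5;
     (x, y) \<in> (Restr E {w. r \<le> q * height A w}) ^^ k\<rbrakk> \<Longrightarrow> C' * r < k"
    using discretely_quasiconvex_imp_divergence[OF A qc \<open>q > 0\<close>, of C'] by blast
  define b where "b = max (real r0 + 1) (5 * real q + 1)"
  let ?\<sigma> = "lower_divergence realisation (vertex ` A) 3 \<rho>"
  have "\<bar>r\<bar> \<le> b" if r: "0 \<le> r" "?\<sigma> r \<le> ennreal (C * r)" for r
  proof (rule ccontr)
    assume "\<not> \<bar>r\<bar> \<le> b"
    then have big: "r > real r0 + 1" "r > 5 * real q + 1" using r(1) by (auto simp: b_def)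
    then have r1: "r \<ge> 1" by simp
    \<comment> \<open>The infima need not be attained; the additional 1 makes the bound strict and
      yields an actual pair of points and an actual path.\<close>
    have "ennreal (C * r) < ennreal (C * r + 1)" using C r(1) by (simp add: ennreal_less_iff)
    then have "?\<sigma> r < ennreal (C * r + 1)" using r(2) by (rule le_less_trans[rotated])
    then obtain x y where xy: "x \<in> nbhd_boundary realisation r (vertex ` A)" "y \<in> nbhd_boundary realisation r (vertex ` A)" "3 * r \<le> mdist realisation x y"
      and ind: "induced_length_dist realisation (mspace realisation - nbhd realisation (\<rho> * r) (vertex ` A)) x y < ennreal (C * r + 1)"
      unfolding lower_divergence_def INF_less_iff by auto
    define Y where "Y = mspace realisation - nbhd realisation (\<rho> * r) (vertex ` A)"
    from ind obtain g where g: "pathin (mtopology_of (submetric realisation Y)) g" "g 0 = x" "g 1 = y"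
      and len: "path_length realisation g < ennreal (C * r + 1)"
      unfolding induced_length_dist_def INF_less_iff Y_def by auto
    define Z where "Z = {w \<in> V. \<exists>t\<in>{0..1}. mdist realisation (vertex w) (g t) \<le> 5}"
    have "0 \<le> C * r + 1" using C r(1) by simp
    obtain k where k: "real k \<le> 4 * (C * r + 1) + 4" "(nearest_vertex x, nearest_vertex y) \<in> (Restr E Z) ^^ k"
      using walk_along_path[OF g(1) less_imp_le[OF len] \<open>0 \<le> C * r + 1\<close>] unfolding g(2,3) Z_def by blast
    define R where "R = nat \<lceil>r\<rceil>"
    have R: "r \<le> real R" "real R < r + 1" using r(1) unfolding R_def by linarith+
    have xy_in: "x \<in> graph_points V E" "y \<in> graph_points V E"
      and xy_d: "dist_to_set realisation x (vertex ` A) = r" "dist_to_set realisation y (vertex ` A) = r"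
      using xy by (auto simp: nbhd_boundary_def)
    have low: "height A (nearest_vertex z) \<le> R + 1" if "z \<in> graph_points V E" "dist_to_set realisation z (vertex ` A) = r" for z
    proof -
      have "dist_to_set realisation (vertex (nearest_vertex z)) (vertex ` A) \<le> mdist realisation (vertex (nearest_vertex z)) z + dist_to_set realisation z (vertex ` A)"
        using that nearest_vertex(1)[OF that(1)] A by (intro dist_to_set_Lipschitz) auto
      moreover have "mdist realisation (vertex (nearest_vertex z)) z \<le> 1" using nearest_vertex(2)[OF that(1)] mdist_commute by metis
      ultimately have "real (height A (nearest_vertex z)) \<le> 1 + real R"
        using dist_to_set_vertex[OF A nearest_vertex(1)[OF that(1)]] that(2) R by linarith
      then show ?thesis by linarith
    qed
    have "mdist realisation x y \<le> real (d (nearest_vertex x) (nearest_vertex y)) + 2" using d_nearest_vertex(2)[OF xy_in] .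
    \<comment> \<open>The 5 consists of 3 for rounding the radius up and 2 for rounding the two
      points to vertices.\<close>
    then have "3 * real R \<le> real (d (nearest_vertex x) (nearest_vertex y)) + 5" using xy(3) R by linarith
    then have far: "3 * R \<le> d (nearest_vertex x) (nearest_vertex y) + 5" by linarith
    have high: "R \<le> q * height A w" if "w \<in> Z" for w
    proof -
      obtain t where t: "w \<in> V" "t \<in> {0..1}" "mdist realisation (vertex w) (g t) \<le> 5" using \<open>w \<in> Z\<close> by (auto simp: Z_def)
      have gt: "g t \<in> Y" using path_image_subset_topspace[OF g(1)] t(2) by auto
      then have "\<rho> * r \<le> dist_to_set realisation (g t) (vertex ` A)" by (auto simp: Y_def nbhd_def not_less)
      also have "\<dots> \<le> mdist realisation (g t) (vertex w) + dist_to_set realisation (vertex w) (vertex ` A)"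
        using gt t A by (intro dist_to_set_Lipschitz) (auto simp: Y_def)
      also have "\<dots> \<le> 5 + real (height A w)"
        using t dist_to_set_vertex[OF A t(1)] mdist_commute[of realisation "g t"] by simp
      finally have "real q * (\<rho> * r) \<le> real q * (5 + real (height A w))" by (intro mult_left_mono) auto
      moreover have "2 * r \<le> (real q * \<rho>) * r" using q r(1) by (rule mult_right_mono)
      moreover have "real q * (\<rho> * r) = (real q * \<rho>) * r" by simp
      ultimately have "r + 1 \<le> real q * real (height A w)" using big(2) unfolding distrib_left by linarith
      then have "real R \<le> real (q * height A w)" using R by simp
      then show ?thesis by (simp only: of_nat_le_iff)
    qed
    have "(nearest_vertex x, nearest_vertex y) \<in> (Restr E {w. R \<le> q * height A w}) ^^ k"
      using k(2) high unfolding relpow_fun_conv by (elim exE, intro exI) auto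
    then have "C' * R < k"
      using r0[of R "nearest_vertex x" "nearest_vertex y" k] big(1) R nearest_vertex(1) xy_in low xy_d far by simp
    then have "real C' * real R < real k" by (simp flip: of_nat_mult)
    moreover have "(4 * C + 8) * r \<le> real C' * real R" using C' R r(1) by (intro mult_mono) auto
    moreover have "4 * (C * r + 1) + 4 \<le> (4 * C + 8) * r" using r1 by (simp add: algebra_simps)
    ultimately show False using k(1) by linarith
  qed
  then show "bounded {x. 0 \<le> x \<and> ?\<sigma> x \<le> ennreal (C * x)}"
    unfolding bounded_iff by (intro exI[of _ b]) auto
qed simp

end

section \<open>Stability and subgraphs\<close>

text \<open>\<open>F\<close> is a graph structure of its own on \<open>H\<close>, not the one
  induced by \<open>E\<close>. The two inequalities say that the inclusion of vertices is a
  quasi-isometric embedding, with the same constants in both directions.\<close>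

locale comparable_graphs = A: vgraph V E + B: vgraph H F for V :: "'a set" and E and H :: "'a set" and F +
  fixes c0 e0 :: nat
  assumes H_sub: "H \<subseteq> V"
    and A_le: "\<lbrakk>x \<in> H; y \<in> H\<rbrakk> \<Longrightarrow> A.d x y \<le> c0 * B.d x y + e0"
    and B_le: "\<lbrakk>x \<in> H; y \<in> H\<rbrakk> \<Longrightarrow> B.d x y \<le> c0 * A.d x y + e0"
begin

lemma A_discrete_qg:
  assumes v: "B.discrete_qg K L N v"
  shows "A.discrete_qg (c0 * K) (c0 * L + K * e0 + e0 + L) N v"
proof (rule A.dqgI)
  show "v i \<in> V" if "i \<le> N" for i using B.dqgD(1)[OF v that] H_sub by blast
  fix i j assume ij: "i \<le> j" "j \<le> N"
  have V: "v i \<in> H" "v j \<in> H" using B.dqgD(1)[OF v] ij by auto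
  have "c0 * B.d (v i) (v j) \<le> c0 * (K * (j - i) + L)" using B.dqgD(2)[OF v ij] by (rule mult_le_mono2)
  then show "A.d (v i) (v j) \<le> c0 * K * (j - i) + (c0 * L + K * e0 + e0 + L)"
    using A_le[OF V] by (simp add: algebra_simps)
  have "K * B.d (v i) (v j) \<le> K * (c0 * A.d (v i) (v j) + e0)" using B_le[OF V] by (rule mult_le_mono2)
  then show "j - i \<le> c0 * K * A.d (v i) (v j) + (c0 * L + K * e0 + e0 + L)"
    using B.dqgD(3)[OF v ij] by (simp add: algebra_simps)
qed

lemma B_discrete_qg:
  assumes v: "A.discrete_qg K L N v" and H: "\<And>i. i \<le> N \<Longrightarrow> v i \<in> H"
  shows "B.discrete_qg (c0 * K) (c0 * L + K * e0 + e0 + L) N v"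
proof (rule B.dqgI)
  fix i j assume ij: "i \<le> j" "j \<le> N"
  have V: "v i \<in> H" "v j \<in> H" using H ij by auto
  have "c0 * A.d (v i) (v j) \<le> c0 * (K * (j - i) + L)" using A.dqgD(2)[OF v ij] by (rule mult_le_mono2)
  then show "B.d (v i) (v j) \<le> c0 * K * (j - i) + (c0 * L + K * e0 + e0 + L)"
    using B_le[OF V] by (simp add: algebra_simps)
  have "K * A.d (v i) (v j) \<le> K * (c0 * B.d (v i) (v j) + e0)" using A_le[OF V] by (rule mult_le_mono2)
  then show "j - i \<le> c0 * K * B.d (v i) (v j) + (c0 * L + K * e0 + e0 + L)"
    using A.dqgD(3)[OF v ij] by (simp add: algebra_simps)
qed (rule H)

text \<open>A geodesic of \<open>H\<close> with the same end points is a quasi-geodesic of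
  \<open>G\<close> that lies in \<open>H\<close>; stability keeps every other quasi-geodesic close
  to it.\<close>

lemma discretely_quasiconvex_if_discretely_stable:
  assumes "A.discretely_stable H"
  shows "A.discretely_quasiconvex H"
  unfolding A.discretely_quasiconvex_def
proof (intro allI)
  fix K L
  \<comment> \<open>These constants cover both the given quasi-geodesic and a geodesic of
    \<open>H\<close>, which in \<open>G\<close> has constants \<open>c0\<close> and
    \<open>2 * e0\<close>.\<close>
  define K' where "K' = K + c0"
  define L' where "L' = L + e0 + e0"
  from assms obtain R where R: "\<forall>N v N' v'. A.discrete_qg K' L' N v \<and> A.discrete_qg K' L' N' v' \<and> v 0 = v' 0 \<and> v N = v' N' \<and>
     v 0 \<in> H \<and> v N \<in> H \<longrightarrow> (\<forall>i\<le>N. \<exists>j\<le>N'. A.d (v i) (v' j) \<le> R)"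
    unfolding A.discretely_stable_def by blast
  have "A.height H (v i) \<le> R" if v: "A.discrete_qg K L N v" "v 0 \<in> H" "v N \<in> H" and i: "i \<le> N" for N v i
  proof -
    obtain f where f: "B.discrete_geodesic (B.d (v 0) (v N)) f" "f 0 = v 0" "f (B.d (v 0) (v N)) = v N"
      by (rule B.discrete_geodesic_ex[OF v(2,3)], rule that) blast+
    have fq: "A.discrete_qg K' L' (B.d (v 0) (v N)) f"
      using A.discrete_qg_mono[OF A_discrete_qg[OF B.geodesic_qg[OF f(1)]]] unfolding K'_def L'_def by simp
    have vq: "A.discrete_qg K' L' N v" using A.discrete_qg_mono[OF v(1)] unfolding K'_def L'_def by simp
    obtain j where j: "j \<le> B.d (v 0) (v N)" "A.d (v i) (f j) \<le> R"
      using R[rule_format, of N v "B.d (v 0) (v N)" f i] vq fq f v i by auto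
    have "f j \<in> H" using f(1) j(1) unfolding B.discrete_geodesic_def by blast
    from A.height_le[OF this, of "v i"] j(2) show ?thesis by linarith
  qed
  then show "\<exists>M. \<forall>N v. A.discrete_qg K L N v \<and> v 0 \<in> H \<and> v N \<in> H \<longrightarrow> (\<forall>i\<le>N. A.height H (v i) \<le> M)" by blast
qed

lemma thin_bigons_if_discretely_stable:
  assumes "A.discretely_stable H"
  shows "B.thin_bigons"
  unfolding B.thin_bigons_def
proof (intro allI)
  fix K L
  define K' where "K' = c0 * K"
  define L' where "L' = c0 * L + K * e0 + e0 + L"
  from assms obtain R where R: "\<forall>N v N' v'. A.discrete_qg K' L' N v \<and> A.discrete_qg K' L' N' v' \<and> v 0 = v' 0 \<and> v N = v' N' \<and>
     v 0 \<in> H \<and> v N \<in> H \<longrightarrow> (\<forall>i\<le>N. \<exists>j\<le>N'. A.d (v i) (v' j) \<le> R)"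
    unfolding A.discretely_stable_def by blast
  have "\<exists>j\<le>N'. B.d (v i) (v' j) \<le> c0 * R + e0"
    if v: "B.discrete_qg K L N v" "B.discrete_qg K L N' v'" "v 0 = v' 0" "v N = v' N'" "i \<le> N" for N v N' v' i
  proof -
    have vH: "v i \<in> H" if "i \<le> N" for i using B.dqgD(1)[OF v(1) that] .
    obtain j where j: "j \<le> N'" "A.d (v i) (v' j) \<le> R"
      using R[rule_format, of N v N' v' i] A_discrete_qg[OF v(1)] A_discrete_qg[OF v(2)] v(3-5) vH[of 0] vH[of N] unfolding K'_def L'_def by auto
    have "c0 * A.d (v i) (v' j) \<le> c0 * R" using j(2) by (rule mult_le_mono2)
    then show ?thesis
      using B_le[OF vH[OF v(5)] B.dqgD(1)[OF v(2) j(1)]] j(1) by (intro exI[of _ j]) linarith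
  qed
  then show "\<exists>R. \<forall>N v N' v'. B.discrete_qg K L N v \<and> B.discrete_qg K L N' v' \<and> v 0 = v' 0 \<and> v N = v' N' \<longrightarrow>
     (\<forall>i\<le>N. \<exists>j\<le>N'. B.d (v i) (v' j) \<le> R)" by blast
qed

end

section \<open>Nearest-point projection to a set of vertices\<close>

context vgraph
begin

definition proj :: "'a set \<Rightarrow> 'a \<Rightarrow> 'a" where
  "proj A v = (SOME a. a \<in> A \<and> d v a = height A v)"

lemma proj:
  assumes "A \<noteq> {}"
  shows "proj A v \<in> A" "d v (proj A v) = height A v"
proof -
  have "\<exists>a. a \<in> A \<and> d v a = height A v" using height_attained[OF assms, of v] by blast
  from someI_ex[OF this] show "proj A v \<in> A" "d v (proj A v) = height A v" unfolding proj_def by auto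
qed

lemma proj_id:
  assumes "A \<subseteq> V" "a \<in> A"
  shows "proj A a = a"
proof -
  have ne: "A \<noteq> {}" using assms by blast
  have "height A a = 0" using height_le[OF assms(2), of a] by simp
  then have "d a (proj A a) = 0" using proj(2)[OF ne, of a] by simp
  moreover have "a \<in> V" "proj A a \<in> V" using proj(1)[OF ne, of a] assms by auto
  ultimately show ?thesis using d_eq_0 by metis
qed

lemma d_proj:
  assumes A: "A \<subseteq> V" "A \<noteq> {}" and V: "u \<in> V" "v \<in> V" and M: "height A u \<le> M" "height A v \<le> M"
  shows "d (proj A u) (proj A v) \<le> d u v + 2 * M" "d u v \<le> d (proj A u) (proj A v) + 2 * M"
proof -
  have P: "proj A u \<in> V" "proj A v \<in> V" using proj(1)[OF A(2)] A(1) by auto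
  have "d (proj A u) (proj A v) \<le> d (proj A u) u + d u (proj A v)" by (rule d_triangle[OF P(1) V(1) P(2)])
  moreover have "d u (proj A v) \<le> d u v + d v (proj A v)" by (rule d_triangle[OF V P(2)])
  moreover have "d u v \<le> d u (proj A u) + d (proj A u) v" by (rule d_triangle[OF V(1) P(1) V(2)])
  moreover have "d (proj A u) v \<le> d (proj A u) (proj A v) + d (proj A v) v" by (rule d_triangle[OF P V(2)])
  moreover have "d (proj A u) u \<le> M" "d (proj A v) v \<le> M" "d u (proj A u) \<le> M" "d v (proj A v) \<le> M"
    using proj(2)[OF A(2)] M d_sym[OF V(1) P(1)] d_sym[OF V(2) P(2)] by auto
  ultimately show "d (proj A u) (proj A v) \<le> d u v + 2 * M" "d u v \<le> d (proj A u) (proj A v) + 2 * M"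
    by linarith+
qed

lemma discrete_qg_proj:
  assumes A: "A \<subseteq> V" "A \<noteq> {}" and v: "discrete_qg K L N v" and M: "\<And>i. i \<le> N \<Longrightarrow> height A (v i) \<le> M"
  shows "discrete_qg K (L + 2 * M + K * (2 * M)) N (\<lambda>i. proj A (v i))"
proof (rule dqgI)
  show "proj A (v i) \<in> V" for i using proj(1)[OF A(2)] A(1) by blast
  fix i j assume ij: "i \<le> j" "j \<le> N"
  have V: "v i \<in> V" "v j \<in> V" and Mij: "height A (v i) \<le> M" "height A (v j) \<le> M" using dqgD(1)[OF v] M ij by auto
  note P = d_proj[OF A V Mij]
  show "d (proj A (v i)) (proj A (v j)) \<le> K * (j - i) + (L + 2 * M + K * (2 * M))"
    using P(1) dqgD(2)[OF v ij] by linarith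
  have "K * d (v i) (v j) \<le> K * (d (proj A (v i)) (proj A (v j)) + 2 * M)" using P(2) by (rule mult_le_mono2)
  then show "j - i \<le> K * d (proj A (v i)) (proj A (v j)) + (L + 2 * M + K * (2 * M))"
    using dqgD(3)[OF v ij] unfolding distrib_left by linarith
qed

end

context comparable_graphs
begin

text \<open>Quasiconvexity gives one \<open>M\<close> for both sides of the bigon. Common end points
  have the same projection, so the projected sides again form a bigon, and returning from it costs
  \<open>2 * M\<close>.\<close>

lemma discretely_stable_if_thin_bigons:
  assumes qc: "A.discretely_quasiconvex H" and "B.thin_bigons"
  shows "A.discretely_stable H"
  unfolding A.discretely_stable_def
proof (intro allI)
  fix K L
  obtain M where M: "\<And>N v i. \<lbrakk>A.discrete_qg K L N v; v 0 \<in> H; v N \<in> H; i \<le> N\<rbrakk> \<Longrightarrow> A.height H (v i) \<le> M"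
    using qc unfolding A.discretely_quasiconvex_def by meson
  define L1 where "L1 = L + 2 * M + K * (2 * M)"
  define K' where "K' = c0 * K"
  define L' where "L' = c0 * L1 + K * e0 + e0 + L1"
  from \<open>B.thin_bigons\<close> obtain R where R: "\<forall>N v N' v'. B.discrete_qg K' L' N v \<and> B.discrete_qg K' L' N' v' \<and> v 0 = v' 0 \<and> v N = v' N' \<longrightarrow>
     (\<forall>i\<le>N. \<exists>j\<le>N'. B.d (v i) (v' j) \<le> R)"
    unfolding B.thin_bigons_def by blast
  have "\<exists>j\<le>N'. A.d (v i) (v' j) \<le> c0 * R + e0 + 2 * M"
    if v: "A.discrete_qg K L N v" "A.discrete_qg K L N' v'" "v 0 = v' 0" "v N = v' N'" "v 0 \<in> H" "v N \<in> H" "i \<le> N" for N v N' v' i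
  proof -
    have ne: "H \<noteq> {}" using v(5) by blast
    have Mv: "A.height H (v i) \<le> M" if "i \<le> N" for i using M[OF v(1,5,6) that] .
    have Mv': "A.height H (v' i) \<le> M" if "i \<le> N'" for i using M[OF v(2) _ _ that] v by simp
    define u u' where "u i = A.proj H (v i)" and "u' i = A.proj H (v' i)" for i
    have uH: "u i \<in> H" "u' i \<in> H" for i unfolding u_def u'_def using A.proj(1)[OF ne] by auto
    have q: "A.discrete_qg K L1 N u" "A.discrete_qg K L1 N' u'"
      unfolding u_def u'_def L1_def using A.discrete_qg_proj[OF H_sub ne v(1) Mv] A.discrete_qg_proj[OF H_sub ne v(2) Mv'] by auto
    have "B.discrete_qg K' L' N u" "B.discrete_qg K' L' N' u'" unfolding K'_def L'_def using B_discrete_qg[OF q(1)] B_discrete_qg[OF q(2)] uH by auto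
    moreover have "u 0 = u' 0" "u N = u' N'" unfolding u_def u'_def using v(3,4) by auto
    ultimately obtain j where j: "j \<le> N'" "B.d (u i) (u' j) \<le> R" using R v(7) by blast
    have "c0 * B.d (u i) (u' j) \<le> c0 * R" using j(2) by (rule mult_le_mono2)
    then have "A.d (u i) (u' j) \<le> c0 * R + e0" using A_le[OF uH] le_trans add_le_mono1 by blast
    moreover have "A.d (v i) (v' j) \<le> A.d (u i) (u' j) + 2 * M"
      unfolding u_def u'_def
      by (rule A.d_proj(2)[OF H_sub ne A.dqgD(1)[OF v(1,7)] A.dqgD(1)[OF v(2) j(1)] Mv[OF v(7)] Mv'[OF j(1)]])
    ultimately show ?thesis using j(1) by (intro exI[of _ j]) linarith
  qed
  then show "\<exists>R. \<forall>N v N' v'. A.discrete_qg K L N v \<and> A.discrete_qg K L N' v' \<and> v 0 = v' 0 \<and> v N = v' N' \<and>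
     v 0 \<in> H \<and> v N \<in> H \<longrightarrow> (\<forall>i\<le>N. \<exists>j\<le>N'. A.d (v i) (v' j) \<le> R)" by blast
qed

end

section \<open>Cayley graphs\<close>

lemma vgraph_cayley:
  assumes "group G" and gen: "finite_generating_set G S"
  shows "vgraph (carrier G) (cayley_edges G S)"
proof
  interpret group G by fact
  let ?E = "cayley_edges G S"
  have S: "S \<subseteq> carrier G" and genS: "generate G S = carrier G"
    using gen by (auto simp: finite_generating_set_def)
  show "?E \<subseteq> carrier G \<times> carrier G" "sym ?E" "(u, u) \<notin> ?E" for u
    by (auto simp: cayley_edges_def sym_def)
  have edge: "(g, g \<otimes>\<^bsub>G\<^esub> s) \<in> ?E\<^sup>*" "(g \<otimes>\<^bsub>G\<^esub> s, g) \<in> ?E\<^sup>*"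
    if "s \<in> S" "g \<in> carrier G" for g s
  proof -
    have "s \<in> carrier G" using that S by blast
    then have "(g, g \<otimes>\<^bsub>G\<^esub> s) \<in> ?E \<and> (g \<otimes>\<^bsub>G\<^esub> s, g) \<in> ?E" if "g \<noteq> g \<otimes>\<^bsub>G\<^esub> s"
      unfolding cayley_edges_def using \<open>g \<in> carrier G\<close> \<open>s \<in> S\<close> that
      by (metis (mono_tags, lifting) case_prodI m_closed mem_Collect_eq)
    then show "(g, g \<otimes>\<^bsub>G\<^esub> s) \<in> ?E\<^sup>*" "(g \<otimes>\<^bsub>G\<^esub> s, g) \<in> ?E\<^sup>*"
      by (metis r_into_rtrancl rtrancl.rtrancl_refl)+
  qed
  have right: "(g, g \<otimes>\<^bsub>G\<^esub> h) \<in> ?E\<^sup>*" if "h \<in> generate G S" "g \<in> carrier G" for g h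
    using that
  proof (induction arbitrary: g)
    case (inv s)
    then have s: "s \<in> carrier G" using S by blast
    then have "g \<otimes>\<^bsub>G\<^esub> inv\<^bsub>G\<^esub> s \<otimes>\<^bsub>G\<^esub> s = g" using inv.prems by (simp add: m_assoc)
    then show ?case using edge(2)[of s "g \<otimes>\<^bsub>G\<^esub> inv\<^bsub>G\<^esub> s"] inv s by simp
  next
    case (eng h1 h2)
    then have h: "h1 \<in> carrier G" "h2 \<in> carrier G" using genS by auto
    have "(g \<otimes>\<^bsub>G\<^esub> h1, g \<otimes>\<^bsub>G\<^esub> h1 \<otimes>\<^bsub>G\<^esub> h2) \<in> ?E\<^sup>*"
      using eng.IH(2)[of "g \<otimes>\<^bsub>G\<^esub> h1"] eng.prems h by simp
    then show ?case using eng.IH(1)[OF eng.prems] m_assoc[OF eng.prems h] by simp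
  qed (auto intro: edge)
  fix u v assume uv: "u \<in> carrier G" "v \<in> carrier G"
  then have "u \<otimes>\<^bsub>G\<^esub> (inv\<^bsub>G\<^esub> u \<otimes>\<^bsub>G\<^esub> v) = v"
    using m_assoc[of u "inv\<^bsub>G\<^esub> u" v] by simp
  then show "(u, v) \<in> ?E\<^sup>*" using right[of "inv\<^bsub>G\<^esub> u \<otimes>\<^bsub>G\<^esub> v" u] genS uv by simp
qed

lemma cayley_graph_eq_realisation:
  assumes "group G" "finite_generating_set G S"
  shows "cayley_graph G S = vgraph.realisation (carrier G) (cayley_edges G S)"
  unfolding cayley_graph_def vgraph.realisation_def[OF vgraph_cayley[OF assms]] ..

text \<open>Generators act on the right, so left multiplication maps edges to edges. It transports
  estimates at the identity to all vertices.\<close>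

lemma cayley_d_left_mult_le:
  assumes "group G" and S: "finite_generating_set G S"
    and g: "g \<in> carrier G" and uv: "u \<in> carrier G" "v \<in> carrier G"
  shows "vgraph.d (cayley_edges G S) (g \<otimes>\<^bsub>G\<^esub> u) (g \<otimes>\<^bsub>G\<^esub> v) \<le> vgraph.d (cayley_edges G S) u v"
proof -
  interpret group G by fact
  interpret vgraph "carrier G" "cayley_edges G S" by (rule vgraph_cayley) fact+
  have edge: "(g \<otimes>\<^bsub>G\<^esub> x, g \<otimes>\<^bsub>G\<^esub> y) \<in> cayley_edges G S" if "(x, y) \<in> cayley_edges G S" for x y
  proof -
    have xy: "x \<in> carrier G" "y \<in> carrier G" "x \<noteq> y" "\<exists>s\<in>S. y = x \<otimes>\<^bsub>G\<^esub> s \<or> x = y \<otimes>\<^bsub>G\<^esub> s"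
      using that by (auto simp: cayley_edges_def)
    have S': "S \<subseteq> carrier G" using S by (simp add: finite_generating_set_def)
    then have "\<exists>s\<in>S. g \<otimes>\<^bsub>G\<^esub> y = g \<otimes>\<^bsub>G\<^esub> x \<otimes>\<^bsub>G\<^esub> s \<or> g \<otimes>\<^bsub>G\<^esub> x = g \<otimes>\<^bsub>G\<^esub> y \<otimes>\<^bsub>G\<^esub> s"
      using xy g m_assoc by (metis subsetD)
    then show ?thesis using xy g by (simp add: cayley_edges_def)
  qed
  have "(g \<otimes>\<^bsub>G\<^esub> x, g \<otimes>\<^bsub>G\<^esub> y) \<in> cayley_edges G S ^^ n" if "(x, y) \<in> cayley_edges G S ^^ n" for x y n
    using that edge by (induction n arbitrary: y) auto
  then show ?thesis using d_relpow[OF uv] d_le by blast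
qed

lemma finite_cayley_ball:
  assumes "group G" and S: "finite_generating_set G S" and u: "u \<in> carrier G"
  shows "finite {v \<in> carrier G. vgraph.d (cayley_edges G S) u v \<le> n}"
proof -
  interpret group G by fact
  interpret vgraph "carrier G" "cayley_edges G S" by (rule vgraph_cayley) fact+
  have S': "S \<subseteq> carrier G" "finite S" using S by (auto simp: finite_generating_set_def)
  have nbrs: "finite (cayley_edges G S `` {x})" for x
  proof (rule finite_subset)
    show "cayley_edges G S `` {x} \<subseteq> (\<lambda>s. x \<otimes>\<^bsub>G\<^esub> s) ` S \<union> (\<lambda>s. x \<otimes>\<^bsub>G\<^esub> inv\<^bsub>G\<^esub> s) ` S"
    proof
      fix y assume "y \<in> cayley_edges G S `` {x}"
      then obtain s where s: "s \<in> S" "y = x \<otimes>\<^bsub>G\<^esub> s \<or> x = y \<otimes>\<^bsub>G\<^esub> s" "x \<in> carrier G" "y \<in> carrier G"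
        by (auto simp: cayley_edges_def)
      then have "y = x \<otimes>\<^bsub>G\<^esub> s \<or> y = x \<otimes>\<^bsub>G\<^esub> inv\<^bsub>G\<^esub> s" using S' inv_solve_right by (metis subsetD)
      then show "y \<in> (\<lambda>s. x \<otimes>\<^bsub>G\<^esub> s) ` S \<union> (\<lambda>s. x \<otimes>\<^bsub>G\<^esub> inv\<^bsub>G\<^esub> s) ` S" using s(1) by blast
    qed
  qed (use S' in simp)
  have fin: "finite ((cayley_edges G S ^^ k) `` {u})" for k
  proof (induction k)
    case (Suc k)
    have "(cayley_edges G S ^^ Suc k) `` {u} = (\<Union>x\<in>(cayley_edges G S ^^ k) `` {u}. cayley_edges G S `` {x})" by auto
    then show ?case using Suc nbrs by simp
  qed simp
  have "{v \<in> carrier G. d u v \<le> n} \<subseteq> (\<Union>k\<le>n. (cayley_edges G S ^^ k) `` {u})"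
    using d_relpow[OF u] by auto
  then show ?thesis by (rule finite_subset) (use fin in simp)
qed

context vgraph
begin

lemma d_le_sum:
  assumes "\<And>i. i \<le> n \<Longrightarrow> f i \<in> V" "\<And>i. i < n \<Longrightarrow> d (f i) (f (Suc i)) \<le> c"
  shows "d (f 0) (f n) \<le> c * n"
  using assms
proof (induction n)
  case (Suc n)
  then have "d (f 0) (f (Suc n)) \<le> d (f 0) (f n) + d (f n) (f (Suc n))"
    by (intro d_triangle) auto
  moreover have "d (f 0) (f n) \<le> c * n" using Suc by simp
  moreover have "d (f n) (f (Suc n)) \<le> c" using Suc.prems(2)[of n] by simp
  ultimately show ?case by simp
qed simp

end

section \<open>Word metrics of a subgroup and of the ambient group\<close>

lemma subgroup_d_le:
  assumes G: "group G" "finite_generating_set G S" and H: "subgroup H G"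
    and T: "finite_generating_set (G\<lparr>carrier := H\<rparr>) T"
  obtains c where "\<And>x y. \<lbrakk>x \<in> H; y \<in> H\<rbrakk> \<Longrightarrow>
     vgraph.d (cayley_edges G S) x y \<le> c * vgraph.d (cayley_edges (G\<lparr>carrier := H\<rparr>) T) x y"
proof -
  interpret group G by fact
  let ?K = "G\<lparr>carrier := H\<rparr>"
  have K: "group ?K" using subgroup.subgroup_is_group[OF H G(1)] .
  interpret A: vgraph "carrier G" "cayley_edges G S" by (rule vgraph_cayley[OF G])
  interpret B: vgraph H "cayley_edges ?K T" using vgraph_cayley[OF K T] by simp
  have HG: "H \<subseteq> carrier G" using H by (rule subgroup.subset)
  have T': "finite T" "T \<subseteq> H" using T by (auto simp: finite_generating_set_def)
  \<comment> \<open>The bound is the longest generator of \<open>H\<close> measured in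
    \<open>G\<close>; the inserted 0 keeps the maximum meaningful if \<open>T\<close> is
    empty.\<close>
  define c where "c = Max (insert 0 ((\<lambda>t. A.d \<one>\<^bsub>G\<^esub> t) ` T))"
  have c: "A.d \<one>\<^bsub>G\<^esub> t \<le> c" if "t \<in> T" for t unfolding c_def using T' that by (intro Max_ge) auto
  have edge: "A.d x y \<le> c" if xy: "(x, y) \<in> cayley_edges ?K T" for x y
  proof -
    have step: "A.d x (x \<otimes>\<^bsub>G\<^esub> t) \<le> c" if "x \<in> H" "t \<in> T" for x t
    proof -
      have "x \<in> carrier G" "t \<in> carrier G" using that T' HG by auto
      then show ?thesis using cayley_d_left_mult_le[OF G, of x "\<one>\<^bsub>G\<^esub>" t] c[OF that(2)] by simp
    qed
    obtain t where t: "t \<in> T" "y = x \<otimes>\<^bsub>G\<^esub> t \<or> x = y \<otimes>\<^bsub>G\<^esub> t" "x \<in> H" "y \<in> H"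
      using xy by (auto simp: cayley_edges_def)
    moreover have "A.d x y = A.d y x" using t(3,4) HG by (intro A.d_sym) auto
    ultimately show ?thesis using step[of x t] step[of y t] by auto
  qed
  have "A.d x y \<le> c * B.d x y" if xy: "x \<in> H" "y \<in> H" for x y
  proof -
    obtain f where f: "B.discrete_geodesic (B.d x y) f" "f 0 = x" "f (B.d x y) = y"
      "\<And>i. i < B.d x y \<Longrightarrow> (f i, f (Suc i)) \<in> cayley_edges ?K T"
      by (rule B.discrete_geodesic_ex[OF xy], rule that) blast+
    have "f i \<in> carrier G" if "i \<le> B.d x y" for i using f(1) that HG unfolding B.discrete_geodesic_def by blast
    then show ?thesis using A.d_le_sum[of "B.d x y" f c] edge f by auto
  qed
  then show thesis by (rule that)
qed

text \<open>Projecting a geodesic of \<open>G\<close> to \<open>H\<close> produces at most as many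
  steps as its length, each joining points of \<open>H\<close> within \<open>1 + 2 * M\<close> in
  \<open>G\<close>. Translated to the identity, the steps range over a finite set, so their word
  length in \<open>H\<close> is bounded.\<close>

lemma subgroup_undistorted_if_discretely_quasiconvex:
  assumes G: "group G" "finite_generating_set G S" and H: "subgroup H G"
    and T: "finite_generating_set (G\<lparr>carrier := H\<rparr>) T"
    and qc: "vgraph.discretely_quasiconvex (carrier G) (cayley_edges G S) H"
  obtains c where "\<And>x y. \<lbrakk>x \<in> H; y \<in> H\<rbrakk> \<Longrightarrow>
     vgraph.d (cayley_edges (G\<lparr>carrier := H\<rparr>) T) x y \<le> c * vgraph.d (cayley_edges G S) x y"
proof -
  interpret group G by fact
  let ?K = "G\<lparr>carrier := H\<rparr>"
  have K: "group ?K" using subgroup.subgroup_is_group[OF H G(1)] .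
  interpret A: vgraph "carrier G" "cayley_edges G S" by (rule vgraph_cayley[OF G])
  interpret B: vgraph H "cayley_edges ?K T" using vgraph_cayley[OF K T] by simp
  have HG: "H \<subseteq> carrier G" using H by (rule subgroup.subset)
  have oneH: "\<one>\<^bsub>G\<^esub> \<in> H" using H by (rule subgroup.one_closed)
  then have ne: "H \<noteq> {}" by blast
  obtain M where M: "\<And>N v i. \<lbrakk>A.discrete_qg 1 0 N v; v 0 \<in> H; v N \<in> H; i \<le> N\<rbrakk> \<Longrightarrow> A.height H (v i) \<le> M"
    using qc unfolding A.discretely_quasiconvex_def by meson
  define D where "D = {h \<in> H. A.d \<one>\<^bsub>G\<^esub> h \<le> 1 + 2 * M}"
  have "finite D"
    by (rule finite_subset[OF _ finite_cayley_ball[OF G one_closed, of "1 + 2 * M"]]) (use HG in \<open>auto simp: D_def\<close>)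
  define c where "c = Max (insert 0 (B.d \<one>\<^bsub>G\<^esub> ` D))"
  have c: "B.d \<one>\<^bsub>G\<^esub> h \<le> c" if "h \<in> D" for h unfolding c_def using \<open>finite D\<close> that by (intro Max_ge) auto
  have near: "B.d x y \<le> c" if xy: "x \<in> H" "y \<in> H" and le: "A.d x y \<le> 1 + 2 * M" for x y
  proof -
    have inG: "x \<in> carrier G" "y \<in> carrier G" using xy HG by auto
    let ?h = "inv\<^bsub>G\<^esub> x \<otimes>\<^bsub>G\<^esub> y"
    have hH: "?h \<in> H" using xy H by (simp add: subgroup.m_closed subgroup.m_inv_closed)
    have "A.d (inv\<^bsub>G\<^esub> x \<otimes>\<^bsub>G\<^esub> x) ?h \<le> A.d x y"
      by (rule cayley_d_left_mult_le[OF G]) (use inG in auto)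
    then have "?h \<in> D" using hH le inG by (simp add: D_def)
    have xh: "x \<otimes>\<^bsub>G\<^esub> ?h = y" using inG m_assoc[of x "inv\<^bsub>G\<^esub> x" y] by simp
    have "B.d (x \<otimes>\<^bsub>?K\<^esub> \<one>\<^bsub>G\<^esub>) (x \<otimes>\<^bsub>?K\<^esub> ?h) \<le> B.d \<one>\<^bsub>G\<^esub> ?h"
      by (rule cayley_d_left_mult_le[OF K T]) (use xy hH oneH in auto)
    then show ?thesis using c[OF \<open>?h \<in> D\<close>] xh inG by simp
  qed
  have "B.d x y \<le> c * A.d x y" if xy: "x \<in> H" "y \<in> H" for x y
  proof -
    have xyG: "x \<in> carrier G" "y \<in> carrier G" using xy HG by auto
    obtain f where f: "A.discrete_geodesic (A.d x y) f" "f 0 = x" "f (A.d x y) = y"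
      by (rule A.discrete_geodesic_ex[OF xyG], rule that) blast+
    let ?n = "A.d x y"
    have fV: "f i \<in> carrier G" if "i \<le> ?n" for i using f(1) that unfolding A.discrete_geodesic_def by blast
    have fM: "A.height H (f i) \<le> M" if "i \<le> ?n" for i
      using M[OF A.geodesic_qg[OF f(1)] _ _ that] f xy by simp
    define u where "u i = A.proj H (f i)" for i
    have uH: "u i \<in> H" for i unfolding u_def by (rule A.proj(1)[OF ne])
    have "B.d (u i) (u (Suc i)) \<le> c" if i: "i < ?n" for i
    proof (rule near[OF uH uH])
      have "A.d (f i) (f (Suc i)) = Suc i - i" using f(1) i unfolding A.discrete_geodesic_def by (metis Suc_leI le_SucI order_refl)
      then show "A.d (u i) (u (Suc i)) \<le> 1 + 2 * M"
        using A.d_proj(1)[OF HG ne fV[of i] fV[of "Suc i"] fM[of i] fM[of "Suc i"]] i unfolding u_def by simp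
    qed
    then have "B.d (u 0) (u ?n) \<le> c * ?n" using uH by (intro B.d_le_sum)
    \<comment> \<open>The projection fixes points of \<open>H\<close>, so the projected path still
      runs from \<open>x\<close> to \<open>y\<close>.\<close>
    then show ?thesis unfolding u_def f(2,3) using A.proj_id[OF HG xy(1)] A.proj_id[OF HG xy(2)] by simp
  qed
  then show thesis by (rule that)
qed

lemma undistorted_iff_comparable:
  assumes G: "group G" "finite_generating_set G S" and H: "subgroup H G"
  shows "undistorted G S H \<longleftrightarrow> (\<exists>T c0 e0. finite_generating_set (G\<lparr>carrier := H\<rparr>) T \<and>
     comparable_graphs (carrier G) (cayley_edges G S) H (cayley_edges (G\<lparr>carrier := H\<rparr>) T) c0 e0)"
proof -
  let ?K = "G\<lparr>carrier := H\<rparr>"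
  have K: "group ?K" using subgroup.subgroup_is_group[OF H G(1)] .
  have HG: "H \<subseteq> carrier G" using H by (rule subgroup.subset)
  have "(\<exists>K\<ge>1. \<exists>L\<ge>0. quasi_isometric_embedding K L (submetric (cayley_graph ?K T) (vertex ` H)) (cayley_graph G S) (\<lambda>x. x)) \<longleftrightarrow>
     (\<exists>c0 e0. comparable_graphs (carrier G) (cayley_edges G S) H (cayley_edges ?K T) c0 e0)" (is "?L \<longleftrightarrow> ?R")
    if T: "finite_generating_set ?K T" for T
  proof -
    interpret A: vgraph "carrier G" "cayley_edges G S" by (rule vgraph_cayley[OF G])
    interpret B: vgraph H "cayley_edges ?K T" using vgraph_cayley[OF K T] by simp
    have eqA: "cayley_graph G S = A.realisation" by (rule cayley_graph_eq_realisation[OF G])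
    have eqB: "cayley_graph ?K T = B.realisation" using cayley_graph_eq_realisation[OF K T] by simp
    have dA: "mdist (cayley_graph G S) (vertex x) (vertex y) = real (A.d x y)"
      and dB: "mdist (submetric (cayley_graph ?K T) (vertex ` H)) (vertex x) (vertex y) = real (B.d x y)"
      if "x \<in> H" "y \<in> H" for x y
      using A.mdist_vertex[of x y] B.mdist_vertex[OF that] subsetD[OF HG that(1)] subsetD[OF HG that(2)]
      unfolding eqA eqB by auto
    have dom: "mspace (submetric (cayley_graph ?K T) (vertex ` H)) = vertex ` H"
      unfolding eqB by auto
    have ran: "vertex ` H \<subseteq> mspace (cayley_graph G S)" unfolding eqA using HG by auto
    show ?thesis
    proof
      assume ?L
      then obtain K L :: real where KL: "K \<ge> 1" "L \<ge> 0"
        and qi: "\<And>x y. \<lbrakk>x \<in> H; y \<in> H\<rbrakk> \<Longrightarrow> real (B.d x y) / K - L \<le> real (A.d x y) \<and> real (A.d x y) \<le> K * real (B.d x y) + L"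
        unfolding quasi_isometric_embedding_def dom using dA dB by fastforce
      define c0 where "c0 = nat \<lceil>K\<rceil>"
      define e0 where "e0 = nat \<lceil>K * L + L\<rceil>"
      have c0: "K \<le> real c0" and e0: "K * L + L \<le> real e0" unfolding c0_def e0_def by linarith+
      have KL0: "0 \<le> K * L" using KL by simp
      have "A.d x y \<le> c0 * B.d x y + e0 \<and> B.d x y \<le> c0 * A.d x y + e0" if xy: "x \<in> H" "y \<in> H" for x y
      proof
        have "real (A.d x y) \<le> real c0 * real (B.d x y) + real e0"
          using qi[OF xy] mult_right_mono[OF c0, of "real (B.d x y)"] e0 KL0 by linarith
        then show "A.d x y \<le> c0 * B.d x y + e0" by (metis of_nat_add of_nat_le_iff of_nat_mult)
        have "real (B.d x y) / K \<le> real (A.d x y) + L" using qi[OF xy] by linarith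
        then have "real (B.d x y) \<le> K * real (A.d x y) + K * L" using KL by (simp add: divide_le_eq algebra_simps)
        then have "real (B.d x y) \<le> real c0 * real (A.d x y) + real e0"
          using mult_right_mono[OF c0, of "real (A.d x y)"] e0 KL by linarith
        then show "B.d x y \<le> c0 * A.d x y + e0" by (metis of_nat_add of_nat_le_iff of_nat_mult)
      qed
      then have "comparable_graphs (carrier G) (cayley_edges G S) H (cayley_edges ?K T) c0 e0"
        using HG by unfold_locales auto
      then show ?R by blast
    next
      assume ?R
      then obtain c0 e0 where "comparable_graphs (carrier G) (cayley_edges G S) H (cayley_edges ?K T) c0 e0" by blast
      then interpret C: comparable_graphs "carrier G" "cayley_edges G S" H "cayley_edges ?K T" c0 e0 .
      \<comment> \<open>The multiplicative constant has to be at least 1 and \<open>c0\<close> might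
        be 0.\<close>
      have "real (B.d x y) / real (c0 + 1) - real e0 \<le> real (A.d x y) \<and> real (A.d x y) \<le> real (c0 + 1) * real (B.d x y) + real e0"
        if xy: "x \<in> H" "y \<in> H" for x y
      proof
        have "real (A.d x y) \<le> real (c0 * B.d x y + e0)" using C.A_le[OF xy] by (simp only: of_nat_le_iff)
        then show "real (A.d x y) \<le> real (c0 + 1) * real (B.d x y) + real e0" by (simp add: algebra_simps)
        have "real (B.d x y) \<le> real (c0 * A.d x y + e0)" using C.B_le[OF xy] by (simp only: of_nat_le_iff)
        also have "\<dots> \<le> (real (A.d x y) + real e0) * real (c0 + 1)" by (simp add: algebra_simps)
        finally have "real (B.d x y) / real (c0 + 1) \<le> real (A.d x y) + real e0"
          by (subst pos_divide_le_eq) auto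
        then show "real (B.d x y) / real (c0 + 1) - real e0 \<le> real (A.d x y)" by linarith
      qed
      then have "quasi_isometric_embedding (real (c0 + 1)) (real e0) (submetric (cayley_graph ?K T) (vertex ` H)) (cayley_graph G S) (\<lambda>x. x)"
        unfolding quasi_isometric_embedding_def dom using ran dA dB by auto
      then show ?L by (intro exI[of _ "real (c0 + 1)"] conjI exI[of _ "real e0"]) auto
    qed
  qed
  then show ?thesis unfolding undistorted_def by blast
qed

theorem theorem4p8:
  fixes G :: "('a, 'b) monoid_scheme" and S H :: "'a set"
  assumes "group G" and "finite_generating_set G S"
    and "subgroup H G" and "infinite H"
  shows "(stable_subgroup G S H \<longleftrightarrow>
            hyperbolic_group (G\<lparr>carrier := H\<rparr>) \<and> strongly_quasiconvex G S H) \<and>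
         (hyperbolic_group (G\<lparr>carrier := H\<rparr>) \<and> strongly_quasiconvex G S H \<longleftrightarrow>
            hyperbolic_group (G\<lparr>carrier := H\<rparr>) \<and>
            completely_super_linear_family (lower_relative_divergence G S H))"
proof -
  note G = assms(1,2) and H = assms(3)
  let ?K = "G\<lparr>carrier := H\<rparr>"
  have K: "group ?K" using subgroup.subgroup_is_group[OF H G(1)] .
  interpret A: vgraph "carrier G" "cayley_edges G S" by (rule vgraph_cayley[OF G])
  have HG: "H \<subseteq> carrier G" using H by (rule subgroup.subset)
  have ne: "H \<noteq> {}" using subgroup.one_closed[OF H] by blast
  have eqA: "cayley_graph G S = A.realisation" by (rule cayley_graph_eq_realisation[OF G])
  have sqc: "strongly_quasiconvex G S H \<longleftrightarrow> A.discretely_quasiconvex H"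
    unfolding strongly_quasiconvex_def eqA by (rule A.strongly_quasiconvex_iff_discretely_quasiconvex[OF HG ne])
  have stable: "stable_subgroup G S H \<longleftrightarrow> undistorted G S H \<and> A.discretely_stable H"
    unfolding stable_subgroup_def eqA A.stable_iff_discretely_stable[OF HG] ..
  \<comment> \<open>Conditions (2) and (3) share the hyperbolicity clause, so their equivalence is
    the one between the remaining clauses.\<close>
  have divergence: "completely_super_linear_family (lower_relative_divergence G S H) \<longleftrightarrow> A.discretely_quasiconvex H"
    unfolding lower_relative_divergence_def eqA
    using A.super_linear_if_discretely_quasiconvex[OF HG ne] A.superlinear_divergence_if_super_linear[OF HG ne] A.divergence_imp_discretely_quasiconvex[OF HG ne] by blast
  have "hyperbolic_group ?K \<and> A.discretely_quasiconvex H" if stab: "undistorted G S H" "A.discretely_stable H"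
  proof -
    obtain T c0 e0 where T: "finite_generating_set ?K T"
      and "comparable_graphs (carrier G) (cayley_edges G S) H (cayley_edges ?K T) c0 e0"
      using stab(1) unfolding undistorted_iff_comparable[OF G H] by blast
    then interpret C: comparable_graphs "carrier G" "cayley_edges G S" H "cayley_edges ?K T" c0 e0 by simp
    have "Gromov_hyperbolic C.B.realisation" by (rule C.B.hyperbolic_if_thin_bigons[OF C.thin_bigons_if_discretely_stable[OF stab(2)]])
    then have "hyperbolic_group ?K" unfolding hyperbolic_group_def using T cayley_graph_eq_realisation[OF K T] by auto
    then show ?thesis using C.discretely_quasiconvex_if_discretely_stable[OF stab(2)] by simp
  qed
  moreover have "undistorted G S H \<and> A.discretely_stable H" if "hyperbolic_group ?K" and qc: "A.discretely_quasiconvex H"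
  proof -
    obtain T where T: "finite_generating_set ?K T" "Gromov_hyperbolic (cayley_graph ?K T)"
      using \<open>hyperbolic_group ?K\<close> unfolding hyperbolic_group_def by blast
    interpret B: vgraph H "cayley_edges ?K T" using vgraph_cayley[OF K T(1)] by simp
    obtain c where c: "\<And>x y. \<lbrakk>x \<in> H; y \<in> H\<rbrakk> \<Longrightarrow> A.d x y \<le> c * B.d x y"
      using subgroup_d_le[OF G H T(1)] by blast
    obtain c' where c': "\<And>x y. \<lbrakk>x \<in> H; y \<in> H\<rbrakk> \<Longrightarrow> B.d x y \<le> c' * A.d x y"
      using subgroup_undistorted_if_discretely_quasiconvex[OF G H T(1) qc] by blast
    interpret C: comparable_graphs "carrier G" "cayley_edges G S" H "cayley_edges ?K T" "c + c'" 0
    proof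
      fix x y assume xy: "x \<in> H" "y \<in> H"
      show "A.d x y \<le> (c + c') * B.d x y + 0" "B.d x y \<le> (c + c') * A.d x y + 0"
        using c[OF xy] c'[OF xy] by (auto simp: distrib_right intro: trans_le_add1 trans_le_add2)
    qed (rule HG)
    obtain \<delta> where "B.slim_intervals \<delta>"
      using B.slim_intervals_if_hyperbolic T(2) cayley_graph_eq_realisation[OF K T(1)] by auto
    then have "A.discretely_stable H" using C.discretely_stable_if_thin_bigons[OF qc B.slim_intervals_imp_thin_bigons] by blast
    moreover have "undistorted G S H"
      unfolding undistorted_iff_comparable[OF G H] using T(1) C.comparable_graphs_axioms by blast
    ultimately show ?thesis by simp
  qed
  ultimately show ?thesis unfolding sqc stable divergence by blast
qed

end
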